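(* Let $\mathcal{Y}$ be a nonempty measurable space and $\mathcal{H}$ a nonempty set of measurable functions $\mathbb{R}\to\mathcal{Y}$ satisfying the zero-measure crossings property with graph dimension $d\in(0,\infty)$. Fix $\varepsilon\in(0,1/2)$ and $k\in\mathbb{N}$ with $k\ge 80/\varepsilon$. For appropriate choices of the numerical constants $c,c',c''\ge1$, the procedure that runs the sampling procedure below, queries $f$ at the $m(\ell+1)$ points $x_i$ and $x'_{ij}$ ($i\le m$, $j\le \ell$), and outputs accept if $\widehat{\mathrm{NS}}_\delta(f;\mathcal{H})\le (k-1)\frac{\delta}{2}(1+\frac{\varepsilon}{8})$ and reject otherwise, is an $s$-sample $q$-query $\varepsilon$-tester for $\mathcal{F}_k(\mathcal{H})$ under $\mathrm{Uniform}(0,1)$, with $s$ as defined below and $q=m(\ell+1)$.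
   Context: Zero-measure crossings: distinct $h,h'\in\mathcal{H}$ agree only on a Lebesgue-null set. Graph dimension $d$: VC dimension of $\{\{(x,h(x)):x\in\mathbb{R}\}:h\in\mathcal{H}\}$. $\mathcal{F}_k(\mathcal{H})$: with $t_0=-\infty$, $t_k=\infty$, all functions $x\mapsto h_i(x)$ for the $i$ with $t_{i-1}<x\le t_i$, over all $t_1\le\cdots\le t_{k-1}$ and $h_1,\dots,h_k\in\mathcal{H}$. $\mathrm{dist}(f,g)=P(x:f(x)\ne g(x))$ with $P=\mathrm{Uniform}(0,1)$, $\mathrm{dist}(f,\mathcal{F})=\inf_{g\in\mathcal{F}}\mathrm{dist}(f,g)$. An $s$-sample $q$-query $\varepsilon$-tester for $\mathcal{F}$ under $P$: a randomized algorithm drawing at most $s$ i.i.d. points from $P$, sequentially querying the target $f$ on at most $q$ of them, and outputting accept/reject so that for every measurable $f$: if $f\in\mathcal{F}$ it accepts w.p. $\ge2/3$, and if $\mathrm{dist}(f,\mathcal{F})\ge\varepsilon$ it rejects w.p. $\ge2/3$. Sampling procedure: $m=\lceil c/\varepsilon^4\rceil$, $\ell=\lceil \frac{c' d}{\varepsilon^4}\ln(\frac{c''}{\varepsilon})\rceil$, $\delta=\frac{\varepsilon^2}{32k}$, $s=m+\lceil\max\{\frac{2\ell}{\delta},\frac{8}{\delta}\ln(12m)\}\rceil$. Draw $x''_1,\dots,x''_s$ i.i.d. $\mathrm{Uniform}(0,1)$, set $x_i=x''_i$ for $i\le m$; for each $i\le m$, $t_{i0}=m$ and $t_{ij}=\min\{t\in\{t_{i(j-1)}+1,\dots,s\}:x''_t\in(x_i-\delta,x_i+\delta)\}$,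 $x'_{ij}=x''_{t_{ij}}$ ($j\le\ell$); if some $t_{ij}$ does not exist the procedure may output anything. With $\mathcal{H}_{(x,y)}=\{h\in\mathcal{H}:h(x)=y\}$, $\widehat{\mathrm{NS}}_\delta(f,x_i;\mathcal{H})=\min_{h\in\mathcal{H}_{(x_i,f(x_i))}}\frac1\ell\sum_{j=1}^\ell\mathbb{1}[h(x'_{ij})\ne f(x'_{ij})]$ (or $1$ if that set is empty), and $\widehat{\mathrm{NS}}_\delta(f;\mathcal{H})=\frac1m\sum_{i=1}^m\widehat{\mathrm{NS}}_\delta(f,x_i;\mathcal{H})$.
   Formalization: Adds the usual VC measurability proviso, without which the claim can fail: for measurable f, each set {h=f} with h in H is Borel, and the event that some h in H has a given agreement pattern with f on an i.i.d. sample is measurable in the completed product space. *)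

theory Defs
  imports "HOL-Probability.Probability" "HOL-Library.Extended_Nat"
begin

section \<open>Function classes\<close>

definition zero_measure_crossings :: "(real \<Rightarrow> 'y) set \<Rightarrow> bool" where
  "zero_measure_crossings H \<longleftrightarrow>
     (\<forall>h\<in>H. \<forall>h'\<in>H. h \<noteq> h' \<longrightarrow> {x. h x = h' x} \<in> null_sets lebesgue)"

definition shatters :: "'a set set \<Rightarrow> 'a set \<Rightarrow> bool" where
  "shatters C A \<longleftrightarrow> (\<forall>B\<subseteq>A. \<exists>S\<in>C. S \<inter> A = B)"

definition vc_dim :: "'a set set \<Rightarrow> enat" where
  "vc_dim C = (SUP A\<in>{A. finite A \<and> shatters C A}. enat (card A))"

definition graph_dim :: "(real \<Rightarrow> 'y) set \<Rightarrow> enat" where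
  "graph_dim H = vc_dim ((\<lambda>h. {(x, h x) |x. True}) ` H)"

definition piecewise :: "nat \<Rightarrow> (real \<Rightarrow> 'y) set \<Rightarrow> (real \<Rightarrow> 'y) set" where
  "piecewise k H = {g. \<exists>(t :: nat \<Rightarrow> ereal) h.
     t 0 = -\<infinity> \<and> t k = \<infinity> \<and> (\<forall>i\<in>{1..<k}. t i \<in> range ereal) \<and> mono_on {0..k} t \<and>
     (\<forall>i\<in>{1..k}. h i \<in> H) \<and>
     (\<forall>x. \<forall>i\<in>{1..k}. t (i - 1) < ereal x \<and> ereal x \<le> t i \<longrightarrow> g x = h i x)}"

definition consistent :: "(real \<Rightarrow> 'y) set \<Rightarrow> real \<Rightarrow> 'y \<Rightarrow> (real \<Rightarrow> 'y) set" where
  "consistent H x y = {h \<in> H. h x = y}"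

abbreviation uniform01 :: "real measure" where
  "uniform01 \<equiv> uniform_measure lborel {0<..<1}"

text \<open>The usual measurability proviso of VC theory.  The first part says that
  \<open>P (x : f x \<noteq> h x)\<close> is the probability of an event.  The second part says that, for a
  measurable target \<open>f\<close>, realisability of an agreement pattern \<open>S\<close> by some \<open>h \<in> H\<close> on an i.i.d.
  sample is an event of the completed sample space.  The first part holds if the diagonal of \<open>Y\<close>
  is measurable; given that, the second holds for countable \<open>H\<close> and, more generally, for
  image-admissible Suslin classes.

  Uniform convergence over \<open>H\<close> fails without such a proviso.  Under the continuum hypothesis,
  well-order the interval \<open>(0,1)\<close> in type \<open>\<omega>\<^sub>1\<close> and, for \<open>a \<in> (0,1)\<close>, let \<open>h\<^sub>a\<close> be \<open>0\<close> on the
  countable set of predecessors of \<open>a\<close> and constantly \<open>a\<close> elsewhere.  This class has zero-measure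
  crossings and graph dimension \<open>1\<close>; the target \<open>0\<close> is at distance \<open>1\<close> from all its piecewise
  combinations, but on every finite sample it agrees with some \<open>h\<^sub>a\<close>.\<close>

definition measurably_well_behaved :: "'y measure \<Rightarrow> (real \<Rightarrow> 'y) set \<Rightarrow> bool" where
  "measurably_well_behaved Y H \<longleftrightarrow> (\<forall>f \<in> borel \<rightarrow>\<^sub>M Y.
     (\<forall>h\<in>H. {x. h x = f x} \<in> sets borel) \<and>
     (\<forall>n::nat. \<forall>S\<subseteq>{..<n}.
        {x \<in> space (PiM {..<n} (\<lambda>_. uniform01)). \<exists>h\<in>H. \<forall>i<n. h (x i) = f (x i) \<longleftrightarrow> i \<in> S}
          \<in> sets (completion (PiM {..<n} (\<lambda>_. uniform01)))))"


section \<open>Testers\<close>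

definition fdist :: "real measure \<Rightarrow> (real \<Rightarrow> 'y) \<Rightarrow> (real \<Rightarrow> 'y) \<Rightarrow> real" where
  "fdist P f g = measure P {x \<in> space P. f x \<noteq> g x}"

definition dist_class :: "real measure \<Rightarrow> (real \<Rightarrow> 'y) \<Rightarrow> (real \<Rightarrow> 'y) set \<Rightarrow> real" where
  "dist_class P f F = (INF g\<in>F. fdist P f g)"

text \<open>Adaptive query strategies: \<open>Query i c\<close> asks for the label of the \<open>i\<close>-th sample point and
  continues with \<open>c y\<close> on answer \<open>y\<close>.\<close>

datatype 'y strategy = Output bool | Query nat "'y \<Rightarrow> 'y strategy"

primrec run :: "'y strategy \<Rightarrow> (nat \<Rightarrow> 'y) \<Rightarrow> bool" where
  "run (Output b) lab = b"
| "run (Query i c) lab = run (c (lab i)) lab"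

primrec query_bounded :: "'y strategy \<Rightarrow> nat set \<Rightarrow> nat \<Rightarrow> bool" where
  "query_bounded (Output b) I q = True"
| "query_bounded (Query i c) I q = (i \<in> I \<and> q > 0 \<and> (\<forall>y. query_bounded (c y) I (q - 1)))"

text \<open>For an event \<open>E\<close> this is \<open>measure M E \<ge> p\<close>; in general it bounds the inner probability of
  \<open>E\<close>.  The general case matters because the behaviour of an algorithm on a set of small
  probability may be arbitrary, hence non-measurable.\<close>

definition prob_at_least :: "'a measure \<Rightarrow> real \<Rightarrow> 'a set \<Rightarrow> bool" where
  "prob_at_least M p E \<longleftrightarrow> (\<exists>A\<in>sets M. A \<subseteq> E \<and> measure M A \<ge> p)"

text \<open>\<open>R\<close> is the distribution of the internal randomness.  The algorithm \<open>A\<close> sees the seed and the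
  sample \<open>x 1, \<dots>, x s\<close>, but accesses the target only through the labels it queries.  An algorithm
  that draws fewer than \<open>s\<close> points is one that ignores some of them.\<close>

definition is_tester ::
  "real measure \<Rightarrow> 'y measure \<Rightarrow> (real \<Rightarrow> 'y) set \<Rightarrow> nat \<Rightarrow> nat \<Rightarrow> real \<Rightarrow>
   'w measure \<Rightarrow> ('w \<Rightarrow> (nat \<Rightarrow> real) \<Rightarrow> 'y strategy) \<Rightarrow> bool" where
  "is_tester P Y F s q \<epsilon> R A \<longleftrightarrow>
     prob_space R \<and>
     (\<forall>\<omega>\<in>space R. \<forall>x\<in>space (PiM {1..s} (\<lambda>_. P)). query_bounded (A \<omega> x) {1..s} q) \<and>
     (\<forall>f \<in> P \<rightarrow>\<^sub>M Y.
        let M = R \<Otimes>\<^sub>M PiM {1..s} (\<lambda>_. P);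
            accepts = (\<lambda>(\<omega>, x). run (A \<omega> x) (\<lambda>i. f (x i)))
        in (f \<in> F \<longrightarrow> prob_at_least M (2/3) {z \<in> space M. accepts z}) \<and>
           (dist_class P f F \<ge> \<epsilon> \<longrightarrow> prob_at_least M (2/3) {z \<in> space M. \<not> accepts z}))"


section \<open>The noise-sensitivity procedure\<close>

definition num_centres :: "real \<Rightarrow> real \<Rightarrow> nat" where
  "num_centres c \<epsilon> = nat \<lceil>c / \<epsilon> ^ 4\<rceil>"

definition num_neighbours :: "real \<Rightarrow> real \<Rightarrow> nat \<Rightarrow> real \<Rightarrow> nat" where
  "num_neighbours c' c'' d \<epsilon> = nat \<lceil>c' * real d / \<epsilon> ^ 4 * ln (c'' / \<epsilon>)\<rceil>"

definition radius :: "real \<Rightarrow> nat \<Rightarrow> real" where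
  "radius \<epsilon> k = \<epsilon>\<^sup>2 / (32 * real k)"

definition sample_size :: "nat \<Rightarrow> nat \<Rightarrow> real \<Rightarrow> nat" where
  "sample_size m l \<delta> = m + nat \<lceil>max (2 * real l / \<delta>) (8 / \<delta> * ln (12 * real m))\<rceil>"

text \<open>The sample is \<open>x 1, \<dots>, x s\<close>, with centres \<open>x 1, \<dots>, x m\<close>;
  \<open>neighbour m s \<delta> x i j\<close> is the index \<open>t\<^sub>i\<^sub>j\<close>, if it exists.\<close>

primrec neighbour :: "nat \<Rightarrow> nat \<Rightarrow> real \<Rightarrow> (nat \<Rightarrow> real) \<Rightarrow> nat \<Rightarrow> nat \<Rightarrow> nat option" where
  "neighbour m s \<delta> x i 0 = Some m"
| "neighbour m s \<delta> x i (Suc j) =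
     (case neighbour m s \<delta> x i j of
        None \<Rightarrow> None
      | Some t' \<Rightarrow>
          let T = {t \<in> {t' + 1..s}. x t \<in> {x i - \<delta><..<x i + \<delta>}}
          in if T = {} then None else Some (Min T))"

text \<open>In the estimators, \<open>t i j\<close> is the index of the \<open>j\<close>-th neighbour of \<open>x i\<close>, and \<open>lab n\<close> is the
  label \<open>f (x n)\<close>.  The minimum ranges over a set of multiples of \<open>1/l\<close> in \<open>[0,1]\<close>, which is
  finite even for infinite \<open>H\<close>.\<close>

definition NS_hat_at ::
  "(real \<Rightarrow> 'y) set \<Rightarrow> nat \<Rightarrow> (nat \<Rightarrow> nat \<Rightarrow> nat) \<Rightarrow> (nat \<Rightarrow> real) \<Rightarrow> (nat \<Rightarrow> 'y) \<Rightarrow> nat \<Rightarrow> real" where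
  "NS_hat_at H l t x lab i =
     (if consistent H (x i) (lab i) = {} then 1
      else Min ((\<lambda>h. 1 / real l * (\<Sum>j=1..l. of_bool (h (x (t i j)) \<noteq> lab (t i j))))
                  ` consistent H (x i) (lab i)))"

definition NS_hat ::
  "(real \<Rightarrow> 'y) set \<Rightarrow> nat \<Rightarrow> nat \<Rightarrow> (nat \<Rightarrow> nat \<Rightarrow> nat) \<Rightarrow> (nat \<Rightarrow> real) \<Rightarrow> (nat \<Rightarrow> 'y) \<Rightarrow> real" where
  "NS_hat H m l t x lab = 1 / real m * (\<Sum>i=1..m. NS_hat_at H l t x lab i)"

primrec query_all :: "nat list \<Rightarrow> (nat \<Rightarrow> 'y) \<Rightarrow> ((nat \<Rightarrow> 'y) \<Rightarrow> bool) \<Rightarrow> 'y strategy" where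
  "query_all [] lab D = Output (D lab)"
| "query_all (n # ns) lab D = Query n (\<lambda>y. query_all ns (lab(n := y)) D)"

text \<open>The parameter \<open>fallback\<close> is the arbitrary behaviour in case some \<open>t\<^sub>i\<^sub>j\<close> does not exist.\<close>

definition NS_procedure ::
  "(real \<Rightarrow> 'y) set \<Rightarrow> nat \<Rightarrow> real \<Rightarrow> nat \<Rightarrow> nat \<Rightarrow> real \<Rightarrow> nat \<Rightarrow>
   ('w \<Rightarrow> (nat \<Rightarrow> real) \<Rightarrow> 'y strategy) \<Rightarrow> 'w \<Rightarrow> (nat \<Rightarrow> real) \<Rightarrow> 'y strategy" where
  "NS_procedure H k \<epsilon> m l \<delta> s fallback \<omega> x =
     (if \<forall>i\<in>{1..m}. \<forall>j\<in>{1..l}. neighbour m s \<delta> x i j \<noteq> None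
      then let t = (\<lambda>i j. the (neighbour m s \<delta> x i j))
           in query_all (concat (map (\<lambda>i. i # map (t i) [1..<l + 1]) [1..<m + 1])) (\<lambda>_. undefined)
                (\<lambda>lab. NS_hat H m l t x lab \<le> (real k - 1) * (\<delta> / 2) * (1 + \<epsilon> / 8))
      else fallback \<omega> x)"

end

theory Submission
  imports Defs
begin

text \<open>
  For a centre \<open>x\<close> let \<open>p\<^sub>h(x)\<close> be the fraction of the window \<open>(x - \<delta>, x + \<delta>)\<close> on which \<open>h\<close> agrees with
  the target \<open>f\<close>.  Zero-measure crossings make the agreement sets almost disjoint, so the \<open>p\<^sub>h(x)\<close> add up
  to at most \<open>1\<close>, and each \<open>p\<^sub>h\<close> is Lipschitz with constant \<open>1/(2\<delta>)\<close>.

  If \<open>f\<close> is piecewise in \<open>H\<close>, the hypothesis of the piece containing \<open>x\<close> errs only near a breakpoint, and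
  each breakpoint contributes \<open>\<delta>/2\<close> to the average.  Conversely, call \<open>x\<close> determined by \<open>h\<close> if
  \<open>p\<^sub>h(x) > 1 - \<tau>\<close>.  Between points determined by different hypotheses some \<open>p\<^sub>h\<close> takes the value \<open>1/2\<close>,
  so by the Lipschitz bound each change costs almost \<open>\<delta>/2\<close>.  Low sensitivity therefore allows only
  slightly more than \<open>k - 1\<close> changes, and dropping the shortest pieces gives an element of
  \<open>piecewise k H\<close> close to \<open>f\<close>.  All this tolerates an additive error \<open>\<epsilon>/128\<close> in every local
  sensitivity that exceeds it.

  Such an additive error is what uniform convergence for the agreement sets gives: they form a class of VC
  dimension at most \<open>d\<close>, and the sample in a window, being the first \<open>l\<close> hits, is conditionally i.i.d. given
  their positions.  The remaining randomness, in the centres, is handled by Chebyshev's inequality.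
\<close>

section \<open>Shattering\<close>

lemma vc_dim_le_iff: "vc_dim C \<le> enat d \<longleftrightarrow> (\<forall>A. finite A \<longrightarrow> shatters C A \<longrightarrow> card A \<le> d)"
  by (auto simp: vc_dim_def SUP_le_iff)

lemma shatters_vimage:
  assumes sh: "shatters ((\<lambda>S. z -` S \<inter> N) ` C) J"
  shows "shatters C (z ` J)" and "inj_on z J"
proof -
  have ex: "\<exists>S'\<in>(\<lambda>S. z -` S \<inter> N) ` C. S' \<inter> J = B" if "B \<subseteq> J" for B
    using sh that unfolding shatters_def by simp
  have JN: "J \<subseteq> N" using ex[OF order.refl] by blast
  have trace: "\<exists>S\<in>C. \<forall>j\<in>J. z j \<in> S \<longleftrightarrow> j \<in> B" if B: "B \<subseteq> J" for B
  proof -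
    obtain S where S: "S \<in> C" "z -` S \<inter> N \<inter> J = B" using ex[OF B] by (elim bexE imageE) simp
    have "z j \<in> S \<longleftrightarrow> j \<in> B" if "j \<in> J" for j using S(2) JN that by blast
    then show ?thesis using S(1) by blast
  qed
  show "inj_on z J"
  proof (rule inj_onI)
    fix i j assume ij: "i \<in> J" "j \<in> J" "z i = z j"
    have "{i} \<subseteq> J" using ij by simp
    from trace[OF this] obtain S where "\<forall>j\<in>J. z j \<in> S \<longleftrightarrow> j \<in> {i}" by (elim bexE)
    then have "z i \<in> S" "z j \<in> S \<longleftrightarrow> j = i" using ij(1,2) by auto
    then show "i = j" using ij(3) by metis
  qed
  show "shatters C (z ` J)" unfolding shatters_def
  proof (intro allI impI)
    fix B assume B: "B \<subseteq> z ` J"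
    have "{j \<in> J. z j \<in> B} \<subseteq> J" by simp
    from trace[OF this] obtain S where S: "S \<in> C" "\<forall>j\<in>J. z j \<in> S \<longleftrightarrow> j \<in> {j \<in> J. z j \<in> B}"
      by (elim bexE)
    then have "S \<inter> z ` J = B" using B by blast
    then show "\<exists>S\<in>C. S \<inter> z ` J = B" using S(1) by blast
  qed
qed

lemma vc_dim_vimage_le: "vc_dim ((\<lambda>S. z -` S \<inter> N) ` C) \<le> vc_dim C"
  unfolding vc_dim_def[of "(\<lambda>S. z -` S \<inter> N) ` C"]
proof (rule SUP_least)
  fix J assume "J \<in> {A. finite A \<and> shatters ((\<lambda>S. z -` S \<inter> N) ` C) A}"
  then have J: "finite J" "shatters ((\<lambda>S. z -` S \<inter> N) ` C) J" by auto
  have "enat (card (z ` J)) \<le> vc_dim C"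
    unfolding vc_dim_def using J shatters_vimage(1)[OF J(2)] by (intro SUP_upper) auto
  then show "enat (card J) \<le> vc_dim C" by (simp add: card_image shatters_vimage(2)[OF J(2)])
qed

lemma card_eq_card_remove_add:
  assumes "finite C"
  shows "card C = card ((\<lambda>S. S - {x}) ` C) + card {S \<in> C. x \<notin> S \<and> insert x S \<in> C}"
proof -
  let ?X = "{S \<in> C. x \<in> S}" and ?Y = "{S \<in> C. x \<notin> S}"
  let ?X' = "(\<lambda>S. S - {x}) ` ?X"
  have "card C = card ?X + card ?Y"
    using assms by (subst card_Un_disjoint[symmetric]) (auto intro!: arg_cong[where f=card])
  also have "card ?X = card ?X'" by (subst card_image) (auto simp: inj_on_def)
  also have "card ?X' + card ?Y = card (?X' \<union> ?Y) + card (?X' \<inter> ?Y)"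
    using assms by (intro card_Un_Int) auto
  also have "?X' \<union> ?Y = (\<lambda>S. S - {x}) ` C"
  proof -
    have "(\<lambda>S. S - {x}) ` ?Y = ?Y" by simp
    then have "?X' \<union> ?Y = (\<lambda>S. S - {x}) ` (?X \<union> ?Y)" by (simp only: image_Un)
    then show ?thesis by (simp add: Un_def flip: conj_disj_distribL)
  qed
  also have "?X' \<inter> ?Y = {S \<in> C. x \<notin> S \<and> insert x S \<in> C}" by (auto simp: image_iff insert_absorb)
  finally show ?thesis .
qed

lemma shatters_remove:
  assumes "shatters ((\<lambda>S. S - {x}) ` C) A" "x \<notin> A"
  shows "shatters C A"
  unfolding shatters_def
proof (intro allI impI)
  fix B assume "B \<subseteq> A"
  then obtain S where "S \<in> C" "(S - {x}) \<inter> A = B" using assms(1) unfolding shatters_def by blast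
  then show "\<exists>S\<in>C. S \<inter> A = B" using assms(2) by (intro bexI[of _ S]) auto
qed

lemma shatters_insert:
  assumes "shatters {S \<in> C. x \<notin> S \<and> insert x S \<in> C} A"
  shows "shatters C (insert x A)"
  unfolding shatters_def
proof (intro allI impI)
  fix B assume B: "B \<subseteq> insert x A"
  then have "B - {x} \<subseteq> A" by auto
  then obtain S where S: "S \<in> C" "x \<notin> S" "insert x S \<in> C" "S \<inter> A = B - {x}"
    using assms unfolding shatters_def by blast
  show "\<exists>S\<in>C. S \<inter> insert x A = B"
  proof (cases "x \<in> B")
    case True
    then show ?thesis using S B by (intro bexI[of _ "insert x S"]) auto
  next
    case False
    then show ?thesis using S B by (intro bexI[of _ S]) auto
  qed
qed

lemma card_le_card_shattered:
  assumes "finite N" "C \<subseteq> Pow N"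
  shows "card C \<le> card {A. A \<subseteq> N \<and> shatters C A}"
  using assms
proof (induction N arbitrary: C rule: finite_induct)
  case empty
  then consider (empty) "C = {}" | (singleton) "C = {{}}" by (auto simp: subset_singleton_iff)
  then show ?case
  proof cases
    case singleton
    then have "{A. A \<subseteq> {} \<and> shatters C A} = {{}}" by (auto simp: shatters_def)
    then show ?thesis using singleton by simp
  qed simp
next
  case (insert x N)
  let ?C0 = "(\<lambda>S. S - {x}) ` C" and ?C1 = "{S \<in> C. x \<notin> S \<and> insert x S \<in> C}"
  let ?sh = "\<lambda>D M. {A. A \<subseteq> M \<and> shatters D A}"
  have "finite C" using insert.prems insert.hyps finite_subset by fastforce
  then have "card C = card ?C0 + card ?C1" by (rule card_eq_card_remove_add)
  also have "\<dots> \<le> card (?sh ?C0 N) + card (?sh ?C1 N)"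
    using insert.prems by (intro add_mono insert.IH) auto
  also have "card (?sh ?C1 N) = card (insert x ` ?sh ?C1 N)"
  proof (rule card_image[symmetric], rule inj_onI)
    fix A B assume "A \<in> ?sh ?C1 N" "B \<in> ?sh ?C1 N" "insert x A = insert x B"
    then show "A = B" using insert.hyps(2) by (auto simp: insert_ident)
  qed
  also have "card (?sh ?C0 N) + card (insert x ` ?sh ?C1 N) = card (?sh ?C0 N \<union> insert x ` ?sh ?C1 N)"
    using insert.hyps by (intro card_Un_disjoint[symmetric]) auto
  also have "\<dots> \<le> card (?sh C (insert x N))"
  proof (rule card_mono)
    show "finite (?sh C (insert x N))" using insert.hyps(1) by simp
    show "?sh ?C0 N \<union> insert x ` ?sh ?C1 N \<subseteq> ?sh C (insert x N)"
      using insert.hyps(2) by (auto intro: shatters_remove shatters_insert)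
  qed
  finally show ?case .
qed

lemma card_small_subsets_le:
  fixes x :: real
  assumes "finite N" and x: "0 < x" "x \<le> 1"
  shows "real (card {A. A \<subseteq> N \<and> card A \<le> d}) \<le> exp (x * real (card N) + real d * ln (1 / x))"
proof -
  have "real (card {A. A \<subseteq> N \<and> card A \<le> d}) = (\<Sum>A\<in>{A. A \<subseteq> N \<and> card A \<le> d}. 1)" by simp
  also have "\<dots> \<le> (\<Sum>A\<in>{A. A \<subseteq> N \<and> card A \<le> d}. x ^ card A / x ^ d)"
    using x by (intro sum_mono) (auto simp: field_simps intro!: power_decreasing)
  also have "\<dots> \<le> (\<Sum>A\<in>Pow N. x ^ card A / x ^ d)"
    using assms(1) x by (intro sum_mono2) auto
  also have "\<dots> = (\<Sum>A\<in>Pow N. x ^ card A) / x ^ d" by (simp add: sum_divide_distrib)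
  also have "(\<Sum>A\<in>Pow N. x ^ card A) = (1 + x) ^ card N"
    using prod_add[OF assms(1), of "\<lambda>_. x" "\<lambda>_. 1"] by (simp add: add.commute)
  also have "(1 + x) ^ card N / x ^ d \<le> exp x ^ card N / x ^ d"
    using x by (intro divide_right_mono power_mono) (auto simp: exp_ge_add_one_self)
  also have "\<dots> = exp (x * real (card N) + real d * ln (1 / x))"
    using x by (simp add: ln_div exp_diff exp_of_nat_mult exp_of_nat2_mult)
  finally show ?thesis .
qed

lemma sauer_shelah_exp_bound:
  fixes x :: real
  assumes "finite N" "C \<subseteq> Pow N" "vc_dim C \<le> enat d" "0 < x" "x \<le> 1"
  shows "real (card C) \<le> exp (x * real (card N) + real d * ln (1 / x))"
proof -
  have "card C \<le> card {A. A \<subseteq> N \<and> shatters C A}" by (rule card_le_card_shattered[OF assms(1,2)])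
  also have "\<dots> \<le> card {A. A \<subseteq> N \<and> card A \<le> d}"
    using assms(1,3) by (intro card_mono) (auto simp: vc_dim_le_iff dest: finite_subset)
  finally show ?thesis using card_small_subsets_le[OF assms(1,4,5), of d] by simp
qed

lemma card_trace_le:
  fixes x :: real
  assumes "finite N" "vc_dim G \<le> enat d" "0 < x" "x \<le> 1"
  shows "real (card ((\<lambda>g. z -` g \<inter> N) ` G)) \<le> exp (x * real (card N) + real d * ln (1 / x))"
proof (rule sauer_shelah_exp_bound[OF assms(1)])
  show "vc_dim ((\<lambda>g. z -` g \<inter> N) ` G) \<le> enat d"
    using vc_dim_vimage_le assms(2) by (rule order.trans)
qed (use assms in auto)

definition agreement_sets :: "('a \<Rightarrow> 'y) \<Rightarrow> ('a \<Rightarrow> 'y) set \<Rightarrow> 'a set set" where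
  "agreement_sets f H = (\<lambda>h. {x. h x = f x}) ` H"

lemma vc_dim_agreement_sets_le: "vc_dim (agreement_sets f H) \<le> graph_dim H"
proof -
  have "agreement_sets f H = (\<lambda>S. (\<lambda>x. (x, f x)) -` S \<inter> UNIV) ` (\<lambda>h. {(x, h x) |x. True}) ` H"
    unfolding agreement_sets_def image_image by (intro image_cong) auto
  then show ?thesis unfolding graph_dim_def by (simp only: vc_dim_vimage_le)
qed

section \<open>Concentration\<close>

lemma signed_sum_tail:
  fixes a :: "'a \<Rightarrow> real"
  assumes J: "finite J" and a: "\<And>j. j \<in> J \<Longrightarrow> \<bar>a j\<bar> \<le> 1" and u: "u > 0"
  shows "real (card {B \<in> Pow J. \<bar>\<Sum>j\<in>J. if j \<in> B then - a j else a j\<bar> \<ge> u})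
           \<le> 2 * 2 ^ card J * exp (- u\<^sup>2 / (2 * real (card J)))"
proof (cases "J = {}")
  case True
  then show ?thesis using u by simp
next
  case False
  let ?S = "\<lambda>B. \<Sum>j\<in>J. if j \<in> B then - a j else a j"
  define signs where "signs = Pi_pmf J False (\<lambda>_. bernoulli_pmf (1/2))"
  define X where "X j b = (if b j then - a j else a j)" for j and b :: "'a \<Rightarrow> bool"
  have mean: "measure_pmf.expectation signs (X j) = 0" if "j \<in> J" for j
  proof -
    have "measure_pmf.expectation signs (X j)
        = measure_pmf.expectation (map_pmf (\<lambda>b. b j) signs) (\<lambda>s. if s then - a j else a j)"
      by (simp add: X_def[abs_def])
    also have "map_pmf (\<lambda>b. b j) signs = bernoulli_pmf (1/2)"
      using J that by (simp add: signs_def Pi_pmf_component)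
    finally show ?thesis by simp
  qed
  interpret Hoeffding_ineq "measure_pmf signs" J X "\<lambda>_. -1" "\<lambda>_. 1" 0
  proof unfold_locales
    show "prob_space.indep_vars (measure_pmf signs) (\<lambda>_. borel) X J"
      using prob_space.indep_vars_compose2[OF measure_pmf.prob_space_axioms indep_vars_Pi_pmf[OF J],
          where Y="\<lambda>j s. if s then - a j else a j" and N="\<lambda>_. borel"]
      by (simp add: signs_def X_def[abs_def])
    show "AE b in measure_pmf signs. X j b \<in> {-1..1}" if "j \<in> J" for j
      using a[OF that] by (auto simp: X_def)
  qed (use J mean in simp_all)
  have "real (card {B \<in> Pow J. \<bar>?S B\<bar> \<ge> u}) / 2 ^ card J = measure (pmf_of_set (Pow J)) {B. \<bar>?S B\<bar> \<ge> u}"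
    using J by (subst measure_pmf_of_set) (auto simp: card_Pow Int_def)
  also have "pmf_of_set (Pow J) = map_pmf (\<lambda>b. {j \<in> J. b j}) signs"
    unfolding signs_def by (rule pmf_of_set_Pow_conv_bernoulli[OF J, symmetric])
  also have "measure \<dots> {B. \<bar>?S B\<bar> \<ge> u} = measure signs {b. \<bar>\<Sum>j\<in>J. X j b\<bar> \<ge> u}"
    by (simp add: X_def vimage_def cong: sum.cong)
  also have "\<dots> \<le> 2 * exp (- 2 * u\<^sup>2 / (\<Sum>j\<in>J. (1 - - 1)\<^sup>2))"
    using Hoeffding_ineq_abs_ge[of u] u False J by (simp add: card_gt_0_iff)
  finally show ?thesis by (simp add: field_simps)
qed

lemma (in prob_space) variance_sum_indep:
  fixes X :: "'i \<Rightarrow> 'a \<Rightarrow> real"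
  assumes I: "finite I" and indep: "indep_vars (\<lambda>_. borel) X I"
    and sq: "\<And>i. i \<in> I \<Longrightarrow> integrable M (\<lambda>x. (X i x)\<^sup>2)"
  shows "variance (\<lambda>x. \<Sum>i\<in>I. X i x) = (\<Sum>i\<in>I. variance (X i))"
proof -
  define Y where "Y i x = X i x - expectation (X i)" for i x
  have rv: "random_variable borel (X i)" if "i \<in> I" for i using indep that by (auto simp: indep_vars_def)
  have int: "integrable M (X i)" if "i \<in> I" for i
    using square_integrable_imp_integrable[OF rv[OF that] sq[OF that]] .
  have centred: "integrable M (Y i)" "expectation (Y i) = 0" if "i \<in> I" for i
    using int[OF that] by (simp_all add: Y_def[abs_def] prob_space)
  have prod: "integrable M (\<lambda>x. Y i x * Y j x)"
    "expectation (\<lambda>x. Y i x * Y j x) = (if i = j then variance (X i) else 0)"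
    if ij: "i \<in> I" "j \<in> I" for i j
  proof (atomize (full), cases "i = j")
    case True
    have "(\<lambda>x. Y i x * Y i x) = (\<lambda>x. (X i x)\<^sup>2 - 2 * expectation (X i) * X i x + (expectation (X i))\<^sup>2)"
      by (simp add: Y_def power2_eq_square algebra_simps)
    then have "integrable M (\<lambda>x. Y i x * Y i x)" using int[OF ij(1)] sq[OF ij(1)] by simp
    then show "integrable M (\<lambda>x. Y i x * Y j x) \<and>
        expectation (\<lambda>x. Y i x * Y j x) = (if i = j then variance (X i) else 0)"
      using True by (simp add: Y_def power2_eq_square)
  next
    case False
    have "indep_vars (\<lambda>_. borel) Y {i, j}" unfolding Y_def[abs_def]
      by (rule indep_vars_compose2[OF indep_vars_subset[OF indep]]) (use ij in auto)
    then have "integrable M (\<lambda>x. \<Prod>k\<in>{i, j}. Y k x)"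
      "expectation (\<lambda>x. \<Prod>k\<in>{i, j}. Y k x) = (\<Prod>k\<in>{i, j}. expectation (Y k))"
      using centred(1) ij by (auto intro!: indep_vars_integrable indep_vars_lebesgue_integral)
    then show "integrable M (\<lambda>x. Y i x * Y j x) \<and>
        expectation (\<lambda>x. Y i x * Y j x) = (if i = j then variance (X i) else 0)"
      using centred(2) ij False by simp
  qed
  have "variance (\<lambda>x. \<Sum>i\<in>I. X i x) = expectation (\<lambda>x. (\<Sum>i\<in>I. Y i x)\<^sup>2)"
    using int by (simp add: Y_def sum_subtractf)
  also have "\<dots> = expectation (\<lambda>x. \<Sum>i\<in>I. \<Sum>j\<in>I. Y i x * Y j x)"
    by (simp add: power2_eq_square sum_product)
  also have "\<dots> = (\<Sum>i\<in>I. variance (X i))" using I prod by simp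
  finally show ?thesis .
qed

lemma (in prob_space) variance_le_expectation:
  fixes X :: "'a \<Rightarrow> real"
  assumes [measurable]: "random_variable borel X" and X: "\<And>x. x \<in> space M \<Longrightarrow> X x \<in> {0..1}"
  shows "variance X \<le> expectation X"
proof -
  have int: "integrable M X" "integrable M (\<lambda>x. (X x)\<^sup>2)"
    using X by (auto intro!: integrable_const_bound[where B=1] simp: power_le_one)
  have "variance X \<le> expectation (\<lambda>x. (X x)\<^sup>2)" using variance_eq[OF int] by simp
  also have "\<dots> \<le> expectation X"
    using int X by (intro integral_mono) (auto simp: power2_eq_square mult_left_le)
  finally show ?thesis .
qed

abbreviation iid :: "'i set \<Rightarrow> 'a measure \<Rightarrow> ('i \<Rightarrow> 'a) measure" where
  "iid I P \<equiv> PiM I (\<lambda>_. P)"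

abbreviation cube :: "'i set \<Rightarrow> 'a set \<Rightarrow> ('i \<Rightarrow> 'a) set" where
  "cube I W \<equiv> PiE I (\<lambda>_. W)"

lemma indep_vars_PiM_component:
  assumes M: "\<And>i. i \<in> I \<Longrightarrow> prob_space (M i)"
  shows "prob_space.indep_vars (PiM I M) M (\<lambda>i x. x i) I"
proof -
  interpret prob_space "PiM I M" by (rule prob_space_PiM[OF M])
  show ?thesis
  proof (cases "I = {}")
    case True
    then show ?thesis unfolding indep_vars_def indep_sets_def by auto
  next
    case False
    have "distr (PiM I M) (PiM I M) (\<lambda>x. \<lambda>i\<in>I. x i) = distr (PiM I M) (PiM I M) (\<lambda>x. x)"
      by (rule distr_cong) (auto simp: space_PiM PiE_restrict)
    also have "\<dots> = PiM I (\<lambda>i. distr (PiM I M) (M i) (\<lambda>x. x i))"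
      by (simp, intro PiM_cong refl distr_PiM_component[OF M, symmetric])
    finally show ?thesis by (subst indep_vars_iff_distr_eq_PiM'[OF False]) simp_all
  qed
qed

lemma (in prob_space) Chebyshev_inequality_sum_indep:
  fixes X :: "'i \<Rightarrow> 'a \<Rightarrow> real"
  assumes I: "finite I" and indep: "indep_vars (\<lambda>_. borel) X I"
    and sq: "\<And>i. i \<in> I \<Longrightarrow> integrable M (\<lambda>x. (X i x)\<^sup>2)" and a: "a > 0"
  shows "prob {x \<in> space M. \<bar>(\<Sum>i\<in>I. X i x) - (\<Sum>i\<in>I. expectation (X i))\<bar> \<ge> a} \<le> (\<Sum>i\<in>I. variance (X i)) / a\<^sup>2"
proof -
  have [measurable]: "random_variable borel (X i)" if "i \<in> I" for i
    using indep that by (auto simp: indep_vars_def)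
  have "integrable M (\<lambda>x. (\<Sum>i\<in>I. (X i x)\<^sup>2) * real (card I))" using sq by simp
  then have "integrable M (\<lambda>x. (\<Sum>i\<in>I. X i x)\<^sup>2)"
    by (rule Bochner_Integration.integrable_bound)
       (auto intro!: AE_I2 simp: sum_nonneg intro: sum_squared_le_sum_of_squares)
  moreover have "expectation (\<lambda>x. \<Sum>i\<in>I. X i x) = (\<Sum>i\<in>I. expectation (X i))"
    by (rule Bochner_Integration.integral_sum) (rule square_integrable_imp_integrable[OF _ sq]; simp)
  ultimately show ?thesis
    using Chebyshev_inequality[of "\<lambda>x. \<Sum>i\<in>I. X i x" a] a variance_sum_indep[OF I indep sq] by simp
qed

lemma Chebyshev_inequality_iid:
  fixes g :: "'a \<Rightarrow> real"
  assumes P: "prob_space P" and I: "finite I" "I \<subseteq> J" and g: "g \<in> borel_measurable P"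
    and sq: "integrable P (\<lambda>x. (g x)\<^sup>2)" and a: "a > 0"
  shows "measure (iid J P) {x \<in> space (iid J P). \<bar>(\<Sum>i\<in>I. g (x i)) - real (card I) * (\<integral>x. g x \<partial>P)\<bar> \<ge> a}
           \<le> real (card I) * prob_space.variance P g / a\<^sup>2"
proof -
  interpret P: prob_space P by fact
  interpret M: prob_space "iid J P" by (intro prob_space_PiM P)
  have integral_component: "(\<integral>x. u (x i) \<partial>iid J P) = (\<integral>y. u y \<partial>P)"
    and integrable_component: "integrable (iid J P) (\<lambda>x. u (x i)) \<longleftrightarrow> integrable P u"
    if "i \<in> I" "u \<in> borel_measurable P" for i and u :: "'a \<Rightarrow> real"
  proof -
    have i: "i \<in> J" using that(1) I(2) by blast
    have distr: "distr (iid J P) P (\<lambda>x. x i) = P" using P i by (rule distr_PiM_component)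
    show "(\<integral>x. u (x i) \<partial>iid J P) = (\<integral>y. u y \<partial>P)"
      using integral_distr[of "\<lambda>x. x i" "iid J P" P u] that(2) i by (simp add: distr)
    show "integrable (iid J P) (\<lambda>x. u (x i)) \<longleftrightarrow> integrable P u"
      using integrable_distr_eq[of "\<lambda>x. x i" "iid J P" P u] that(2) i by (simp add: distr)
  qed
  have indep: "M.indep_vars (\<lambda>_. borel) (\<lambda>i x. g (x i)) I"
    using M.indep_vars_subset[OF indep_vars_PiM_component[OF P] I(2)] g
    by (rule M.indep_vars_compose2)
  have "integrable (iid J P) (\<lambda>x. (g (x i))\<^sup>2)" "M.expectation (\<lambda>x. g (x i)) = P.expectation g"
    "M.variance (\<lambda>x. g (x i)) = P.variance g" if "i \<in> I" for i
    using that g sq integrable_component[of i "\<lambda>y. (g y)\<^sup>2"] integral_component[of i g]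
      integral_component[of i "\<lambda>y. (g y - P.expectation g)\<^sup>2"] by simp_all
  then show ?thesis using M.Chebyshev_inequality_sum_indep[OF I(1) indep _ a] by simp
qed

lemma integral_PiM_power_card:
  fixes c :: real
  assumes P: "prob_space P" and W[measurable]: "W \<in> sets P" and J: "finite J"
  shows "integrable (iid J P) (\<lambda>x. c ^ card {t \<in> J. x t \<in> W})"
    and "(\<integral>x. c ^ card {t \<in> J. x t \<in> W} \<partial>iid J P) = (1 - (1 - c) * measure P W) ^ card J"
proof -
  interpret P: prob_space P by fact
  interpret PP: product_prob_space "\<lambda>_. P" J by unfold_locales
  let ?f = "\<lambda>t. 1 - (1 - c) * indicator W t :: real"
  have int: "integrable P ?f" by (simp add: P.emeasure_eq_measure)
  have eq: "c ^ card {t \<in> J. x t \<in> W} = (\<Prod>t\<in>J. ?f (x t))" for x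
  proof -
    have "(\<Prod>t\<in>J. ?f (x t)) = (\<Prod>t\<in>J. if x t \<in> W then c else 1)" by (intro prod.cong) auto
    then show ?thesis using J by (simp add: prod.If_cases Int_def)
  qed
  show "integrable (iid J P) (\<lambda>x. c ^ card {t \<in> J. x t \<in> W})"
    unfolding eq using J int by (intro PP.product_integrable_prod) auto
  have "(\<integral>x. (\<Prod>t\<in>J. ?f (x t)) \<partial>iid J P) = (\<Prod>t\<in>J. \<integral>y. ?f y \<partial>P)"
    using J int by (intro PP.product_integral_prod)
  also have "(\<integral>y. ?f y \<partial>P) = 1 - (1 - c) * measure P W"
    by (simp add: P.prob_space P.emeasure_eq_measure)
  finally show "(\<integral>x. c ^ card {t \<in> J. x t \<in> W} \<partial>iid J P) = (1 - (1 - c) * measure P W) ^ card J"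
    unfolding eq by simp
qed

lemma measure_few_hits_le:
  assumes P: "prob_space P" and W: "W \<in> sets P" and J: "finite J"
    and l: "real l \<le> real (card J) * measure P W / 2"
  shows "measure (iid J P) {x \<in> space (iid J P). card {t \<in> J. x t \<in> W} < l}
           \<le> exp (- (real (card J) * measure P W / 8))"
proof -
  interpret P: prob_space P by fact
  interpret M: prob_space "iid J P" by (intro prob_space_PiM P)
  define p where "p = measure P W"
  let ?u = "\<lambda>x. (1/2 :: real) ^ card {t \<in> J. x t \<in> W}"
  note hits = integral_PiM_power_card[OF P W J, of "1/2"]
  have "measure (iid J P) {x \<in> space (iid J P). card {t \<in> J. x t \<in> W} < l}
      \<le> measure (iid J P) {x \<in> space (iid J P). ?u x \<ge> (1/2) ^ l}"
  proof (rule M.finite_measure_mono)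
    show "{x \<in> space (iid J P). ?u x \<ge> (1/2) ^ l} \<in> sets (iid J P)"
      using borel_measurable_integrable[OF hits(1)] by measurable
  qed auto
  also have "\<dots> \<le> (\<integral>x. ?u x \<partial>iid J P) / (1/2) ^ l"
    using hits(1) by (intro integral_Markov_inequality_measure[where A="{}"]) auto
  also have "\<dots> = 2 ^ l * (1 - p / 2) ^ card J" unfolding hits(2) by (simp add: p_def power_one_over)
  also have "\<dots> \<le> exp (ln 2 * (real (card J) * p / 2)) * exp (- p / 2) ^ card J"
  proof (intro mult_mono power_mono)
    have "(2::real) ^ l = exp (ln 2 * real l)" by (simp add: exp_of_nat2_mult)
    also have "\<dots> \<le> exp (ln 2 * (real (card J) * p / 2))" using l by (simp add: p_def)
    finally show "(2::real) ^ l \<le> exp (ln 2 * (real (card J) * p / 2))" .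
    show "1 - p / 2 \<le> exp (- p / 2)" using exp_ge_add_one_self[of "- p / 2"] by simp
    show "0 \<le> 1 - p / 2" using P.prob_le_1[of W] unfolding p_def by linarith
    then show "0 \<le> (1 - p / 2) ^ card J" by simp
  qed simp
  also have "\<dots> = exp ((ln 2 - 1) * (real (card J) * p / 2))"
    by (simp add: exp_of_nat_mult[symmetric] exp_add[symmetric] algebra_simps)
  also have "(ln 2 - 1) * (real (card J) * p / 2) \<le> (- 1/4) * (real (card J) * p / 2)"
    using ln2_le_25_over_36 by (intro mult_right_mono) (auto simp: p_def)
  finally show ?thesis by (simp add: p_def)
qed

section \<open>Product measures\<close>

lemma prob_space_uniform_measureI:
  assumes "prob_space P" "measure P W > 0"
  shows "prob_space (uniform_measure P W)"
proof -
  interpret P: prob_space P by fact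
  show ?thesis using assms(2) by (intro prob_space_uniform_measure) (auto simp: P.emeasure_eq_measure)
qed

lemma distr_left_inverse:
  assumes "distr M N f = N" "f \<in> M \<rightarrow>\<^sub>M N" "g \<in> N \<rightarrow>\<^sub>M M" "\<And>x. x \<in> space M \<Longrightarrow> g (f x) = x"
  shows "distr N M g = M"
proof -
  have "distr N M g = distr M M (g \<circ> f)"
    using distr_distr[OF assms(3,2)] assms(1) by simp
  also have "\<dots> = distr M M (\<lambda>x. x)" using assms(4) by (intro distr_cong) auto
  finally show ?thesis by simp
qed

lemma distr_PiM_restrict_restrict:
  assumes M: "\<And>i. prob_space (M i)" and TU: "T \<inter> U = {}" "finite T" "finite U"
  shows "distr (PiM (T \<union> U) M) (PiM T M \<Otimes>\<^sub>M PiM U M) (\<lambda>x. (restrict x T, restrict x U)) = PiM T M \<Otimes>\<^sub>M PiM U M"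
proof (rule distr_left_inverse)
  interpret product_prob_space M by (intro product_prob_spaceI M)
  show "distr (PiM T M \<Otimes>\<^sub>M PiM U M) (PiM (T \<union> U) M) (merge T U) = PiM (T \<union> U) M"
    by (rule distr_merge[OF TU])
  show "(\<lambda>x. (restrict x T, restrict x U)) \<in> PiM (T \<union> U) M \<rightarrow>\<^sub>M PiM T M \<Otimes>\<^sub>M PiM U M"
    by (intro measurable_Pair measurable_restrict_subset) auto
  show "(restrict (merge T U x) T, restrict (merge T U x) U) = x" if "x \<in> space (PiM T M \<Otimes>\<^sub>M PiM U M)" for x
    using that TU(1) by (cases x) (auto simp: space_pair_measure space_PiM PiE_iff extensional_restrict)
qed measurable

lemma measure_PiM_restrict_restrict:
  assumes M: "\<And>i. prob_space (M i)" and TU: "T \<inter> U = {}" "finite T" "finite U"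
    and A: "A \<in> sets (PiM T M)" and D: "D \<in> sets (PiM U M)"
  shows "measure (PiM (T \<union> U) M) {x \<in> space (PiM (T \<union> U) M). restrict x T \<in> A \<and> restrict x U \<in> D}
           = measure (PiM T M) A * measure (PiM U M) D"
proof -
  interpret U: prob_space "PiM U M" by (intro prob_space_PiM M)
  let ?M = "PiM (T \<union> U) M" and ?N = "PiM T M \<Otimes>\<^sub>M PiM U M" and ?r = "\<lambda>x. (restrict x T, restrict x U)"
  have r: "?r \<in> ?M \<rightarrow>\<^sub>M ?N"
    by (intro measurable_Pair measurable_restrict_subset) auto
  have "{x \<in> space ?M. restrict x T \<in> A \<and> restrict x U \<in> D} = ?r -` (A \<times> D) \<inter> space ?M" by auto
  also have "measure ?M \<dots> = measure (distr ?M ?N ?r) (A \<times> D)"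
    using A D by (intro measure_distr[symmetric] r) auto
  also have "\<dots> = measure (PiM T M) A * measure (PiM U M) D"
    using A D unfolding distr_PiM_restrict_restrict[OF M TU]
    by (simp add: measure_def U.emeasure_pair_measure_Times enn2real_mult)
  finally show ?thesis .
qed

lemma distr_PiM_component_restrict:
  assumes M: "\<And>i. prob_space (M i)" and J: "finite K" "insert i J \<subseteq> K" "i \<notin> J"
  shows "distr (PiM K M) (M i \<Otimes>\<^sub>M PiM J M) (\<lambda>x. (x i, restrict x J)) = M i \<Otimes>\<^sub>M PiM J M"
proof -
  interpret product_prob_space M K by (intro product_prob_spaceI M)
  let ?L = "PiM (insert i J) M" and ?N = "M i \<Otimes>\<^sub>M PiM J M"
  have split: "(\<lambda>x. (x i, restrict x J)) \<in> ?L \<rightarrow>\<^sub>M ?N"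
    by (intro measurable_Pair measurable_restrict_subset) auto
  have restrict: "(\<lambda>x. restrict x (insert i J)) \<in> PiM K M \<rightarrow>\<^sub>M ?L"
    using J(2) by (rule measurable_restrict_subset)
  have "distr (PiM K M) ?N (\<lambda>x. (x i, restrict x J))
      = distr (distr (PiM K M) ?L (\<lambda>x. restrict x (insert i J))) ?N (\<lambda>x. (x i, restrict x J))"
    using J(2) by (subst distr_distr[OF split restrict])
      (auto intro!: distr_cong simp: Int_absorb1 subset_insertI)
  also have "distr (PiM K M) ?L (\<lambda>x. restrict x (insert i J)) = ?L"
    using distr_restrict[OF J(2,1)] by simp
  also have "distr ?L ?N (\<lambda>x. (x i, restrict x J)) = ?N"
  proof (rule distr_left_inverse)
    show "distr ?N ?L (\<lambda>(x, X). X(i := x)) = ?L" by (rule distr_pair_PiM_eq_PiM[OF M M])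
    show "(\<lambda>x. (x i, restrict x J)) ((\<lambda>(x, X). X(i := x)) p) = p" if "p \<in> space ?N" for p
      using that J(3)
      by (auto simp: space_pair_measure space_PiM PiE_iff extensional_def restrict_def fun_eq_iff)
  qed (use split in measurable)
  finally show ?thesis .
qed

lemma (in pair_prob_space) measure_le_of_sections:
  assumes Q: "Q \<in> sets (M1 \<Otimes>\<^sub>M M2)" and \<beta>: "0 \<le> \<beta>"
    and sec: "AE y in M1. measure M2 (Pair y -` Q) \<le> \<beta>"
  shows "measure (M1 \<Otimes>\<^sub>M M2) Q \<le> \<beta>"
proof -
  have "emeasure (M1 \<Otimes>\<^sub>M M2) Q = (\<integral>\<^sup>+y. emeasure M2 (Pair y -` Q) \<partial>M1)"
    by (rule M2.emeasure_pair_measure_alt[OF Q])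
  also have "\<dots> \<le> (\<integral>\<^sup>+y. ennreal \<beta> \<partial>M1)"
    by (rule nn_integral_mono_AE, use sec in eventually_elim)
       (simp add: M2.emeasure_eq_measure ennreal_leI)
  also have "\<dots> = ennreal \<beta>" by (simp add: M1.emeasure_space_1)
  finally show ?thesis using \<beta> by (simp add: P.emeasure_eq_measure)
qed

lemma measure_iid_cube:
  assumes P: "prob_space P" and "W \<in> sets P" "finite I"
  shows "measure (iid I P) (cube I W) = measure P W ^ card I"
proof -
  interpret P: prob_space P by fact
  interpret PP: finite_product_prob_space "\<lambda>_. P" I by unfold_locales fact
  show ?thesis using assms by (simp add: PP.finite_measure_PiM_emb)
qed

lemma uniform_measure_iid:
  assumes P: "prob_space P" and W: "W \<in> sets P" "measure P W > 0" and I: "finite I"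
  shows "uniform_measure (iid I P) (cube I W) = iid I (uniform_measure P W)"
proof -
  interpret P: prob_space P by fact
  interpret M: prob_space "iid I P" by (intro prob_space_PiM P)
  interpret PP: finite_product_prob_space "\<lambda>_. P" I by unfold_locales (rule I)
  have Q: "prob_space (uniform_measure P W)" using P W(2) by (rule prob_space_uniform_measureI)
  interpret QQ: product_prob_space "\<lambda>_. uniform_measure P W" I by (intro product_prob_spaceI Q)
  have E: "cube I W \<in> sets (iid I P)" using I W(1) by (intro sets_PiM_I_finite) auto
  note cube = measure_iid_cube[OF P W(1) I]
  have pos: "measure (iid I P) (cube I W) > 0" using W(2) by (simp add: cube)
  show ?thesis
  proof (rule QQ.PiM_eqI[OF I])
    show "sets (uniform_measure (iid I P) (cube I W)) = sets (iid I (uniform_measure P W))"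
      by (simp cong: sets_PiM_cong)
    fix B assume "\<And>i. i \<in> I \<Longrightarrow> B i \<in> sets (uniform_measure P W)"
    then have B: "\<And>i. i \<in> I \<Longrightarrow> B i \<in> sets P" by simp
    have "emeasure (uniform_measure (iid I P) (cube I W)) (PiE I B)
        = ennreal (measure (iid I P) (cube I W \<inter> PiE I B) / measure (iid I P) (cube I W))"
      using pos E B I by (simp add: M.emeasure_eq_measure divide_ennreal sets_PiM_I_finite)
    also have "cube I W \<inter> PiE I B = PiE I (\<lambda>i. W \<inter> B i)" by auto
    also have "measure (iid I P) (PiE I (\<lambda>i. W \<inter> B i)) / measure (iid I P) (cube I W)
        = (\<Prod>i\<in>I. measure P (W \<inter> B i) / measure P W)"
      using B W(1) by (simp add: PP.finite_measure_PiM_emb cube prod_dividef)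
    also have "ennreal \<dots> = (\<Prod>i\<in>I. emeasure (uniform_measure P W) (B i))"
      using W B by (subst prod_ennreal[symmetric])
        (auto intro!: prod.cong simp: P.emeasure_eq_measure divide_ennreal)
    finally show "emeasure (uniform_measure (iid I P) (cube I W)) (PiE I B)
        = (\<Prod>i\<in>I. emeasure (uniform_measure P W) (B i))" .
  qed
qed

lemma measure_iid_Int_cube:
  assumes P: "prob_space P" and W: "W \<in> sets P" "measure P W > 0" and I: "finite I" and A: "A \<in> sets (iid I P)"
  shows "measure (iid I P) (A \<inter> cube I W) = measure P W ^ card I * measure (iid I (uniform_measure P W)) A"
proof -
  interpret M: prob_space "iid I P" by (intro prob_space_PiM P)
  note cube = measure_iid_cube[OF P W(1) I]
  have "measure (iid I (uniform_measure P W)) A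
    = measure (iid I P) (cube I W \<inter> A) / measure (iid I P) (cube I W)"
    unfolding uniform_measure_iid[OF P W I, symmetric]
    using W(2) A by (intro measure_uniform_measure) (auto simp: M.emeasure_eq_measure cube)
  then show ?thesis using W(2) by (simp add: cube Int_commute)
qed

section \<open>The first hits of a set\<close>

definition first_hits :: "nat \<Rightarrow> 'a set \<Rightarrow> 'i :: linorder set \<Rightarrow> ('i \<Rightarrow> 'a) \<Rightarrow> 'i set" where
  "first_hits l W J x = set (take l (sorted_list_of_set {t \<in> J. x t \<in> W}))"

lemma card_first_hits:
  assumes "finite J" "l \<le> card {t \<in> J. x t \<in> W}"
  shows "card (first_hits l W J x) = l"
  using assms by (simp add: first_hits_def distinct_card)

lemma first_hits_subset: "finite J \<Longrightarrow> first_hits l W J x \<subseteq> {t \<in> J. x t \<in> W}"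
  by (auto simp: first_hits_def dest!: in_set_takeD)

lemma set_take_sorted_list_of_set_eq:
  assumes A: "finite A" and T: "T \<subseteq> A" and below: "\<And>a t. a \<in> A - T \<Longrightarrow> t \<in> T \<Longrightarrow> t < a"
  shows "set (take (card T) (sorted_list_of_set A)) = T"
proof -
  have fin: "finite T" "finite (A - T)" using A T by (auto dest: finite_subset)
  have "sorted_wrt (<) (sorted_list_of_set T @ sorted_list_of_set (A - T))"
    using fin below by (auto simp: sorted_wrt_append)
  then have "sorted_list_of_set A = sorted_list_of_set T @ sorted_list_of_set (A - T)"
    using A T fin by (intro sorted_list_of_set_unique[THEN iffD1]) (auto simp: card_Diff_subset card_mono)
  then show ?thesis using fin by simp
qed

lemma first_hits_eq_iff:
  assumes J: "finite J" and T: "T \<subseteq> J" "card T = l"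
  shows "first_hits l W J x = T \<longleftrightarrow> (\<forall>t\<in>T. x t \<in> W) \<and> (\<forall>t\<in>J - T. (\<exists>u\<in>T. t < u) \<longrightarrow> x t \<notin> W)"
proof (intro iffI conjI ballI impI)
  let ?xs = "sorted_list_of_set {t \<in> J. x t \<in> W}"
  assume eq: "first_hits l W J x = T"
  show "x t \<in> W" if "t \<in> T" for t using that eq first_hits_subset[OF J, of l W x] by auto
  fix t assume t: "t \<in> J - T" and "\<exists>u\<in>T. t < u"
  then obtain u where u: "u \<in> set (take l ?xs)" "t < u" using eq by (auto simp: first_hits_def)
  have "sorted (take l ?xs @ drop l ?xs)" by simp
  then have "\<forall>u\<in>set (take l ?xs). \<forall>t\<in>set (drop l ?xs). u \<le> t"
    unfolding sorted_append by blast
  then have "t \<notin> set (drop l ?xs)" using u by (meson leD)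
  moreover have "t \<notin> set (take l ?xs)" using t eq by (simp add: first_hits_def)
  ultimately have "t \<notin> set ?xs" by (metis append_take_drop_id Un_iff set_append)
  then show "x t \<notin> W" using t J by simp
next
  assume hit: "(\<forall>t\<in>T. x t \<in> W) \<and> (\<forall>t\<in>J - T. (\<exists>u\<in>T. t < u) \<longrightarrow> x t \<notin> W)"
  have "set (take (card T) (sorted_list_of_set {t \<in> J. x t \<in> W})) = T"
  proof (rule set_take_sorted_list_of_set_eq)
    fix a t assume "a \<in> {t \<in> J. x t \<in> W} - T" "t \<in> T"
    then show "t < a" using hit by (metis DiffD1 DiffD2 DiffI linorder_neqE mem_Collect_eq)
  qed (use J T hit in auto)
  then show "first_hits l W J x = T" using T(2) by (simp add: first_hits_def)
qed

definition no_early_hits :: "'a measure \<Rightarrow> 'a set \<Rightarrow> 'i :: linorder set \<Rightarrow> 'i set \<Rightarrow> ('i \<Rightarrow> 'a) set" where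
  "no_early_hits P W T I = {y \<in> space (iid I P). \<forall>t\<in>{t \<in> I. \<exists>u\<in>T. t < u}. y t \<notin> W}"

lemma sets_no_early_hits:
  assumes [measurable]: "W \<in> sets P" and "finite I"
  shows "no_early_hits P W T I \<in> sets (iid I P)"
  unfolding no_early_hits_def using assms(2) by (intro sets.sets_Collect_finite_All) measurable

lemma first_hits_restrict_event_eq:
  assumes J: "finite J" and T: "T \<subseteq> J" "card T = l"
  shows "{x \<in> space (iid J P). first_hits l W J x = T \<and> restrict x T \<in> B}
    = {x \<in> space (iid J P). restrict x T \<in> B \<inter> cube T W \<and> restrict x (J - T) \<in> no_early_hits P W T (J - T)}"
proof -
  have "restrict x T \<in> cube T W \<longleftrightarrow> (\<forall>t\<in>T. x t \<in> W)" for x by auto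
  moreover have "restrict x (J - T) \<in> no_early_hits P W T (J - T) \<longleftrightarrow> (\<forall>t\<in>J - T. (\<exists>u\<in>T. t < u) \<longrightarrow> x t \<notin> W)"
    if "x \<in> space (iid J P)" for x using that by (auto simp: no_early_hits_def space_PiM)
  ultimately show ?thesis unfolding first_hits_eq_iff[OF J T] by blast
qed

lemma measure_first_hits_restrict:
  assumes P: "prob_space P" and W: "W \<in> sets P" "measure P W > 0" and J: "finite J"
    and T: "T \<subseteq> J" "card T = l" and B: "B \<in> sets (iid T P)"
  shows "{x \<in> space (iid J P). first_hits l W J x = T \<and> restrict x T \<in> B} \<in> sets (iid J P)" (is "?F B \<in> _")
    and "measure (iid J P) {x \<in> space (iid J P). first_hits l W J x = T \<and> restrict x T \<in> B}
      = measure (iid J P) {x \<in> space (iid J P). first_hits l W J x = T} * measure (iid T (uniform_measure P W)) B"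
proof -
  have Q: "prob_space (uniform_measure P W)" using P W(2) by (rule prob_space_uniform_measureI)
  interpret QT: prob_space "iid T (uniform_measure P W)" by (intro prob_space_PiM Q)
  have fin_T: "finite T" and T_Un: "T \<union> (J - T) = J" using T J by (auto dest: finite_subset)
  let ?D = "no_early_hits P W T (J - T)"
  have D: "?D \<in> sets (iid (J - T) P)" using W(1) J by (intro sets_no_early_hits) auto
  have cube: "cube T W \<in> sets (iid T P)" using fin_T W(1) by (intro sets_PiM_I_finite) auto
  note event_eq = first_hits_restrict_event_eq[OF J T, of P W]
  have [measurable]: "(\<lambda>x. restrict x T) \<in> iid J P \<rightarrow>\<^sub>M iid T P"
    "(\<lambda>x. restrict x (J - T)) \<in> iid J P \<rightarrow>\<^sub>M iid (J - T) P"
    using T by (auto intro!: measurable_restrict_subset)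
  note [measurable] = B D cube
  show "?F B \<in> sets (iid J P)" unfolding event_eq by measurable
  have prod: "measure (iid J P) (?F B)
      = measure P W ^ l * measure (iid (J - T) P) ?D * measure (iid T (uniform_measure P W)) B"
    if B: "B \<in> sets (iid T P)" for B
  proof -
    have "measure (iid J P) (?F B) = measure (iid T P) (B \<inter> cube T W) * measure (iid (J - T) P) ?D"
      using measure_PiM_restrict_restrict[OF P _ fin_T _ sets.Int[OF B cube] D] J
      unfolding event_eq T_Un by simp
    then show ?thesis using measure_iid_Int_cube[OF P W fin_T B] T(2) by simp
  qed
  have "{x \<in> space (iid J P). first_hits l W J x = T} = ?F (space (iid T P))"
    using measurable_space[OF measurable_restrict_subset[OF T(1), of "\<lambda>_. P"]] by blast
  then have "measure (iid J P) {x \<in> space (iid J P). first_hits l W J x = T}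
      = measure P W ^ l * measure (iid (J - T) P) ?D"
    using prod[OF sets.top] QT.prob_space by (simp add: space_PiM)
  then show "measure (iid J P) (?F B)
      = measure (iid J P) {x \<in> space (iid J P). first_hits l W J x = T} * measure (iid T (uniform_measure P W)) B"
    using prod[OF B] by simp
qed

lemma measure_first_hits_le:
  assumes P: "prob_space P" and W: "W \<in> sets P" "measure P W > 0" and J: "finite J"
    and C: "\<And>T. T \<subseteq> J \<Longrightarrow> card T = l \<Longrightarrow> C T \<in> sets (iid T P)"
    and le: "\<And>T. T \<subseteq> J \<Longrightarrow> card T = l \<Longrightarrow> measure (iid T (uniform_measure P W)) (C T) \<le> \<beta>"
    and \<beta>: "0 \<le> \<beta>"
  shows "measure (iid J P) {x \<in> space (iid J P). card (first_hits l W J x) = l \<and>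
      restrict x (first_hits l W J x) \<in> C (first_hits l W J x)} \<le> \<beta>"
proof -
  interpret M: prob_space "iid J P" by (intro prob_space_PiM P)
  let ?N = "iid J P" and ?\<T> = "{T. T \<subseteq> J \<and> card T = l}"
  let ?F = "\<lambda>T. {x \<in> space ?N. first_hits l W J x = T \<and> restrict x T \<in> C T}"
  let ?E = "\<lambda>T. {x \<in> space ?N. first_hits l W J x = T}"
  note restr = measure_first_hits_restrict[OF P W J]
  have fin: "finite ?\<T>" using J by simp
  have E: "?E T \<in> sets ?N" if "T \<in> ?\<T>" for T
  proof -
    have "?E T = {x \<in> space ?N. first_hits l W J x = T \<and> restrict x T \<in> space (iid T P)}"
      using that measurable_space[OF measurable_restrict_subset[of T J "\<lambda>_. P"]] by blast
    then show ?thesis using restr(1)[of T l "space (iid T P)"] that by simp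
  qed
  have "{x \<in> space ?N. card (first_hits l W J x) = l \<and> restrict x (first_hits l W J x) \<in> C (first_hits l W J x)}
      = (\<Union>T\<in>?\<T>. ?F T)"
    using first_hits_subset[OF J, of l W] by auto
  also have "measure ?N \<dots> \<le> (\<Sum>T\<in>?\<T>. measure ?N (?F T))"
    using fin restr(1) C by (intro M.finite_measure_subadditive_finite) auto
  also have "\<dots> \<le> (\<Sum>T\<in>?\<T>. measure ?N (?E T) * \<beta>)"
    using C le by (intro sum_mono) (auto simp: restr(2) intro!: mult_left_mono)
  also have "\<dots> = measure ?N (\<Union>T\<in>?\<T>. ?E T) * \<beta>"
    using fin E unfolding sum_distrib_right[symmetric]
    by (subst M.finite_measure_finite_Union) (auto simp: disjoint_family_on_def)
  also have "\<dots> \<le> 1 * \<beta>" using \<beta> by (intro mult_right_mono) auto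
  finally show ?thesis by simp
qed

section \<open>Symmetrization\<close>

lemma (in prob_space) prob_le_average:
  assumes B: "finite B" "B \<noteq> {}" and T: "\<And>b. b \<in> B \<Longrightarrow> T b \<in> M \<rightarrow>\<^sub>M M" "\<And>b. b \<in> B \<Longrightarrow> distr M M (T b) = M"
    and A: "A \<in> events" and ae: "AE x in M. real (card {b \<in> B. T b x \<in> A}) \<le> \<beta> * real (card B)"
  shows "prob A \<le> \<beta>"
proof -
  have TA: "T b -` A \<inter> space M \<in> events" if "b \<in> B" for b using measurable_sets[OF T(1)[OF that] A] .
  have prob: "prob (T b -` A \<inter> space M) = prob A" if "b \<in> B" for b
    using measure_distr[OF T(1)[OF that] A] T(2)[OF that] by simp
  have int: "integrable M (indicator (T b -` A \<inter> space M) :: _ \<Rightarrow> real)" if "b \<in> B" for b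
    using TA[OF that] by (simp add: emeasure_eq_measure)
  have "real (card B) * prob A = (\<Sum>b\<in>B. expectation (indicator (T b -` A \<inter> space M)))"
    using TA prob by simp
  also have "\<dots> = expectation (\<lambda>x. \<Sum>b\<in>B. indicator (T b -` A \<inter> space M) x)"
    using int by (intro Bochner_Integration.integral_sum[symmetric])
  also have "\<dots> \<le> expectation (\<lambda>x. \<beta> * real (card B))"
  proof (rule integral_mono_AE)
    show "AE x in M. (\<Sum>b\<in>B. indicator (T b -` A \<inter> space M) x) \<le> \<beta> * real (card B)"
      using ae AE_space
    proof eventually_elim
      fix x assume x: "x \<in> space M" and le: "real (card {b \<in> B. T b x \<in> A}) \<le> \<beta> * real (card B)"
      have "(\<Sum>b\<in>B. indicator (T b -` A \<inter> space M) x :: real) = (\<Sum>b\<in>B. if T b x \<in> A then 1 else 0)"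
        using x by (intro sum.cong) (auto simp: indicator_def)
      also have "\<dots> = real (card {b \<in> B. T b x \<in> A})" using B(1) by (simp add: sum.If_cases Int_def)
      finally show "(\<Sum>b\<in>B. indicator (T b -` A \<inter> space M) x) \<le> \<beta> * real (card B)" using le by simp
    qed
  qed (use int in auto)
  also have "\<dots> = real (card B) * \<beta>" by (simp add: prob_space)
  finally show ?thesis using B by (simp add: card_gt_0_iff)
qed

definition half_discrepancy :: "nat \<Rightarrow> 'a set \<Rightarrow> (nat \<Rightarrow> 'a) \<Rightarrow> real" where
  "half_discrepancy l g z = (\<Sum>j<l. of_bool (z j \<in> g) - of_bool (z (j + l) \<in> g))"

definition swap_index :: "nat \<Rightarrow> nat set \<Rightarrow> nat \<Rightarrow> nat" where
  "swap_index l B j = (if j < l \<and> j \<in> B then j + l else if l \<le> j \<and> j - l \<in> B then j - l else j)"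

definition swap_halves :: "nat \<Rightarrow> nat set \<Rightarrow> (nat \<Rightarrow> 'a) \<Rightarrow> nat \<Rightarrow> 'a" where
  "swap_halves l B z = (\<lambda>j\<in>{..<2 * l}. z (swap_index l B j))"

lemma half_discrepancy_swap_halves:
  assumes "B \<subseteq> {..<l}"
  shows "half_discrepancy l g (swap_halves l B z) = (\<Sum>j<l.
    if j \<in> B then - (of_bool (z j \<in> g) - of_bool (z (j + l) \<in> g))
    else of_bool (z j \<in> g) - of_bool (z (j + l) \<in> g))"
  unfolding half_discrepancy_def by (intro sum.cong) (auto simp: swap_halves_def swap_index_def)

lemma swap_halves_measure_preserving:
  assumes P: "prob_space P" and B: "B \<subseteq> {..<l}"
  shows "swap_halves l B \<in> iid {..<2 * l} P \<rightarrow>\<^sub>M iid {..<2 * l} P"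
    and "distr (iid {..<2 * l} P) (iid {..<2 * l} P) (swap_halves l B) = iid {..<2 * l} P"
proof -
  have into: "swap_index l B \<in> {..<2 * l} \<rightarrow> {..<2 * l}" using B by (auto simp: swap_index_def)
  show "swap_halves l B \<in> iid {..<2 * l} P \<rightarrow>\<^sub>M iid {..<2 * l} P" unfolding swap_halves_def[abs_def]
    using into by (intro measurable_restrict measurable_component_singleton) auto
  have "swap_index l B (swap_index l B j) = j" for j using B by (auto simp: swap_index_def)
  then have "inj_on (swap_index l B) {..<2 * l}" by (metis inj_onI)
  from distr_PiM_reindex[of "{..<2 * l}" "\<lambda>_. P", OF _ this into] P
  show "distr (iid {..<2 * l} P) (iid {..<2 * l} P) (swap_halves l B) = iid {..<2 * l} P"
    by (simp add: swap_halves_def[abs_def])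
qed

definition vc_bound :: "nat \<Rightarrow> nat \<Rightarrow> real \<Rightarrow> real" where
  "vc_bound d l \<eta> = 2 * exp (real d * ln (32 / \<eta>\<^sup>2) - real l * \<eta>\<^sup>2 / 16)"

lemma card_swaps_large_discrepancy_le:
  assumes vc: "vc_dim G \<le> enat d" and l: "l > 0" and \<eta>: "0 < \<eta>" "\<eta> \<le> 1"
  shows "real (card {B \<in> Pow {..<l}. \<exists>g\<in>G. \<bar>half_discrepancy l g (swap_halves l B z)\<bar> \<ge> \<eta> / 2 * real l})
    \<le> vc_bound d l \<eta> * 2 ^ l"
proof -
  define a where "a S j = (of_bool (j \<in> S) - of_bool (j + l \<in> S) :: real)" for S :: "nat set" and j
  let ?u = "\<eta> / 2 * real l" and ?N = "{..<2 * l}" and ?x = "\<eta>\<^sup>2 / 32"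
  let ?T = "(\<lambda>g. z -` g \<inter> ?N) ` G"
  let ?E = "\<lambda>S. {B \<in> Pow {..<l}. \<bar>\<Sum>j<l. if j \<in> B then - a S j else a S j\<bar> \<ge> ?u}"
  let ?tail = "2 * 2 ^ l * exp (- ?u\<^sup>2 / (2 * real l))"
  have fin: "finite ?T" by (rule finite_subset[of _ "Pow ?N"]) auto
  have "half_discrepancy l g (swap_halves l B z)
      = (\<Sum>j<l. if j \<in> B then - a (z -` g \<inter> ?N) j else a (z -` g \<inter> ?N) j)"
    if "B \<subseteq> {..<l}" for B g
    unfolding half_discrepancy_swap_halves[OF that] by (intro sum.cong) (auto simp: a_def)
  then have "{B \<in> Pow {..<l}. \<exists>g\<in>G. \<bar>half_discrepancy l g (swap_halves l B z)\<bar> \<ge> ?u} \<subseteq> (\<Union>S\<in>?T. ?E S)"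
    by auto
  then have "card {B \<in> Pow {..<l}. \<exists>g\<in>G. \<bar>half_discrepancy l g (swap_halves l B z)\<bar> \<ge> ?u} \<le> card (\<Union>S\<in>?T. ?E S)"
    using fin by (intro card_mono finite_UN_I) auto
  also have "\<dots> \<le> (\<Sum>S\<in>?T. card (?E S))" by (rule card_UN_le[OF fin])
  finally have "real (card {B \<in> Pow {..<l}. \<exists>g\<in>G. \<bar>half_discrepancy l g (swap_halves l B z)\<bar> \<ge> ?u})
      \<le> (\<Sum>S\<in>?T. real (card (?E S)))"
    by (simp only: of_nat_sum[symmetric] of_nat_le_iff)
  also have "\<dots> \<le> (\<Sum>S\<in>?T. ?tail)"
  proof (rule sum_mono)
    show "real (card (?E S)) \<le> ?tail" for S
      using signed_sum_tail[of "{..<l}" "a S" ?u] l \<eta> by (simp add: a_def)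
  qed
  also have "\<dots> = real (card ?T) * ?tail" by simp
  also have "\<dots> \<le> exp (?x * real (card ?N) + real d * ln (1 / ?x)) * ?tail"
    using \<eta> by (intro mult_right_mono card_trace_le vc) (auto simp: power_le_one order_trans[of "\<eta>\<^sup>2" 1])
  also have "\<dots> = vc_bound d l \<eta> * 2 ^ l"
  proof -
    have "?x * real (card ?N) + real d * ln (1 / ?x) + - ?u\<^sup>2 / (2 * real l)
      = real d * ln (32 / \<eta>\<^sup>2) - real l * \<eta>\<^sup>2 / 16"
      using l by (simp add: field_simps power2_eq_square)
    then show ?thesis by (simp add: vc_bound_def exp_add[symmetric])
  qed
  finally show ?thesis .
qed

lemma measure_large_discrepancy_le:
  assumes P: "prob_space P" and vc: "vc_dim G \<le> enat d" and l: "l > 0" and \<eta>: "0 < \<eta>" "\<eta> \<le> 1"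
    and A: "A \<in> sets (iid {..<2 * l} P)" and N: "N \<in> null_sets (iid {..<2 * l} P)"
    and AN: "\<And>z. z \<in> A - N \<Longrightarrow> \<exists>g\<in>G. \<bar>half_discrepancy l g z\<bar> \<ge> \<eta> / 2 * real l"
  shows "measure (iid {..<2 * l} P) A \<le> vc_bound d l \<eta>"
proof -
  let ?M = "iid {..<2 * l} P"
  interpret M: prob_space ?M by (intro prob_space_PiM P)
  note swap = swap_halves_measure_preserving[OF P]
  have "AE z in ?M. \<forall>B\<in>Pow {..<l}. swap_halves l B z \<notin> N"
  proof (rule AE_finite_allI)
    fix B assume "B \<in> Pow {..<l}"
    then have B: "B \<subseteq> {..<l}" by simp
    have "AE z in distr ?M ?M (swap_halves l B). z \<notin> N" unfolding swap(2)[OF B] by (rule AE_not_in[OF N])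
    then show "AE z in ?M. swap_halves l B z \<notin> N" by (rule AE_distrD[OF swap(1)[OF B]])
  qed simp
  then have "AE z in ?M. real (card {B \<in> Pow {..<l}. swap_halves l B z \<in> A})
    \<le> vc_bound d l \<eta> * real (card (Pow {..<l}))"
  proof eventually_elim
    fix z assume z: "\<forall>B\<in>Pow {..<l}. swap_halves l B z \<notin> N"
    have "card {B \<in> Pow {..<l}. swap_halves l B z \<in> A}
        \<le> card {B \<in> Pow {..<l}. \<exists>g\<in>G. \<bar>half_discrepancy l g (swap_halves l B z)\<bar> \<ge> \<eta> / 2 * real l}"
      using AN z by (intro card_mono) auto
    then show "real (card {B \<in> Pow {..<l}. swap_halves l B z \<in> A}) \<le> vc_bound d l \<eta> * real (card (Pow {..<l}))"
      using card_swaps_large_discrepancy_le[OF vc l \<eta>, of z] by (simp add: card_Pow)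
  qed
  then show ?thesis using swap A by (intro M.prob_le_average[of "Pow {..<l}" "swap_halves l" A]) auto
qed

section \<open>Uniform convergence\<close>

definition emp_freq :: "'i set \<Rightarrow> 'a set \<Rightarrow> ('i \<Rightarrow> 'a) \<Rightarrow> real" where
  "emp_freq T g x = real (card {t \<in> T. x t \<in> g}) / real (card T)"

lemma emp_freq_eq_sum: "finite T \<Longrightarrow> emp_freq T g x = (\<Sum>t\<in>T. indicator g (x t)) / real (card T)"
  by (simp add: emp_freq_def indicator_def sum.If_cases Int_def)

lemma emp_freq_bounds:
  assumes "finite T"
  shows "0 \<le> emp_freq T g x" "emp_freq T g x \<le> 1"
  using card_mono[OF assms, of "{t \<in> T. x t \<in> g}"] by (auto simp: emp_freq_def divide_le_eq_1)

lemma half_discrepancy_eq: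
  assumes "l > 0"
  shows "half_discrepancy l g z = real l * (emp_freq {..<l} g z - emp_freq {l..<2 * l} g z)"
proof -
  have "(\<Sum>j<l. of_bool (z (j + l) \<in> g)) = (\<Sum>j\<in>{l..<2 * l}. of_bool (z j \<in> g) :: real)"
    by (rule sum.reindex_bij_witness[where i="\<lambda>j. j - l" and j="\<lambda>j. j + l"]) auto
  then show ?thesis
    using assms by (simp add: half_discrepancy_def sum_subtractf emp_freq_def right_diff_distrib
      of_bool_def sum.If_cases Int_def)
qed

lemma measure_emp_freq_deviation_le:
  assumes Q: "prob_space Q" and g[measurable]: "g \<in> sets Q" and L: "finite L" "L \<noteq> {}" and a: "a > 0"
  shows "measure (iid L Q) {x \<in> space (iid L Q). \<bar>emp_freq L g x - measure Q g\<bar> \<ge> a}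
    \<le> 1 / (real (card L) * a\<^sup>2)"
proof -
  interpret Q: prob_space Q by fact
  let ?i = "indicator g :: _ \<Rightarrow> real"
  have n: "real (card L) > 0" using L by (simp add: card_gt_0_iff)
  have mean: "(\<integral>x. ?i x \<partial>Q) = measure Q g" by simp
  have "Q.variance ?i \<le> measure Q g" using Q.variance_le_expectation[of ?i] by simp
  then have var: "Q.variance ?i \<le> 1" using Q.prob_le_1[of g] by linarith
  have "\<bar>emp_freq L g x - measure Q g\<bar> \<ge> a \<longleftrightarrow>
      \<bar>(\<Sum>i\<in>L. ?i (x i)) - real (card L) * (\<integral>x. ?i x \<partial>Q)\<bar> \<ge> real (card L) * a" for x
  proof -
    have "(\<Sum>i\<in>L. ?i (x i)) - real (card L) * (\<integral>x. ?i x \<partial>Q) = real (card L) * (emp_freq L g x - measure Q g)"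
      using n L(1) by (simp add: emp_freq_eq_sum right_diff_distrib mean)
    then show ?thesis using n by (simp add: abs_mult)
  qed
  moreover have "integrable Q (\<lambda>x. (?i x)\<^sup>2)"
    by (rule Q.integrable_const_bound[where B=1]) (auto simp: indicator_def)
  ultimately have "measure (iid L Q) {x \<in> space (iid L Q). \<bar>emp_freq L g x - measure Q g\<bar> \<ge> a}
      \<le> real (card L) * Q.variance ?i / (real (card L) * a)\<^sup>2"
    using Chebyshev_inequality_iid[OF Q L(1) order.refl, of ?i "real (card L) * a"] n a by simp
  also have "\<dots> \<le> real (card L) * 1 / (real (card L) * a)\<^sup>2"
    by (intro divide_right_mono mult_left_mono var) auto
  also have "\<dots> = 1 / (real (card L) * a\<^sup>2)" using n by (simp add: power2_eq_square)
  finally show ?thesis .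
qed

lemma (in pair_prob_space) measure_large_sections_le:
  assumes Q[measurable]: "Q \<in> sets (M1 \<Otimes>\<^sub>M M2)" and c: "c > 0"
  shows "measure M1 {x \<in> space M1. measure M2 (Pair x -` Q) \<ge> c} \<le> measure (M1 \<Otimes>\<^sub>M M2) Q / c"
proof -
  have "integrable (M1 \<Otimes>\<^sub>M M2) (indicator Q :: _ \<Rightarrow> real)" by (simp add: P.emeasure_eq_measure)
  note fubini = integrable_fst'[OF this] integral_fst'[OF this]
  have slice: "(\<integral>y. indicat_real Q (x, y) \<partial>M2) = measure M2 (Pair x -` Q)" for x
  proof -
    have "(\<integral>y. indicat_real Q (x, y) \<partial>M2) = (\<integral>y. indicator (Pair x -` Q) y \<partial>M2)"
      by (intro Bochner_Integration.integral_cong) (auto simp: indicator_def)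
    then show ?thesis using sets_Pair1[OF Q] by simp
  qed
  have "measure M1 {x \<in> space M1. measure M2 (Pair x -` Q) \<ge> c} \<le> (\<integral>x. measure M2 (Pair x -` Q) \<partial>M1) / c"
    using fubini(1) c unfolding slice by (intro integral_Markov_inequality_measure[where A="{}"]) auto
  also have "(\<integral>x. measure M2 (Pair x -` Q) \<partial>M1) = measure (M1 \<Otimes>\<^sub>M M2) Q"
    using fubini(2) unfolding slice by simp
  finally show ?thesis .
qed

definition ghost_sections :: "nat \<Rightarrow> 'a measure \<Rightarrow> (nat \<Rightarrow> 'a) set \<Rightarrow> (nat \<Rightarrow> 'a) \<Rightarrow> (nat \<Rightarrow> 'a) set" where
  "ghost_sections l Q A z = {z' \<in> space (iid {l..<2 * l} Q). merge {..<l} {l..<2 * l} (z, z') \<in> A}"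

definition ghost_bad :: "nat \<Rightarrow> 'a measure \<Rightarrow> (nat \<Rightarrow> 'a) set \<Rightarrow> (nat \<Rightarrow> 'a) set" where
  "ghost_bad l Q A = {z \<in> space (iid {..<l} Q). measure (iid {l..<2 * l} Q) (ghost_sections l Q A z) \<ge> 1 / 2}"

lemma lessThan_double_eq: "{..<2 * l} = {..<l} \<union> {l..<2 * l}" for l :: nat
  by auto

lemma measurable_merge_halves:
  "merge {..<l} {l..<2 * l} \<in> iid {..<l} P \<Otimes>\<^sub>M iid {l..<2 * l} P \<rightarrow>\<^sub>M iid {..<2 * l} P" for l :: nat
  unfolding lessThan_double_eq by (rule measurable_merge)

lemma sets_ghost_sections:
  assumes [measurable]: "A \<in> sets (iid {..<2 * l} Q)" "z \<in> space (iid {..<l} Q)"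
  shows "ghost_sections l Q A z \<in> sets (iid {l..<2 * l} Q)"
proof -
  note [measurable] = measurable_merge_halves
  show ?thesis unfolding ghost_sections_def by measurable
qed

lemma measure_ghost_bad_le:
  assumes Q: "prob_space Q" and A: "A \<in> sets (iid {..<2 * l} Q)"
  shows "measure (iid {..<l} Q) (ghost_bad l Q A) \<le> 2 * measure (iid {..<2 * l} Q) A"
proof -
  let ?L1 = "{..<l}" and ?L2 = "{l..<2 * l}"
  interpret Q: prob_space Q by fact
  interpret product_prob_space "\<lambda>_. Q" ?L1 by unfold_locales
  interpret M1: prob_space "iid ?L1 Q" by (intro prob_space_PiM Q)
  interpret M2: prob_space "iid ?L2 Q" by (intro prob_space_PiM Q)
  interpret PP: pair_prob_space "iid ?L1 Q" "iid ?L2 Q" by unfold_locales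
  let ?pair = "iid ?L1 Q \<Otimes>\<^sub>M iid ?L2 Q"
  let ?A = "merge ?L1 ?L2 -` A \<inter> space ?pair"
  have A': "?A \<in> sets ?pair" by (rule measurable_sets[OF measurable_merge_halves A])
  have "ghost_sections l Q A z = Pair z -` ?A" if "z \<in> space (iid ?L1 Q)" for z
    using that by (auto simp: ghost_sections_def space_pair_measure)
  then have ghost_bad_eq:
    "ghost_bad l Q A = {z \<in> space (iid ?L1 Q). measure (iid ?L2 Q) (Pair z -` ?A) \<ge> 1 / 2}"
    unfolding ghost_bad_def by auto
  have "measure (iid ?L1 Q) (ghost_bad l Q A) \<le> measure ?pair ?A / (1 / 2)"
    unfolding ghost_bad_eq by (rule PP.measure_large_sections_le[OF A']) simp
  also have "measure ?pair ?A = measure (distr ?pair (iid {..<2 * l} Q) (merge ?L1 ?L2)) A"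
    by (simp add: measure_distr measurable_merge_halves A)
  also have "distr ?pair (iid {..<2 * l} Q) (merge ?L1 ?L2) = iid {..<2 * l} Q"
  proof -
    have "?L1 \<inter> ?L2 = {}" by auto
    then show ?thesis using distr_merge[of ?L1 ?L2] unfolding lessThan_double_eq[symmetric] by simp
  qed
  finally show ?thesis by simp
qed

lemma deviation_in_ghost_bad:
  assumes Q: "prob_space Q" and g: "g \<in> sets Q" and l: "l > 0" and \<eta>: "0 < \<eta>" "8 \<le> real l * \<eta>\<^sup>2"
    and A: "A \<in> sets (iid {..<2 * l} Q)"
      "\<And>z. z \<in> space (iid {..<2 * l} Q) \<Longrightarrow> \<bar>half_discrepancy l g z\<bar> \<ge> \<eta> / 2 * real l \<Longrightarrow> z \<in> A"
    and z: "z \<in> space (iid {..<l} Q)" and dev: "\<bar>emp_freq {..<l} g z - measure Q g\<bar> \<ge> \<eta>"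
  shows "z \<in> ghost_bad l Q A"
proof -
  let ?L1 = "{..<l}" and ?L2 = "{l..<2 * l}"
  let ?near = "{z' \<in> space (iid ?L2 Q). \<bar>emp_freq ?L2 g z' - measure Q g\<bar> < \<eta> / 2}"
  let ?far = "{z' \<in> space (iid ?L2 Q). \<bar>emp_freq ?L2 g z' - measure Q g\<bar> \<ge> \<eta> / 2}"
  interpret M2: prob_space "iid ?L2 Q" by (intro prob_space_PiM Q)
  have far: "?far \<in> M2.events"
  proof -
    note [measurable] = g
    show ?thesis unfolding emp_freq_eq_sum[OF finite_atLeastLessThan] by measurable
  qed
  have "1 / 2 \<le> M2.prob (space (iid ?L2 Q) - ?far)"
  proof -
    have "M2.prob ?far \<le> 1 / (real (card ?L2) * (\<eta> / 2)\<^sup>2)"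
      using l \<eta> by (intro measure_emp_freq_deviation_le[OF Q g]) auto
    also have "\<dots> \<le> 1 / 2" using l \<eta> by (simp add: power_divide field_simps)
    finally show ?thesis using M2.prob_compl[OF far] by simp
  qed
  also have "space (iid ?L2 Q) - ?far = ?near" by auto
  also have "M2.prob ?near \<le> M2.prob (ghost_sections l Q A z)"
  proof (rule M2.finite_measure_mono[OF _ sets_ghost_sections[OF A(1) z]], safe)
    fix z' assume z': "z' \<in> space (iid ?L2 Q)" and near: "\<bar>emp_freq ?L2 g z' - measure Q g\<bar> < \<eta> / 2"
    let ?m = "merge ?L1 ?L2 (z, z')"
    have "emp_freq ?L1 g ?m = emp_freq ?L1 g z" "emp_freq ?L2 g ?m = emp_freq ?L2 g z'"
      by (auto simp: emp_freq_def merge_def intro!: arg_cong[where f=card])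
    then have "half_discrepancy l g ?m = real l * (emp_freq ?L1 g z - emp_freq ?L2 g z')"
      unfolding half_discrepancy_eq[OF l] by (simp only:)
    moreover have "\<bar>emp_freq ?L1 g z - emp_freq ?L2 g z'\<bar> \<ge> \<eta> / 2" using near dev by linarith
    ultimately have "\<bar>half_discrepancy l g ?m\<bar> \<ge> \<eta> / 2 * real l"
      using l by (simp add: abs_mult mult.commute)
    moreover have "?m \<in> space (iid {..<2 * l} Q)"
      using measurable_space[OF measurable_merge_halves] z z' by (auto simp: space_pair_measure)
    ultimately show "z' \<in> ghost_sections l Q A z" using A(2) z' by (simp add: ghost_sections_def)
  qed
  finally show ?thesis using z by (simp add: ghost_bad_def)
qed

lemma null_sets_iid_uniform_measure:
  assumes P: "prob_space P" and W: "W \<in> sets P" "measure P W > 0" and I: "finite I"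
    and N: "N \<in> null_sets (iid I P)"
  shows "N \<in> null_sets (iid I (uniform_measure P W))"
proof -
  have Q: "prob_space (uniform_measure P W)" using P W(2) by (rule prob_space_uniform_measureI)
  interpret Q: prob_space "iid I (uniform_measure P W)" by (intro prob_space_PiM Q)
  have sets: "N \<in> sets (iid I P)" "N \<in> sets (iid I (uniform_measure P W))"
    using N by (auto cong: sets_PiM_cong)
  have "N \<inter> cube I W \<in> null_sets (iid I P)"
    using N I W(1) by (intro null_set_Int2 sets_PiM_I_finite) auto
  then have "measure (iid I (uniform_measure P W)) N = 0"
    using measure_iid_Int_cube[OF P W I sets(1)] W(2) by (simp add: measure_eq_0_null_sets)
  then show ?thesis using sets(2) by (auto simp: Q.emeasure_eq_measure)
qed

lemma sets_ghost_bad_uniform_measure: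
  assumes P: "prob_space P" and W: "\<And>y. W y \<in> sets P"
    and W_meas: "Measurable.pred (N \<Otimes>\<^sub>M P) (\<lambda>p. snd p \<in> W (fst p))"
    and A: "A \<in> sets (iid {..<2 * l} P)"
  shows "{p \<in> space (N \<Otimes>\<^sub>M iid {..<l} P). measure P (W (fst p)) > 0 \<and>
    snd p \<in> ghost_bad l (uniform_measure P (W (fst p))) A} \<in> sets (N \<Otimes>\<^sub>M iid {..<l} P)"
proof -
  let ?L1 = "{..<l}" and ?L2 = "{l..<2 * l}"
  let ?M1 = "iid ?L1 P" and ?M2 = "iid ?L2 P"
  interpret P: prob_space P by fact
  interpret M2: prob_space ?M2 by (intro prob_space_PiM P)
  note [measurable] = A measurable_merge_halves
  define D where "D = {q \<in> space ((N \<Otimes>\<^sub>M ?M1) \<Otimes>\<^sub>M ?M2). merge ?L1 ?L2 (snd (fst q), snd q) \<in> A \<and>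
      (\<forall>j\<in>?L2. snd q j \<in> W (fst (fst q)))}"
  have [measurable]: "Measurable.pred ((N \<Otimes>\<^sub>M ?M1) \<Otimes>\<^sub>M ?M2) (\<lambda>q. snd q j \<in> W (fst (fst q)))" if "j \<in> ?L2" for j
    using that by (intro measurable_compose[OF _ W_meas, of "\<lambda>q. (fst (fst q), snd q j)", simplified]) measurable
  have D: "D \<in> sets ((N \<Otimes>\<^sub>M ?M1) \<Otimes>\<^sub>M ?M2)" unfolding D_def by measurable
  have Ws: "{p \<in> space (N \<Otimes>\<^sub>M P). snd p \<in> W (fst p)} \<in> sets (N \<Otimes>\<^sub>M P)" using W_meas by (simp add: pred_def)
  have "(\<lambda>y. emeasure P (Pair y -` {p \<in> space (N \<Otimes>\<^sub>M P). snd p \<in> W (fst p)})) \<in> borel_measurable N"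
    by (rule P.measurable_emeasure_Pair[OF Ws])
  moreover have "Pair y -` {p \<in> space (N \<Otimes>\<^sub>M P). snd p \<in> W (fst p)} = W y" if "y \<in> space N" for y
    using that sets.sets_into_space[OF W] by (auto simp: space_pair_measure)
  ultimately have [measurable]: "(\<lambda>y. measure P (W y)) \<in> borel_measurable N"
    unfolding measure_def by (simp cong: measurable_cong)
  have [measurable]: "(\<lambda>p. measure ?M2 (Pair p -` D)) \<in> borel_measurable (N \<Otimes>\<^sub>M ?M1)"
    unfolding measure_def using M2.measurable_emeasure_Pair[OF D] by measurable
  have slice: "measure ?M2 (Pair p -` D) =
      measure P (W (fst p)) ^ l
        * measure (iid ?L2 (uniform_measure P (W (fst p)))) (ghost_sections l P A (snd p))"
    if p: "p \<in> space (N \<Otimes>\<^sub>M ?M1)" "measure P (W (fst p)) > 0" for p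
  proof -
    have z: "snd p \<in> space ?M1" using p(1) by (auto simp: space_pair_measure)
    have "Pair p -` D = ghost_sections l P A (snd p) \<inter> cube ?L2 (W (fst p))"
      using p(1) by (auto simp: D_def ghost_sections_def space_pair_measure space_PiM PiE_iff extensional_def)
    then show ?thesis using measure_iid_Int_cube[OF P W p(2) _ sets_ghost_sections[OF A z]] by simp
  qed
  have "{p \<in> space (N \<Otimes>\<^sub>M ?M1). measure P (W (fst p)) > 0 \<and>
        snd p \<in> ghost_bad l (uniform_measure P (W (fst p))) A}
     = {p \<in> space (N \<Otimes>\<^sub>M ?M1). measure P (W (fst p)) > 0 \<and>
        measure P (W (fst p)) ^ l * (1 / 2) \<le> measure ?M2 (Pair p -` D)}"
    using slice by (auto simp: ghost_bad_def ghost_sections_def space_pair_measure space_PiM)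
  also have "\<dots> \<in> sets (N \<Otimes>\<^sub>M ?M1)" by measurable
  finally show ?thesis .
qed

definition measurable_vc_class :: "'a measure \<Rightarrow> nat \<Rightarrow> 'a set set \<Rightarrow> bool" where
  "measurable_vc_class P d G \<longleftrightarrow> G \<subseteq> sets P \<and> vc_dim G \<le> enat d \<and> (\<forall>(n::nat) S. S \<subseteq> {..<n} \<longrightarrow>
    {x \<in> space (iid {..<n} P). \<exists>g\<in>G. \<forall>i<n. x i \<in> g \<longleftrightarrow> i \<in> S} \<in> sets (completion (iid {..<n} P)))"

lemma measurable_vc_classD:
  assumes "measurable_vc_class P d G"
  shows "G \<subseteq> sets P" "vc_dim G \<le> enat d"
    and "S \<subseteq> {..<n :: nat} \<Longrightarrow>
      {x \<in> space (iid {..<n} P). \<exists>g\<in>G. \<forall>i<n. x i \<in> g \<longleftrightarrow> i \<in> S} \<in> sets (completion (iid {..<n} P))"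
  using assms unfolding measurable_vc_class_def by blast+

lemma measurable_vc_class_agreement_sets:
  assumes "measurably_well_behaved Y H" "graph_dim H = enat d" and f: "f \<in> borel \<rightarrow>\<^sub>M Y"
  shows "measurable_vc_class uniform01 d (agreement_sets f H)"
proof -
  have "\<forall>h\<in>H. {x. h x = f x} \<in> sets borel"
    and "\<forall>n::nat. \<forall>S\<subseteq>{..<n}. {x \<in> space (iid {..<n} uniform01). \<exists>h\<in>H. \<forall>i<n. h (x i) = f (x i) \<longleftrightarrow> i \<in> S}
      \<in> sets (completion (iid {..<n} uniform01))"
    using assms(1) f unfolding measurably_well_behaved_def by blast+
  then show ?thesis
    using vc_dim_agreement_sets_le[of f H] assms(2) by (auto simp: measurable_vc_class_def agreement_sets_def)
qed

lemma sets_completion_half_discrepancy: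
  fixes P :: "'a measure" and l :: nat
  assumes G: "measurable_vc_class P d G"
  shows "{z \<in> space (iid {..<2 * l} P). \<exists>g\<in>G. \<bar>half_discrepancy l g z\<bar> \<ge> u}
    \<in> sets (completion (iid {..<2 * l} P))"
proof -
  let ?M = "iid {..<2 * l} P"
  define e where "e S = (\<Sum>j<l. of_bool (j \<in> S) - of_bool (j + l \<in> S) :: real)" for S :: "nat set"
  let ?pattern = "\<lambda>S. {z \<in> space ?M. \<exists>g\<in>G. \<forall>i<2 * l. z i \<in> g \<longleftrightarrow> i \<in> S}"
  have e: "half_discrepancy l g z = e S" if "\<forall>i<2 * l. z i \<in> g \<longleftrightarrow> i \<in> S" for g z S
    using that by (auto simp: e_def half_discrepancy_def intro!: sum.cong)
  have "{z \<in> space ?M. \<exists>g\<in>G. \<bar>half_discrepancy l g z\<bar> \<ge> u} = (\<Union>S\<in>{S \<in> Pow {..<2 * l}. \<bar>e S\<bar> \<ge> u}. ?pattern S)"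
  proof (intro set_eqI iffI)
    fix z assume "z \<in> {z \<in> space ?M. \<exists>g\<in>G. \<bar>half_discrepancy l g z\<bar> \<ge> u}"
    then obtain g where g: "z \<in> space ?M" "g \<in> G" "\<bar>half_discrepancy l g z\<bar> \<ge> u" by auto
    let ?S = "{i. i < 2 * l \<and> z i \<in> g}"
    have "half_discrepancy l g z = e ?S" by (rule e) simp
    then show "z \<in> (\<Union>S\<in>{S \<in> Pow {..<2 * l}. \<bar>e S\<bar> \<ge> u}. ?pattern S)"
      using g by (intro UN_I[of ?S]) auto
  next
    fix z assume "z \<in> (\<Union>S\<in>{S \<in> Pow {..<2 * l}. \<bar>e S\<bar> \<ge> u}. ?pattern S)"
    then obtain S g where "z \<in> space ?M" "g \<in> G" "\<bar>e S\<bar> \<ge> u" and S: "\<forall>i<2 * l. z i \<in> g \<longleftrightarrow> i \<in> S" by auto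
    then show "z \<in> {z \<in> space ?M. \<exists>g\<in>G. \<bar>half_discrepancy l g z\<bar> \<ge> u}"
      using e[OF S] by (intro CollectI conjI bexI[of _ g]) simp_all
  qed
  moreover have "(\<Union>S\<in>{S \<in> Pow {..<2 * l}. \<bar>e S\<bar> \<ge> u}. ?pattern S) \<in> sets (completion ?M)"
  proof (rule sets.finite_UN)
    fix S assume "S \<in> {S \<in> Pow {..<2 * l}. \<bar>e S\<bar> \<ge> u}"
    then have "S \<subseteq> {..<2 * l}" by simp
    then show "?pattern S \<in> sets (completion ?M)" by (rule measurable_vc_classD(3)[OF G])
  qed simp
  ultimately show ?thesis by (rule ssubst)
qed

lemma sets_completion_cover:
  assumes "D \<in> sets (completion M)"
  obtains A N where "A \<in> sets M" "N \<in> null_sets M" "D \<subseteq> A" "A - N \<subseteq> D"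
proof -
  obtain S N\<^sub>0 N where D: "D = S \<union> N\<^sub>0" "N\<^sub>0 \<subseteq> N" "N \<in> null_sets M" "S \<in> sets M"
    using assms by (rule sets_completionE)
  then show ?thesis by (intro that[of "S \<union> N" N]) auto
qed

text \<open>The deviations of \<open>G\<close> need not form a measurable set, let alone one measurable jointly in \<open>y\<close>;
  hence the measurable cover \<open>C\<close>.\<close>

lemma uniform_convergence_cover:
  fixes P :: "'a measure" and N :: "'b measure" and W :: "'b \<Rightarrow> 'a set"
  assumes P: "prob_space P" and W: "\<And>y. W y \<in> sets P"
    and W_meas: "Measurable.pred (N \<Otimes>\<^sub>M P) (\<lambda>p. snd p \<in> W (fst p))"
    and G: "measurable_vc_class P d G"
    and l: "l > 0" and \<eta>: "0 < \<eta>" "\<eta> \<le> 1" "8 \<le> real l * \<eta>\<^sup>2"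
  obtains C where "C \<in> sets (N \<Otimes>\<^sub>M iid {..<l} P)"
    and "\<And>y z g. y \<in> space N \<Longrightarrow> measure P (W y) > 0 \<Longrightarrow> z \<in> space (iid {..<l} P) \<Longrightarrow> g \<in> G \<Longrightarrow>
        \<bar>emp_freq {..<l} g z - measure (uniform_measure P (W y)) g\<bar> \<ge> \<eta> \<Longrightarrow> (y, z) \<in> C"
    and "\<And>y. measure P (W y) > 0 \<Longrightarrow>
        measure (iid {..<l} (uniform_measure P (W y))) (Pair y -` C) \<le> 2 * vc_bound d l \<eta>"
proof -
  let ?M = "iid {..<2 * l} P" and ?Q = "\<lambda>y. uniform_measure P (W y)"
  define D where "D = {z \<in> space ?M. \<exists>g\<in>G. \<bar>half_discrepancy l g z\<bar> \<ge> \<eta> / 2 * real l}"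
  have "D \<in> sets (completion ?M)" unfolding D_def by (rule sets_completion_half_discrepancy[OF G])
  then obtain A N' where A: "A \<in> sets ?M" "D \<subseteq> A" "A - N' \<subseteq> D" and null: "N' \<in> null_sets ?M"
    by (rule sets_completion_cover)
  have Q: "prob_space (?Q y)" if "measure P (W y) > 0" for y
    using P that by (rule prob_space_uniform_measureI)
  have sets_Q: "sets (iid I (?Q y)) = sets (iid I P)" for I :: "nat set" and y by (intro sets_PiM_cong) auto
  have space_Q: "space (iid I (?Q y)) = space (iid I P)" for I :: "nat set" and y by (simp add: space_PiM)
  show ?thesis
  proof (rule that)
    let ?C = "{p \<in> space (N \<Otimes>\<^sub>M iid {..<l} P). measure P (W (fst p)) > 0 \<and> snd p \<in> ghost_bad l (?Q (fst p)) A}"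
    show "?C \<in> sets (N \<Otimes>\<^sub>M iid {..<l} P)" by (rule sets_ghost_bad_uniform_measure[OF P W W_meas A(1)])
    show "(y, z) \<in> ?C" if "y \<in> space N" "measure P (W y) > 0" "z \<in> space (iid {..<l} P)" "g \<in> G"
      "\<bar>emp_freq {..<l} g z - measure (?Q y) g\<bar> \<ge> \<eta>" for y z g
    proof -
      have "z \<in> ghost_bad l (?Q y) A"
      proof (rule deviation_in_ghost_bad[OF Q[OF that(2)] _ l \<eta>(1,3)])
        show "x \<in> A" if "x \<in> space (iid {..<2 * l} (?Q y))" "\<bar>half_discrepancy l g x\<bar> \<ge> \<eta> / 2 * real l" for x
          using that \<open>g \<in> G\<close> A(2) by (auto simp: D_def space_Q)
      qed (use that measurable_vc_classD(1)[OF G] A(1) in \<open>auto simp: sets_Q space_Q\<close>)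
      then show ?thesis using that by (simp add: space_pair_measure)
    qed
    show "measure (iid {..<l} (?Q y)) (Pair y -` ?C) \<le> 2 * vc_bound d l \<eta>" if w: "measure P (W y) > 0" for y
    proof -
      have AQ: "A \<in> sets (iid {..<2 * l} (?Q y))" using A(1) by (simp add: sets_Q)
      have "measure (iid {..<l} (?Q y)) (ghost_bad l (?Q y) A) \<le> 2 * measure (iid {..<2 * l} (?Q y)) A"
        by (rule measure_ghost_bad_le[OF Q[OF w] AQ])
      also have "\<dots> \<le> 2 * vc_bound d l \<eta>"
        using null_sets_iid_uniform_measure[OF P W w _ null] A(3) l \<eta>
        by (intro mult_left_mono measure_large_discrepancy_le[OF Q[OF w] measurable_vc_classD(2)[OF G] _ _ _ AQ]) (auto simp: D_def)
      finally have "measure (iid {..<l} (?Q y)) (ghost_bad l (?Q y) A) \<le> 2 * vc_bound d l \<eta>" .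
      moreover have "Pair y -` ?C = (if y \<in> space N then ghost_bad l (?Q y) A else {})"
        using w by (auto simp: space_pair_measure ghost_bad_def space_Q)
      ultimately show ?thesis by (simp add: vc_bound_def)
    qed
  qed
qed

section \<open>Piecewise functions\<close>

lemma exists_piecewise:
  fixes t :: "nat \<Rightarrow> ereal"
  assumes "t 0 = -\<infinity>" "t k = \<infinity>" "\<And>i. i \<in> {1..<k} \<Longrightarrow> t i \<in> range ereal"
    and mono: "mono_on {0..k} t" and h: "\<And>i. i \<in> {1..k} \<Longrightarrow> h i \<in> H"
  shows "\<exists>g\<in>piecewise k H. \<forall>i\<in>{1..k}. \<forall>x. t (i - 1) < ereal x \<and> ereal x \<le> t i \<longrightarrow> g x = h i x"
proof -
  define g where "g x = h (LEAST i. 1 \<le> i \<and> ereal x \<le> t i) x" for x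
  have g_eq: "g x = h i x" if i: "i \<in> {1..k}" "t (i - 1) < ereal x" "ereal x \<le> t i" for x i
  proof -
    have "(LEAST i. 1 \<le> i \<and> ereal x \<le> t i) = i"
    proof (rule Least_equality)
      show "1 \<le> i \<and> ereal x \<le> t i" using i by simp
      fix j assume j: "1 \<le> j \<and> ereal x \<le> t j"
      show "i \<le> j"
      proof (rule ccontr)
        assume "\<not> i \<le> j"
        then have "t j \<le> t (i - 1)" using i by (intro mono_onD[OF mono]) auto
        then show False using j i(2) by (meson order.trans not_le)
      qed
    qed
    then show ?thesis by (simp add: g_def)
  qed
  then have "g \<in> piecewise k H"
    unfolding piecewise_def using assms by (intro CollectI exI[of _ t] exI[of _ h]) simp
  then show ?thesis using g_eq by blast
qed

lemma exists_piecewise_of_mono: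
  fixes q :: "real \<Rightarrow> nat"
  assumes q: "mono q" and k: "k \<ge> 1" and h: "\<And>j. h j \<in> H"
  shows "\<exists>g\<in>piecewise k H. \<exists>F. finite F \<and> (\<forall>x\<in>{a<..<b} - F. q x < k \<longrightarrow> g x = h (q x) x)"
proof -
  define u where "u i = Sup (insert a {x \<in> {a..b}. q x < i})" for i
  define t where "t i = (if i = 0 then -\<infinity> else if i \<ge> k then \<infinity> else ereal (u i))" for i
  have bdd: "bdd_above (insert a {x \<in> {a..b}. q x < i})" for i
    by (rule bdd_aboveI[of _ "max a b"]) auto
  have u_mono: "u i \<le> u j" if "i \<le> j" for i j
    unfolding u_def using that bdd by (intro cSup_subset_mono) auto
  have "\<exists>g\<in>piecewise k H. \<forall>i\<in>{1..k}. \<forall>x. t (i - 1) < ereal x \<and> ereal x \<le> t i \<longrightarrow> g x = h (i - 1) x"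
  proof (rule exists_piecewise)
    show "mono_on {0..k} t" by (rule mono_onI) (auto simp: t_def u_mono)
  qed (use k h in \<open>auto simp: t_def\<close>)
  then obtain g where g: "g \<in> piecewise k H"
    and g_eq: "\<And>i x. i \<in> {1..k} \<Longrightarrow> t (i - 1) < ereal x \<Longrightarrow> ereal x \<le> t i \<Longrightarrow> g x = h (i - 1) x"
    by blast
  have "g x = h (q x) x" if x: "x \<in> {a<..<b} - u ` {..k}" "q x < k" for x
  proof -
    have "ereal x \<le> t (Suc (q x))"
    proof (cases "Suc (q x) = k")
      case False
      have "x \<le> u (Suc (q x))" unfolding u_def using x bdd by (intro cSup_upper) auto
      then show ?thesis using False x by (simp add: t_def)
    qed (simp add: t_def)
    moreover have "t (q x) < ereal x"
    proof (cases "q x = 0")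
      case False
      have "u (q x) \<le> x" unfolding u_def
      proof (rule cSup_least)
        fix y assume "y \<in> insert a {x' \<in> {a..b}. q x' < q x}"
        then show "y \<le> x" using x monoD[OF q, of x y] by (auto simp: not_less[symmetric])
      qed simp
      moreover have "u (q x) \<noteq> x" using x by (metis DiffD2 atMost_iff imageI less_imp_le)
      ultimately have "u (q x) < x" by simp
      then show ?thesis using False x by (simp add: t_def)
    qed (simp add: t_def)
    ultimately show ?thesis using g_eq[of "Suc (q x)" x] x(2) by simp
  qed
  then show ?thesis using g by (intro bexI[OF _ g] exI[of _ "u ` {..k}"]) auto
qed

lemma exists_piecewise_of_levels:
  fixes r :: "real \<Rightarrow> nat"
  assumes r: "mono r" and S: "finite S" "card S \<le> k" and k: "k \<ge> 1" and lab: "\<And>j. lab j \<in> H"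
  shows "\<exists>g\<in>piecewise k H. \<exists>F. finite F \<and> (\<forall>x\<in>{a<..<b} - F. r x \<in> S \<longrightarrow> g x = lab (r x) x)"
proof -
  define pos where "pos s = card {s' \<in> S. s' < s}" for s
  have pos_strict: "pos s < pos s'" if "s < s'" "s \<in> S" for s s'
    unfolding pos_def using S that by (intro psubset_card_mono) auto
  have pos_less: "pos s < k" if "s \<in> S" for s
  proof -
    have "pos s < card S" unfolding pos_def using S that by (intro psubset_card_mono) auto
    then show ?thesis using S(2) by simp
  qed
  have "inj_on pos S"
  proof (rule inj_onI, rule ccontr)
    fix s s' assume "s \<in> S" "s' \<in> S" "pos s = pos s'" "s \<noteq> s'"
    then show False using pos_strict[of s s'] pos_strict[of s' s] by (cases "s < s'") auto
  qed
  then have inv: "inv_into S pos (pos s) = s" if "s \<in> S" for s using that by (rule inv_into_f_f)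
  have "mono pos" unfolding pos_def using S by (intro monoI card_mono) auto
  then have "mono (\<lambda>x. pos (r x))" using r by (simp add: mono_def)
  from exists_piecewise_of_mono[OF this k, of "\<lambda>j. lab (inv_into S pos j)" H a b] lab
  obtain g F where "g \<in> piecewise k H" "finite F"
    and g: "\<And>x. x \<in> {a<..<b} - F \<Longrightarrow> pos (r x) < k \<Longrightarrow> g x = lab (inv_into S pos (pos (r x))) x"
    by blast
  moreover have "g x = lab (r x) x" if "x \<in> {a<..<b} - F" "r x \<in> S" for x
    using g[OF that(1) pos_less[OF that(2)]] inv[OF that(2)] by simp
  ultimately show ?thesis by (intro bexI[of _ g] exI[of _ F]) simp_all
qed

definition has_breakpoints :: "(real \<Rightarrow> 'y) set \<Rightarrow> nat \<Rightarrow> (real \<Rightarrow> 'y) \<Rightarrow> (nat \<Rightarrow> real) \<Rightarrow> bool" where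
  "has_breakpoints H k f s \<longleftrightarrow> (\<forall>x. \<exists>h\<in>H. h x = f x \<and>
    (\<forall>y. h y \<noteq> f y \<longrightarrow> (\<exists>j\<in>{1..<k}. y \<le> s j \<and> s j < x \<or> x \<le> s j \<and> s j < y)))"

lemma piecewise_has_breakpoints:
  assumes "f \<in> piecewise k H"
  shows "\<exists>s. has_breakpoints H k f s"
proof -
  obtain t h where t: "t 0 = -\<infinity>" "t k = \<infinity>" "\<And>i. i \<in> {1..<k} \<Longrightarrow> t i \<in> range ereal" "mono_on {0..k} t"
    and h: "\<And>i. i \<in> {1..k} \<Longrightarrow> h i \<in> H"
    and f_eq: "\<And>x i. i \<in> {1..k} \<Longrightarrow> t (i - 1) < ereal x \<Longrightarrow> ereal x \<le> t i \<Longrightarrow> f x = h i x"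
    using assms unfolding piecewise_def by blast
  define s where "s j = real_of_ereal (t j)" for j
  have t_eq: "t j = ereal (s j)" if "j \<in> {1..<k}" for j
    using t(3)[OF that] by (cases "t j") (auto simp: s_def)
  have "\<exists>h\<in>H. h x = f x \<and> (\<forall>y. h y \<noteq> f y \<longrightarrow> (\<exists>j\<in>{1..<k}. y \<le> s j \<and> s j < x \<or> x \<le> s j \<and> s j < y))" for x
  proof -
    define i where "i = (LEAST i. ereal x \<le> t i)"
    have le_right: "ereal x \<le> t i" unfolding i_def by (rule LeastI[of _ k]) (simp add: t)
    have i_le: "i \<le> k" unfolding i_def by (rule Least_le) (simp add: t)
    have i_neq_0: "i \<noteq> 0" using le_right t(1) by (auto intro: ccontr)
    have left_less: "t (i - 1) < ereal x"
      using not_less_Least[of "i - 1" "\<lambda>i. ereal x \<le> t i"] i_neq_0 by (auto simp: i_def[symmetric])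
    have i: "i \<in> {1..k}" using i_le i_neq_0 by auto
    have "\<exists>j\<in>{1..<k}. y \<le> s j \<and> s j < x \<or> x \<le> s j \<and> s j < y" if "h i y \<noteq> f y" for y
    proof -
      have "\<not> (t (i - 1) < ereal y \<and> ereal y \<le> t i)" using f_eq[OF i] that by metis
      then consider (left) "ereal y \<le> t (i - 1)" | (right) "t i < ereal y" by force
      then show ?thesis
      proof cases
        case left
        then have "i - 1 \<noteq> 0" using t(1) by (auto intro: ccontr)
        then have j: "i - 1 \<in> {1..<k}" using i_le by auto
        then show ?thesis using left left_less t_eq[OF j] by (intro bexI[OF _ j]) auto
      next
        case right
        then have "i \<noteq> k" using t(2) by auto
        then have j: "i \<in> {1..<k}" using i by auto
        then show ?thesis using right le_right t_eq[OF j] by (intro bexI[OF _ j]) auto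
      qed
    qed
    then show ?thesis using h[OF i] f_eq[OF i left_less le_right] by metis
  qed
  then show ?thesis unfolding has_breakpoints_def by blast
qed

section \<open>Combinatorics of levels\<close>

lemma exists_heavy_subset:
  fixes w :: "'a \<Rightarrow> real"
  assumes "finite A" "k \<le> card A"
  shows "\<exists>S\<subseteq>A. card S = k \<and> real k * sum w A \<le> real (card A) * sum w S"
  using assms
proof (induction "card A - k" arbitrary: A)
  case 0
  then show ?case by (intro exI[of _ A]) auto
next
  case (Suc n)
  then have fin: "finite A" and cA: "card A > k" "A \<noteq> {}" by auto
  obtain a where a: "a \<in> A" "\<And>b. b \<in> A \<Longrightarrow> w a \<le> w b"
    using arg_min_if_finite[OF fin cA(2), of w] by (metis not_le_imp_less)
  have card_remove: "card (A - {a}) = card A - 1" using a fin by simp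
  have "\<exists>S\<subseteq>A - {a}. card S = k \<and> real k * sum w (A - {a}) \<le> real (card (A - {a})) * sum w S"
    using Suc cA fin by (intro Suc.hyps(1)) (auto simp: card_remove)
  then obtain S where S: "S \<subseteq> A - {a}" "card S = k"
     "real k * sum w (A - {a}) \<le> (real (card A) - 1) * sum w S"
    using cA by (auto simp: card_remove of_nat_diff)
  have "real k * w a = (\<Sum>b\<in>S. w a)" using S by simp
  also have "\<dots> \<le> sum w S" using S a by (intro sum_mono) auto
  finally have "real k * w a \<le> sum w S" .
  moreover have "sum w A = w a + sum w (A - {a})" using fin a by (simp add: sum.remove)
  ultimately have "real k * sum w A \<le> real (card A) * sum w S"
    using S(3) by (simp add: algebra_simps)
  then show ?case using S by (intro exI[of _ S]) auto
qed

lemma exists_subset_light_complement: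
  fixes w :: "'a \<Rightarrow> real"
  assumes A: "finite A" and w: "\<And>a. a \<in> A \<Longrightarrow> w a \<ge> 0" "sum w A \<le> 1" and k: "k > 0"
  shows "\<exists>S\<subseteq>A. card S \<le> k \<and> sum w (A - S) \<le> max 0 ((real (card A) - real k) / real k)"
proof (cases "card A \<le> k")
  case True
  then show ?thesis by (intro exI[of _ A]) auto
next
  case False
  then obtain S where S: "S \<subseteq> A" "card S = k" "real k * sum w A \<le> real (card A) * sum w S"
    using exists_heavy_subset[OF A, of k w] by auto
  have "real k * sum w (A - S) \<le> real (card A) * sum w (A - S)"
    using False w(1) by (intro mult_right_mono sum_nonneg) auto
  also have "\<dots> = real (card A) * sum w A - real (card A) * sum w S"
    using A S(1) by (simp add: sum_diff right_diff_distrib)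
  also have "\<dots> \<le> (real (card A) - real k) * sum w A"
    using S(3) by (simp add: left_diff_distrib)
  also have "\<dots> \<le> (real (card A) - real k) * 1" using w(2) False by (intro mult_left_mono) auto
  finally have "sum w (A - S) \<le> (real (card A) - real k) / real k" using k by (simp add: field_simps)
  then show ?thesis using S by (intro exI[of _ S]) auto
qed

inductive alternating :: "('a :: linorder \<Rightarrow> 'b) \<Rightarrow> 'a set \<Rightarrow> nat \<Rightarrow> 'a \<Rightarrow> bool" for L D where
  alternating_1: "x \<in> D \<Longrightarrow> alternating L D 1 x"
| alternating_Suc: "alternating L D n x \<Longrightarrow> x < y \<Longrightarrow> y \<in> D \<Longrightarrow> L x \<noteq> L y \<Longrightarrow> alternating L D (Suc n) y"

lemma alternating_in: "alternating L D n x \<Longrightarrow> x \<in> D"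
  by (cases rule: alternating.cases) auto

lemma bounded_alternation_rank:
  fixes L :: "'a :: linorder \<Rightarrow> 'b"
  assumes bounded: "\<And>n x. alternating L D n x \<Longrightarrow> n \<le> N"
  obtains r :: "'a \<Rightarrow> nat" where "mono r" "\<And>x. r x \<le> N" "\<And>x. x \<in> D \<Longrightarrow> r x \<ge> 1"
    "\<And>x y. x \<in> D \<Longrightarrow> y \<in> D \<Longrightarrow> r x = r y \<Longrightarrow> L x = L y"
proof -
  let ?A = "\<lambda>x. insert 0 {n. \<exists>y\<le>x. alternating L D n y}"
  define r where "r x = Max (?A x)" for x
  have fin: "finite (?A x)" for x by (rule finite_subset[of _ "{..N}"]) (auto dest: bounded)
  have r_ge: "n \<le> r x" if "alternating L D n y" "y \<le> x" for n x y
    unfolding r_def using fin that by (intro Max_ge) auto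
  have label_le: "L x = L y" if x: "x \<in> D" and y: "y \<in> D" and xy: "r x = r y" "x \<le> y" for x y
  proof -
    have "1 \<le> r x" by (rule r_ge[OF alternating_1[OF x]]) simp
    then obtain z where z: "z \<le> x" "alternating L D (r x) z"
      using Max_in[OF fin, of x] by (auto simp: r_def)
    have "L z = L w" if "w \<in> D" "x \<le> w" "r w = r x" for w
    proof (rule ccontr)
      assume "L z \<noteq> L w"
      then have "z < w" using z(1) that(2) by (cases "z = w") auto
      then have "alternating L D (Suc (r x)) w" using z(2) that(1) \<open>L z \<noteq> L w\<close> by (intro alternating_Suc)
      then show False using r_ge[of "Suc (r x)" w w] that(3) by simp
    qed
    from this[OF x] this[OF y] show "L x = L y" using xy by simp
  qed
  show ?thesis
  proof (rule that)
    show "mono r" unfolding r_def by (intro monoI Max_mono fin) (auto intro: order.trans)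
    show "r x \<le> N" for x unfolding r_def using fin bounded by (subst Max_le_iff) auto
    show "1 \<le> r x" if "x \<in> D" for x using r_ge[OF alternating_1[OF that]] by simp
    show "L x = L y" if "x \<in> D" "y \<in> D" "r x = r y" for x y
    proof (cases "x \<le> y")
      case True
      then show ?thesis by (rule label_le[OF that])
    next
      case False
      then have "y \<le> x" by simp
      then show ?thesis by (rule label_le[OF that(2,1) that(3)[symmetric], symmetric])
    qed
  qed
qed

section \<open>Windows\<close>

abbreviation window :: "real \<Rightarrow> real \<Rightarrow> real set" where
  "window \<delta> x \<equiv> {x - \<delta><..<x + \<delta>}"

definition window_frac :: "real \<Rightarrow> real set \<Rightarrow> real \<Rightarrow> real" where
  "window_frac \<delta> g x = measure lborel (g \<inter> window \<delta> x) / (2 * \<delta>)"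

lemma fmeasurable_Int_window: "g \<in> sets borel \<Longrightarrow> \<delta> > 0 \<Longrightarrow> g \<inter> window \<delta> x \<in> fmeasurable lborel"
  by (rule fmeasurableI2[of "window \<delta> x"]) (auto simp: fmeasurable_def)

lemma window_frac_Lipschitz:
  assumes "\<delta> > 0" and g: "g \<in> sets borel"
  shows "\<bar>window_frac \<delta> g x - window_frac \<delta> g y\<bar> \<le> \<bar>x - y\<bar> / (2 * \<delta>)"
proof -
  let ?m = "\<lambda>x. measure lborel (g \<inter> window \<delta> x)"
  note fm = fmeasurable_Int_window[OF g assms(1)]
  have shift: "?m x \<le> ?m y + \<bar>x - y\<bar>" for x y
  proof -
    let ?C = "if x \<le> y then {x - \<delta>..y - \<delta>} else {y + \<delta>..x + \<delta>}"
    have C: "?C \<in> fmeasurable lborel" by (auto simp: fmeasurable_def)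
    have "?m x \<le> measure lborel ((g \<inter> window \<delta> y) \<union> ?C)"
      using fm C g by (intro measure_mono_fmeasurable fmeasurable.Un) auto
    also have "\<dots> \<le> ?m y + measure lborel ?C"
      using fm C by (intro measure_Un_le) (auto simp: fmeasurable_def)
    also have "measure lborel ?C = \<bar>x - y\<bar>" by auto
    finally show ?thesis .
  qed
  have "\<bar>?m x - ?m y\<bar> \<le> \<bar>x - y\<bar>" using shift[of x y] shift[of y x] by linarith
  then show ?thesis using assms(1)
    by (simp add: window_frac_def diff_divide_distrib[symmetric] divide_right_mono)
qed

lemma continuous_window_frac:
  assumes "\<delta> > 0" "g \<in> sets borel"
  shows "continuous_on A (window_frac \<delta> g)"
proof (rule continuous_on_subset[OF _ subset_UNIV], rule lipschitz_on_continuous_on)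
  show "(1 / (2 * \<delta>))-lipschitz_on UNIV (window_frac \<delta> g)"
    using assms window_frac_Lipschitz[OF assms] by (intro lipschitz_onI) (auto simp: dist_real_def)
qed

lemma window_frac_disjoint:
  assumes "\<delta> > 0" and g: "g \<in> sets borel" "g' \<in> sets borel" and null: "g \<inter> g' \<in> null_sets lborel"
  shows "window_frac \<delta> g x + window_frac \<delta> g' x \<le> 1"
proof -
  let ?w = "window \<delta> x"
  note fm = fmeasurable_Int_window[OF g(1) assms(1), of x] fmeasurable_Int_window[OF g(2) assms(1), of x]
  have "(g \<inter> ?w) \<inter> (g' \<inter> ?w) \<in> null_sets lborel" by (rule null_sets_subset[OF null]) (use g in auto)
  then have "measure lborel (g \<inter> ?w) + measure lborel (g' \<inter> ?w) = measure lborel ((g \<inter> ?w) \<union> (g' \<inter> ?w))"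
    using fm by (subst measure_Un3) (auto simp: measure_eq_0_null_sets)
  also have "\<dots> \<le> measure lborel ?w"
    using g assms(1) by (intro measure_mono_fmeasurable) (auto simp: fmeasurable_def)
  finally show ?thesis using assms(1) by (simp add: window_frac_def add_divide_distrib[symmetric])
qed

lemma has_real_derivative_mult_abs: "((\<lambda>x. (x - c) * \<bar>x - c\<bar> / 2) has_real_derivative \<bar>x - c\<bar>) (at x)"
proof (cases "x = c")
  case True
  have "((\<lambda>y. \<bar>y - c\<bar> / 2) \<longlongrightarrow> 0) (at c)" by (rule tendsto_eq_intros refl | simp)+
  moreover have "\<forall>\<^sub>F y in at c. \<bar>y - c\<bar> / 2 = ((y - c) * \<bar>y - c\<bar> / 2 - (c - c) * \<bar>c - c\<bar> / 2) / (y - c)"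
    using eventually_neq_at_within[of c c UNIV] by eventually_elim (simp add: field_simps)
  ultimately have "((\<lambda>y. ((y - c) * \<bar>y - c\<bar> / 2 - (c - c) * \<bar>c - c\<bar> / 2) / (y - c)) \<longlongrightarrow> 0) (at c)"
    by (rule Lim_transform_eventually)
  then show ?thesis using True by (simp only: has_field_derivative_iff) simp
next
  case False
  define s where "s = sgn (x - c)"
  have "((\<lambda>y. (y - c) * (s * (y - c)) / 2) has_real_derivative s * (x - c)) (at x)"
    by (auto intro!: derivative_eq_intros)
  then have "((\<lambda>y. (y - c) * \<bar>y - c\<bar> / 2) has_real_derivative s * (x - c)) (at x)"
  proof (rule has_field_derivative_transform_within_open)
    show "open {y. 0 < s * (y - c)}" by (intro open_Collect_less continuous_intros)
  qed (use False in \<open>auto simp: s_def sgn_if abs_if split: if_splits\<close>)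
  then show ?thesis using False by (simp add: s_def sgn_if abs_if split: if_splits)
qed

lemma integral_tent:
  fixes \<alpha> \<beta> c \<rho> :: real
  assumes "\<rho> \<ge> 0"
  shows "(\<integral>x. (\<alpha> - \<beta> * \<bar>x - c\<bar>) * indicator {c - \<rho>..c + \<rho>} x \<partial>lborel) = 2 * \<alpha> * \<rho> - \<beta> * \<rho>\<^sup>2"
    and "integrable lborel (\<lambda>x. (\<alpha> - \<beta> * \<bar>x - c\<bar>) * indicator {c - \<rho>..c + \<rho>} x)"
proof -
  let ?f = "\<lambda>x. \<alpha> - \<beta> * \<bar>x - c\<bar>" and ?F = "\<lambda>x. \<alpha> * x - \<beta> * ((x - c) * \<bar>x - c\<bar> / 2)"
  have F: "(?F has_real_derivative ?f x) (at x)" for x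
    by (rule derivative_eq_intros has_real_derivative_mult_abs refl | simp)+
  have cont: "isCont ?f x" for x by (intro continuous_intros)
  have "(\<integral>x. ?f x * indicator {c - \<rho>..c + \<rho>} x \<partial>lborel) = ?F (c + \<rho>) - ?F (c - \<rho>)"
    using assms F cont by (intro integral_FTC_Icc_real) auto
  also have "\<dots> = 2 * \<alpha> * \<rho> - \<beta> * \<rho>\<^sup>2" using assms by (simp add: power2_eq_square algebra_simps)
  finally show "(\<integral>x. ?f x * indicator {c - \<rho>..c + \<rho>} x \<partial>lborel) = 2 * \<alpha> * \<rho> - \<beta> * \<rho>\<^sup>2" .
  show "integrable lborel (\<lambda>x. ?f x * indicator {c - \<rho>..c + \<rho>} x)"
    using borel_integrable_atLeastAtMost[of "c - \<rho>" "c + \<rho>" ?f] cont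
    by (simp add: indicator_def if_distrib cong: if_cong)
qed

section \<open>The uniform distribution\<close>

lemma prob_space_uniform01: "prob_space uniform01"
  by (rule prob_space_uniform_measure) auto

lemma measure_uniform01:
  assumes "A \<in> sets borel"
  shows "measure uniform01 A = measure lborel (A \<inter> {0<..<1})"
  using assms by (subst measure_uniform_measure) (auto simp: Int_commute)

lemma measure_uniform01_finite:
  assumes "finite F"
  shows "measure uniform01 F = 0"
proof -
  have "F \<inter> {0<..<1} \<in> null_sets lborel" using assms by (intro finite_imp_null_set_lborel) auto
  then show ?thesis
    using measure_uniform01[of F] assms by (simp add: measure_eq_0_null_sets finite_imp_closed borel_closed)
qed

lemma integral_uniform01:
  fixes g :: "real \<Rightarrow> real"
  assumes [measurable]: "g \<in> borel_measurable borel"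
  shows "(\<integral>x. g x \<partial>uniform01) = (\<integral>x. indicator {0<..<1} x * g x \<partial>lborel)"
proof -
  have "uniform01 = density lborel (\<lambda>x. ennreal (indicator {0<..<1} x))"
    unfolding uniform_measure_def by (intro density_cong) (auto simp: indicator_def)
  then show ?thesis by (simp add: integral_density)
qed

lemma measure_uniform01_margin:
  assumes "0 < \<delta>" "\<delta> < 1/2"
  shows "measure uniform01 (- {\<delta>..1 - \<delta>}) = 2 * \<delta>"
proof -
  interpret prob_space uniform01 by (rule prob_space_uniform01)
  have "{\<delta>..1 - \<delta>} \<inter> {0<..<1} = {\<delta>..1 - \<delta>}" using assms by auto
  then have "measure uniform01 {\<delta>..1 - \<delta>} = 1 - 2 * \<delta>" using assms by (subst measure_uniform01) auto
  then show ?thesis using prob_compl[of "{\<delta>..1 - \<delta>}"] by (simp add: Compl_eq_Diff_UNIV)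
qed

lemma measure_uniform01_window:
  assumes "0 < \<delta>" "x \<in> {\<delta>..1 - \<delta>}"
  shows "measure uniform01 (window \<delta> x) = 2 * \<delta>"
proof -
  have "window \<delta> x \<inter> {0<..<1} = window \<delta> x" using assms by auto
  then show ?thesis using assms(1) by (subst measure_uniform01) auto
qed

lemma measure_uniform01_window_ge:
  assumes "0 < \<delta>" "\<delta> < 1/2" "x \<in> {0<..<1}"
  shows "\<delta> \<le> measure uniform01 (window \<delta> x)"
proof -
  have "window \<delta> x \<inter> {0<..<1} = {max 0 (x - \<delta>)<..<min 1 (x + \<delta>)}" by auto
  then have "measure uniform01 (window \<delta> x) = measure lborel {max 0 (x - \<delta>)<..<min 1 (x + \<delta>)}"
    by (subst measure_uniform01) auto
  also have "\<dots> = min 1 (x + \<delta>) - max 0 (x - \<delta>)" using assms by (intro measure_lborel_Ioo) auto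
  finally show ?thesis using assms by auto
qed

lemma measure_uniform_window:
  assumes "0 < \<delta>" "x \<in> {\<delta>..1 - \<delta>}" and g: "g \<in> sets borel"
  shows "measure (uniform_measure uniform01 (window \<delta> x)) g = window_frac \<delta> g x"
proof -
  interpret prob_space uniform01 by (rule prob_space_uniform01)
  note window = measure_uniform01_window[OF assms(1,2)]
  have "window \<delta> x \<inter> g \<inter> {0<..<1} = g \<inter> window \<delta> x" using assms by auto
  then have "measure uniform01 (window \<delta> x \<inter> g) = measure lborel (g \<inter> window \<delta> x)"
    using g by (subst measure_uniform01) auto
  then show ?thesis using assms(1) g window
    by (subst measure_uniform_measure) (auto simp: emeasure_eq_measure window_frac_def)
qed

section \<open>Local noise sensitivity\<close>

definition agree :: "real \<Rightarrow> (real \<Rightarrow> 'y) \<Rightarrow> (real \<Rightarrow> 'y) \<Rightarrow> real \<Rightarrow> real" where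
  "agree \<delta> f h = window_frac \<delta> {y. h y = f y}"

text \<open>Two hypotheses cannot both agree with \<open>f\<close> on more than half of a window.  Below the truncation level
  \<open>1/2\<close> the infimum is therefore attained by a single hypothesis, and only countably many of them occur;
  the untruncated infimum need not be measurable.\<close>

definition truncated_NS :: "(real \<Rightarrow> 'y) set \<Rightarrow> real \<Rightarrow> (real \<Rightarrow> 'y) \<Rightarrow> real \<Rightarrow> real" where
  "truncated_NS H \<delta> f x = Inf (insert (1/2) ((\<lambda>h. 1 - agree \<delta> f h x) ` consistent H x (f x)))"

definition excess_NS :: "(real \<Rightarrow> 'y) set \<Rightarrow> real \<Rightarrow> (real \<Rightarrow> 'y) \<Rightarrow> real \<Rightarrow> real \<Rightarrow> real" where
  "excess_NS H \<delta> f \<eta> x = (if x \<in> {\<delta>..1 - \<delta>} then max 0 (truncated_NS H \<delta> f x - \<eta>) else 0)"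

locale noise_sensitivity =
  fixes H :: "(real \<Rightarrow> 'y) set" and f :: "real \<Rightarrow> 'y" and \<delta> :: real
  assumes agree_sets: "h \<in> H \<Longrightarrow> {x. h x = f x} \<in> sets borel"
    and agree_null: "h \<in> H \<Longrightarrow> h' \<in> H \<Longrightarrow> h \<noteq> h' \<Longrightarrow> {x. h x = f x} \<inter> {x. h' x = f x} \<in> null_sets lborel"
    and \<delta>: "0 < \<delta>" "\<delta> < 1/2"
begin

abbreviation "ag \<equiv> agree \<delta> f"
abbreviation "NS \<equiv> truncated_NS H \<delta> f"

lemma agree_add_le_1: "h \<in> H \<Longrightarrow> h' \<in> H \<Longrightarrow> h \<noteq> h' \<Longrightarrow> ag h x + ag h' x \<le> 1"
  unfolding agree_def using agree_sets agree_null \<delta> by (intro window_frac_disjoint) auto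

lemma agree_Lipschitz: "h \<in> H \<Longrightarrow> \<bar>ag h x - ag h y\<bar> \<le> \<bar>x - y\<bar> / (2 * \<delta>)"
  unfolding agree_def using agree_sets \<delta> by (intro window_frac_Lipschitz) auto

lemma continuous_agree: "h \<in> H \<Longrightarrow> continuous_on A (ag h)"
  unfolding agree_def using agree_sets \<delta> by (intro continuous_window_frac) auto

lemma agree_le_1: "h \<in> H \<Longrightarrow> ag h x \<le> 1"
  using window_frac_disjoint[OF \<delta>(1) agree_sets, of h "{}" x] by (simp add: agree_def window_frac_def)

lemma bdd_below_NS: "bdd_below (insert (1/2) ((\<lambda>h. 1 - ag h x) ` consistent H x (f x)))"
  by (rule bdd_belowI[of _ 0]) (auto simp: consistent_def agree_le_1)

lemma NS_le_half: "NS x \<le> 1/2"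
  unfolding truncated_NS_def by (rule cInf_lower[OF _ bdd_below_NS]) simp

lemma NS_le: "h \<in> H \<Longrightarrow> h x = f x \<Longrightarrow> NS x \<le> 1 - ag h x"
  unfolding truncated_NS_def by (rule cInf_lower[OF _ bdd_below_NS]) (auto simp: consistent_def)

lemma NS_less_iff:
  assumes "a \<le> 1/2"
  shows "NS x < a \<longleftrightarrow> (\<exists>h\<in>H. h x = f x \<and> 1 - ag h x < a)"
proof -
  have "NS x < a \<longleftrightarrow> (\<exists>v\<in>insert (1/2) ((\<lambda>h. 1 - ag h x) ` consistent H x (f x)). v < a)"
    unfolding truncated_NS_def by (rule cInf_less_iff[OF _ bdd_below_NS]) simp
  then show ?thesis using assms by (auto simp: consistent_def)
qed

lemma NS_ge_tent:
  assumes h: "h \<in> H" "ag h c = 1/2"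
  shows "1/2 - \<bar>x - c\<bar> / (2 * \<delta>) \<le> NS x"
  unfolding truncated_NS_def
proof (rule cInf_greatest)
  fix v assume "v \<in> insert (1/2) ((\<lambda>h. 1 - ag h x) ` consistent H x (f x))"
  then consider (half) "v = 1/2" | (hypothesis) h' where "h' \<in> H" "v = 1 - ag h' x" by (auto simp: consistent_def)
  then show "1/2 - \<bar>x - c\<bar> / (2 * \<delta>) \<le> v"
  proof cases
    case half
    have "0 \<le> \<bar>x - c\<bar> / (2 * \<delta>)" using \<delta> by simp
    then show ?thesis using half by linarith
  next
    case hypothesis
    then have "ag h' c \<le> 1/2" using agree_add_le_1[OF h(1), of h' c] h(2) by (cases "h = h'") auto
    then show ?thesis using agree_Lipschitz[OF hypothesis(1), of x c] hypothesis(2) by linarith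
  qed
qed simp

lemma countable_majority: "countable {h \<in> H. \<exists>x. ag h x > 1/2}"
proof -
  let ?maj = "\<lambda>h. {x. ag h x > 1/2}" and ?A = "{h \<in> H. \<exists>x. ag h x > 1/2}"
  have disj: "?maj h \<inter> ?maj h' = {}" if "h \<in> ?A" "h' \<in> ?A" "h \<noteq> h'" for h h'
  proof -
    have "ag h x + ag h' x \<le> 1" for x using that by (intro agree_add_le_1) auto
    then show ?thesis by (smt (verit) disjoint_iff mem_Collect_eq field_sum_of_halves)
  qed
  have "open (?maj h)" if "h \<in> ?A" for h
    using that continuous_agree[of h UNIV] by (intro open_Collect_less) auto
  moreover have "disjoint (?maj ` ?A)" using disj unfolding disjoint_def by blast
  ultimately have "countable (?maj ` ?A)" by (intro countable_disjoint_open_subsets) auto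
  moreover have "inj_on ?maj ?A"
  proof (rule inj_onI, rule ccontr)
    fix h h' assume h: "h \<in> ?A" "h' \<in> ?A" "?maj h = ?maj h'" "h \<noteq> h'"
    then show False using disj[OF h(1,2,4)] by auto
  qed
  ultimately show ?thesis by (simp add: countable_image_inj_eq)
qed

lemma NS_measurable: "NS \<in> borel_measurable borel"
proof (rule borel_measurableI_less)
  fix a :: real
  show "{x \<in> space borel. NS x < a} \<in> sets borel"
  proof (cases "a \<le> 1/2")
    case True
    have "\<exists>x. ag h x > 1/2" if "1 - ag h x < a" for h x using that True by (intro exI[of _ x]) linarith
    then have "{x \<in> space borel. NS x < a}
        = (\<Union>h\<in>{h \<in> H. \<exists>x. ag h x > 1/2}. {x. h x = f x} \<inter> {x. 1 - ag h x < a})"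
      unfolding NS_less_iff[OF True] by auto
    also have "\<dots> \<in> sets borel"
    proof (rule sets.countable_UN''[OF countable_majority])
      fix h assume "h \<in> {h \<in> H. \<exists>x. ag h x > 1/2}"
      then have h: "h \<in> H" by simp
      have "open {x. 1 - ag h x < a}"
        using continuous_agree[OF h] by (intro open_Collect_less continuous_intros)
      then show "{x. h x = f x} \<inter> {x. 1 - ag h x < a} \<in> sets borel" using agree_sets[OF h] by auto
    qed
    finally show ?thesis .
  next
    case False
    then have "NS x < a" for x using NS_le_half[of x] by linarith
    then show ?thesis by simp
  qed
qed

lemma excess_NS_measurable: "excess_NS H \<delta> f \<eta> \<in> borel_measurable borel"
proof -
  note [measurable] = NS_measurable
  show ?thesis unfolding excess_NS_def[abs_def] by measurable
qed

lemma excess_NS_bounds: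
  assumes "0 \<le> \<eta>"
  shows "0 \<le> excess_NS H \<delta> f \<eta> x" "excess_NS H \<delta> f \<eta> x \<le> 1"
  using NS_le_half[of x] assms by (auto simp: excess_NS_def)

end

section \<open>Rounding a target of low noise sensitivity\<close>

locale rounding = noise_sensitivity H f \<delta>
  for H :: "(real \<Rightarrow> 'y) set" and f :: "real \<Rightarrow> 'y" and \<delta> :: real +
  fixes \<tau> \<eta> :: real
  assumes \<eta>: "0 < \<eta>" "\<eta> < \<tau>" and \<tau>: "\<tau> \<le> 1/16"
begin

abbreviation "excess \<equiv> excess_NS H \<delta> f \<eta>"

definition total_excess :: real where "total_excess = (\<integral>x. excess x \<partial>lborel)"

definition cost :: real where "cost = \<delta> / 2 * (1 - 4 * \<tau>\<^sup>2 - 4 * \<eta>)"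

definition determined :: "(real \<Rightarrow> 'y) \<Rightarrow> real \<Rightarrow> bool" where
  "determined h x \<longleftrightarrow> h \<in> H \<and> x \<in> {\<delta>..1 - \<delta>} \<and> ag h x > 1 - \<tau>"

definition label :: "real \<Rightarrow> real \<Rightarrow> 'y" where
  "label x = (THE h. determined h x)"

abbreviation "determined_points \<equiv> {x. \<exists>h. determined h x}"

lemmas excess_bounds = excess_NS_bounds[OF less_imp_le[OF \<eta>(1)]]

lemma integrable_excess:
  assumes [measurable]: "A \<in> sets borel"
  shows "integrable lborel (\<lambda>x. excess x * indicator A x)"
proof (rule Bochner_Integration.integrable_bound)
  note [measurable] = excess_NS_measurable
  show "(\<lambda>x. excess x * indicator A x) \<in> borel_measurable lborel" by measurable
  show "integrable lborel (indicator {0..1::real} :: real \<Rightarrow> real)" by (intro integrable_real_indicator) auto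
  have "excess x = 0" if "x \<notin> {0..1}" for x using that \<delta> by (auto simp: excess_NS_def)
  then show "AE x in lborel. norm (excess x * indicator A x) \<le> norm (indicator {0..1::real} x :: real)"
    using excess_bounds by (intro AE_I2) (auto simp: indicator_def)
qed

lemma total_excess_nonneg: "0 \<le> total_excess"
  using excess_bounds by (simp add: total_excess_def integral_nonneg_AE)

lemma integral_excess_uniform01: "(\<integral>x. excess x \<partial>uniform01) = total_excess"
proof -
  have "indicator {0<..<1} x * excess x = excess x" for x
    using \<delta> by (auto simp: excess_NS_def indicator_def)
  then show ?thesis using integral_uniform01[OF excess_NS_measurable] by (simp only: total_excess_def)
qed

lemma cost_pos: "cost > 0"
proof -
  have "\<tau>\<^sup>2 \<le> (1/16)\<^sup>2" using \<tau> \<eta> by (intro power_mono) auto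
  then show ?thesis using \<delta> \<eta> \<tau> by (simp add: cost_def power2_eq_square)
qed

lemma determined_unique: "determined h x \<Longrightarrow> determined h' x \<Longrightarrow> h = h'"
  using agree_add_le_1[of h h' x] \<tau> by (fastforce simp: determined_def)

lemma label_eq: "determined h x \<Longrightarrow> label x = h"
  unfolding label_def using determined_unique by blast

definition gap :: real where "gap = \<delta> * (1 - 2 * \<tau>)"

lemma gap_pos: "0 < gap"
  using \<delta> \<tau> by (simp add: gap_def)

lemma exists_half_agreement:
  assumes a: "determined h a" and b: "determined h' b" and ne: "h \<noteq> h'" and ab: "a < b"
  obtains c where "ag h c = 1/2" "a < c - gap" "c + gap < b"
proof -
  note det_a = a[unfolded determined_def] and det_b = b[unfolded determined_def]
  have "ag h b \<le> 1/2" using agree_add_le_1[of h h' b] det_a det_b ne \<tau> by linarith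
  moreover have "1/2 \<le> ag h a" using det_a \<tau> by linarith
  ultimately obtain c where c: "a \<le> c" "c \<le> b" "ag h c = 1/2"
    using IVT2'[of "ag h" b "1/2" a] continuous_agree[of h] det_a ab by auto
  have far: "gap < \<bar>x - c\<bar>" if "g \<in> H" "ag g x > 1 - \<tau>" "ag g c \<le> 1/2" for g x
  proof -
    have "1/2 - \<tau> < \<bar>x - c\<bar> / (2 * \<delta>)" using agree_Lipschitz[OF that(1), of x c] that by linarith
    then show ?thesis using \<delta> by (simp add: gap_def field_simps)
  qed
  have "ag h' c \<le> 1/2" using agree_add_le_1[of h h' c] det_a det_b ne c(3) by linarith
  then have "a < c - gap" "c + gap < b" using far[of h a] far[of h' b] det_a det_b c by auto
  with c(3) show ?thesis by (rule that)
qed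

text \<open>Around a point \<open>c\<close> with \<open>ag h c = 1/2\<close> no hypothesis agrees with \<open>f\<close> on much more than half of the
  window, by the Lipschitz bound.\<close>

lemma transition_cost:
  assumes a: "determined h a" and b: "determined h' b" and ne: "h \<noteq> h'" and ab: "a < b"
  shows "cost \<le> (\<integral>x. excess x * indicator {a<..b} x \<partial>lborel)"
proof -
  obtain c where c: "ag h c = 1/2" "a < c - gap" "c + gap < b" by (rule exists_half_agreement[OF a b ne ab])
  let ?tent = "\<lambda>x. (1/2 - \<eta> - 1 / (2 * \<delta>) * \<bar>x - c\<bar>) * indicator {c - gap..c + gap} x"
  have "2 * (1/2 - \<eta>) * gap - 1 / (2 * \<delta>) * gap\<^sup>2 = cost + \<delta> * (4 * \<tau> * \<eta>)"
    using \<delta> by (simp add: gap_def cost_def field_simps power2_eq_square)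
  then have "cost \<le> 2 * (1/2 - \<eta>) * gap - 1 / (2 * \<delta>) * gap\<^sup>2" using \<delta> \<eta> by simp
  also have "\<dots> = (\<integral>x. ?tent x \<partial>lborel)" using gap_pos by (subst integral_tent) auto
  also have "\<dots> \<le> (\<integral>x. excess x * indicator {a<..b} x \<partial>lborel)"
  proof (rule integral_mono)
    show "integrable lborel ?tent" using gap_pos by (intro integral_tent) auto
    show "integrable lborel (\<lambda>x. excess x * indicator {a<..b} x)" by (intro integrable_excess) auto
    show "?tent x \<le> excess x * indicator {a<..b} x" for x
    proof (cases "x \<in> {c - gap..c + gap}")
      case True
      then have "x \<in> {a<..b}" "x \<in> {\<delta>..1 - \<delta>}" using c(2,3) a b by (auto simp: determined_def)
      then show ?thesis using NS_ge_tent[of h c x] a c(1) True by (simp add: determined_def excess_NS_def)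
    next
      case False
      then have "indicator {c - gap..c + gap} x = (0 :: real)" by (rule indicator_simps(2))
      then show ?thesis using excess_bounds(1)[of x] by simp
    qed
  qed
  finally show ?thesis .
qed

lemma alternating_cost:
  "alternating label determined_points n x \<Longrightarrow> (real n - 1) * cost \<le> (\<integral>t. excess t * indicator {..x} t \<partial>lborel)"
proof (induction rule: alternating.induct)
  case (alternating_1 x)
  then show ?case using excess_bounds by (simp add: integral_nonneg_AE)
next
  case (alternating_Suc n x y)
  obtain h h' where h: "determined h x" "determined h' y"
    using alternating_in[OF alternating_Suc.hyps(1)] alternating_Suc.hyps(3) by blast
  then have "h \<noteq> h'" using alternating_Suc.hyps(4) by (auto simp: label_eq)
  have "(real (Suc n) - 1) * cost = (real n - 1) * cost + cost" by (simp add: algebra_simps)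
  also have "\<dots> \<le> (\<integral>t. excess t * indicator {..x} t \<partial>lborel) + (\<integral>t. excess t * indicator {x<..y} t \<partial>lborel)"
    by (intro add_mono alternating_Suc.IH transition_cost[OF h \<open>h \<noteq> h'\<close> alternating_Suc.hyps(2)])
  also have "\<dots> = (\<integral>t. excess t * indicator {..x} t + excess t * indicator {x<..y} t \<partial>lborel)"
    by (subst Bochner_Integration.integral_add) (auto intro!: integrable_excess)
  also have "\<dots> = (\<integral>t. excess t * indicator {..y} t \<partial>lborel)"
    using alternating_Suc.hyps(2) by (intro Bochner_Integration.integral_cong) (auto simp: indicator_def)
  finally show ?case .
qed

definition max_alternation :: nat where "max_alternation = nat \<lfloor>total_excess / cost\<rfloor> + 1"

lemma max_alternation_le: "real max_alternation \<le> total_excess / cost + 1"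
  using total_excess_nonneg cost_pos by (simp add: max_alternation_def)

lemma alternating_le:
  assumes "alternating label determined_points n x"
  shows "n \<le> max_alternation"
proof -
  have "(\<integral>t. excess t * indicator {..x} t \<partial>lborel) \<le> total_excess"
    unfolding total_excess_def using integrable_excess[of UNIV] excess_bounds
    by (intro integral_mono integrable_excess) (auto simp: indicator_def)
  then have "(real n - 1) * cost \<le> total_excess" using alternating_cost[OF assms] by linarith
  then have "real n - 1 \<le> total_excess / cost" using cost_pos by (simp add: field_simps)
  then have "int n - 1 \<le> \<lfloor>total_excess / cost\<rfloor>" by (simp add: le_floor_iff)
  then show ?thesis unfolding max_alternation_def by linarith
qed

lemma level_labels:
  assumes "H \<noteq> {}"
  obtains r :: "real \<Rightarrow> nat" and lab :: "nat \<Rightarrow> real \<Rightarrow> 'y" where "mono r" "\<And>j. lab j \<in> H"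
    "\<And>h x. determined h x \<Longrightarrow> r x \<in> {1..max_alternation} \<and> lab (r x) = h"
proof -
  obtain r :: "real \<Rightarrow> nat" where r: "mono r" "\<And>x. r x \<le> max_alternation" "\<And>x. x \<in> determined_points \<Longrightarrow> r x \<ge> 1"
    "\<And>x y. x \<in> determined_points \<Longrightarrow> y \<in> determined_points \<Longrightarrow> r x = r y \<Longrightarrow> label x = label y"
    using bounded_alternation_rank[of label determined_points max_alternation] alternating_le by blast
  obtain h0 where "h0 \<in> H" using assms by blast
  define lab where "lab j = (if \<exists>x\<in>determined_points. r x = j
    then label (SOME x. x \<in> determined_points \<and> r x = j) else h0)" for j
  have lab_r: "lab (r x) = label x" if "x \<in> determined_points" for x
  proof -
    let ?y = "SOME y. y \<in> determined_points \<and> r y = r x"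
    have "\<exists>y. y \<in> determined_points \<and> r y = r x" using that by blast
    then have "?y \<in> determined_points \<and> r ?y = r x" by (rule someI_ex)
    then have "label ?y = label x" using r(4)[OF _ that] by blast
    then show ?thesis using that unfolding lab_def by auto
  qed
  show ?thesis
  proof (rule that[OF r(1)])
    show "lab j \<in> H" for j
    proof (cases "\<exists>x\<in>determined_points. r x = j")
      case True
      then obtain x h where "x \<in> determined_points" "r x = j" "determined h x" by blast
      then show ?thesis using lab_r[of x] label_eq[of h x] by (simp add: determined_def)
    next
      case False
      then show ?thesis using \<open>h0 \<in> H\<close> by (auto simp: lab_def)
    qed
    show "r x \<in> {1..max_alternation} \<and> lab (r x) = h" if "determined h x" for h x
      using that r(2,3)[of x] lab_r[of x] label_eq[OF that] by auto
  qed
qed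

end

lemma sets_mono_level:
  fixes r :: "real \<Rightarrow> nat"
  assumes "mono r"
  shows "{x. r x \<in> B} \<in> sets borel"
proof -
  have "(\<lambda>x. real (r x)) \<in> borel_measurable borel"
    by (rule borel_measurable_mono) (use assms in \<open>auto simp: mono_def\<close>)
  moreover have "real ` B \<in> sets borel"
    by (rule sets.countable[OF _ countable_image[OF countableI_type]]) simp
  ultimately have "(\<lambda>x. real (r x)) -` (real ` B) \<inter> space borel \<in> sets borel"
    by (rule measurable_sets)
  moreover have "(\<lambda>x. real (r x)) -` (real ` B) \<inter> space borel = {x. r x \<in> B}" by auto
  ultimately show ?thesis by simp
qed

lemma (in prob_space) exists_few_heavy_levels:
  fixes r :: "'a \<Rightarrow> nat"
  assumes r: "\<And>B. {x. r x \<in> B} \<in> events" and k: "k > 0"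
  shows "\<exists>S\<subseteq>{1..n}. card S \<le> k \<and> prob {x. r x \<in> {1..n} - S} \<le> max 0 ((real n - real k) / real k)"
proof -
  define w where "w j = prob {x. r x = j}" for j
  have w_sum: "sum w B = prob {x. r x \<in> B}" if "finite B" for B
  proof -
    have "prob (\<Union>j\<in>B. {x. r x = j}) = sum w B"
      unfolding w_def using r[of "{_}"] that
      by (intro finite_measure_finite_Union) (auto simp: disjoint_family_on_def)
    moreover have "(\<Union>j\<in>B. {x. r x = j}) = {x. r x \<in> B}" by auto
    ultimately show ?thesis by simp
  qed
  obtain S where S: "S \<subseteq> {1..n}" "card S \<le> k" "sum w ({1..n} - S) \<le> max 0 ((real n - real k) / real k)"
    using exists_subset_light_complement[of "{1..n}" w k] k w_sum[of "{1..n}"] by (auto simp: w_def)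
  then show ?thesis using w_sum[of "{1..n} - S"] by (intro exI[of _ S]) simp
qed

context rounding
begin

lemma prob_large_excess_le: "measure uniform01 {x. excess x \<ge> \<tau> - \<eta>} \<le> total_excess / (\<tau> - \<eta>)"
proof -
  interpret U: prob_space uniform01 by (rule prob_space_uniform01)
  note [measurable] = excess_NS_measurable
  have "integrable uniform01 excess" using excess_bounds by (intro U.integrable_const_bound[where B=1]) auto
  then have "U.prob {x \<in> space uniform01. excess x \<ge> \<tau> - \<eta>} \<le> (\<integral>x. excess x \<partial>uniform01) / (\<tau> - \<eta>)"
    using excess_bounds \<eta> by (intro integral_Markov_inequality_measure[where A="{}"]) auto
  then show ?thesis by (simp add: integral_excess_uniform01)
qed

lemma exists_determined:
  assumes "x \<in> {\<delta>..1 - \<delta>}" "excess x < \<tau> - \<eta>"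
  shows "\<exists>h. h x = f x \<and> determined h x"
proof -
  have "NS x < \<tau>" using assms by (auto simp: excess_NS_def)
  then show ?thesis using NS_less_iff[of \<tau> x] \<tau> assms(1) by (auto simp: determined_def)
qed

lemma exists_close_piecewise:
  assumes H: "H \<noteq> {}" and k: "k \<ge> 1"
  shows "\<exists>g\<in>piecewise k H. fdist uniform01 f g
    \<le> 2 * \<delta> + total_excess / (\<tau> - \<eta>) + max 0 ((total_excess / cost - (real k - 1)) / real k)"
proof -
  interpret U: prob_space uniform01 by (rule prob_space_uniform01)
  let ?N = "{1..max_alternation}"
  obtain r lab where r: "mono r" and lab: "\<And>j. lab j \<in> H"
    and det: "\<And>h x. determined h x \<Longrightarrow> r x \<in> ?N \<and> lab (r x) = h"
    using level_labels[OF H] by blast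
  have r_meas: "{x. r x \<in> B} \<in> sets borel" for B by (rule sets_mono_level[OF r])
  obtain S where S: "S \<subseteq> ?N" "card S \<le> k"
    "U.prob {x. r x \<in> ?N - S} \<le> max 0 ((real max_alternation - real k) / real k)"
    using U.exists_few_heavy_levels[of r k max_alternation] r_meas k by auto
  obtain g F where g: "g \<in> piecewise k H" and F: "finite F"
    and gF: "\<And>x. x \<in> {0<..<1} - F \<Longrightarrow> r x \<in> S \<Longrightarrow> g x = lab (r x) x"
    using exists_piecewise_of_levels[of r S k lab H 0 1, OF r finite_subset[OF S(1)] S(2) k lab] by blast
  define margin where "margin = - {\<delta>..1 - \<delta>}"
  define sensitive where "sensitive = {x. excess x \<ge> \<tau> - \<eta>}"
  define dropped where "dropped = {x. r x \<in> ?N - S}"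
  note [measurable] = excess_NS_measurable
  have meas: "margin \<in> sets borel" "sensitive \<in> sets borel" "dropped \<in> sets borel" "F \<in> sets borel"
    using r_meas[of "?N - S"] F unfolding margin_def sensitive_def dropped_def
    by (simp_all add: finite_imp_closed borel_closed)
  have "{x \<in> space uniform01. f x \<noteq> g x} \<subseteq> margin \<union> sensitive \<union> dropped \<union> F"
  proof (rule subsetI, rule ccontr)
    fix x assume fg: "x \<in> {x \<in> space uniform01. f x \<noteq> g x}" and x: "x \<notin> margin \<union> sensitive \<union> dropped \<union> F"
    then have "x \<in> {\<delta>..1 - \<delta>}" "excess x < \<tau> - \<eta>" by (auto simp: margin_def sensitive_def)
    then obtain h where h: "h x = f x" "determined h x" using exists_determined by blast
    then show False
      using det[OF h(2)] gF[of x] x fg \<delta> \<open>x \<in> {\<delta>..1 - \<delta>}\<close> by (auto simp: dropped_def)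
  qed
  then have "fdist uniform01 f g \<le> U.prob (margin \<union> sensitive \<union> dropped \<union> F)"
    unfolding fdist_def using meas by (intro U.finite_measure_mono) auto
  also have "\<dots> \<le> U.prob margin + U.prob sensitive + U.prob dropped + U.prob F"
    using meas by (intro order.trans[OF measure_Un_le] add_mono order.refl) auto
  also have "U.prob margin = 2 * \<delta>" unfolding margin_def by (rule measure_uniform01_margin[OF \<delta>])
  also have "U.prob sensitive \<le> total_excess / (\<tau> - \<eta>)"
    unfolding sensitive_def by (rule prob_large_excess_le)
  also have "U.prob dropped \<le> max 0 ((total_excess / cost - (real k - 1)) / real k)"
    unfolding dropped_def
    by (rule order.trans[OF S(3)], intro max.mono divide_right_mono) (use max_alternation_le in auto)
  also have "U.prob F = 0" by (rule measure_uniform01_finite[OF F])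
  finally show ?thesis using g by (intro bexI[of _ g]) auto
qed

end

lemma radius_bounds:
  fixes \<epsilon> :: real
  assumes eps: "0 < \<epsilon>" "\<epsilon> < 1/2" and k: "real k \<ge> 80 / \<epsilon>"
  shows "real k > 160" "80 \<le> real k * \<epsilon>" "0 < radius \<epsilon> k" "radius \<epsilon> k < 1/2"
    "real k * radius \<epsilon> k = \<epsilon>\<^sup>2 / 32" "2 * radius \<epsilon> k \<le> \<epsilon> / 1000"
proof -
  have "160 < 80 / \<epsilon>" using eps by (simp add: field_simps)
  then show k_gt: "real k > 160" using k by linarith
  show "80 \<le> real k * \<epsilon>" using k eps by (simp add: field_simps)
  show "0 < radius \<epsilon> k" using eps k_gt by (simp add: radius_def)
  show "real k * radius \<epsilon> k = \<epsilon>\<^sup>2 / 32" using k_gt by (simp add: radius_def)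
  have "\<epsilon>\<^sup>2 \<le> \<epsilon> * (1/2)" using eps by (simp add: power2_eq_square)
  then have "\<epsilon>\<^sup>2 / (32 * real k) \<le> (\<epsilon> * (1/2)) / (32 * 160)"
    using k_gt eps by (intro frac_le) auto
  then show "2 * radius \<epsilon> k \<le> \<epsilon> / 1000" using eps by (simp add: radius_def)
  then show "radius \<epsilon> k < 1/2" using eps by linarith
qed

lemma rounding_error_less:
  fixes \<epsilon> \<mu> :: real
  assumes eps: "0 < \<epsilon>" "\<epsilon> < 1/2" and k: "real k \<ge> 80 / \<epsilon>"
  defines "\<delta> \<equiv> radius \<epsilon> k"
  defines "cost \<equiv> \<delta> / 2 * (1 - 4 * (\<epsilon> / 8)\<^sup>2 - 4 * (\<epsilon> / 128))"
  assumes \<mu>: "\<mu> \<le> (real k - 1) * (\<delta> / 2) * (1 + \<epsilon> / 4)"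
  shows "2 * \<delta> + \<mu> / (\<epsilon> / 8 - \<epsilon> / 128) + max 0 ((\<mu> / cost - (real k - 1)) / real k) < \<epsilon>"
proof -
  note radius = radius_bounds[OF eps k, folded \<delta>_def]
  have sq: "\<epsilon>\<^sup>2 \<le> \<epsilon> * (1/2)" using eps by (simp add: power2_eq_square)
  have "\<mu> / (\<epsilon> / 8 - \<epsilon> / 128) \<le> 3 / 20 * \<epsilon>"
  proof -
    have "\<mu> \<le> (real k * (\<delta> / 2)) * (9/8)"
      by (rule order.trans[OF \<mu>]) (use radius eps in \<open>intro mult_mono, auto\<close>)
    also have "\<dots> = (real k * \<delta>) * (9/16)" by simp
    also have "\<dots> = 9/512 * \<epsilon>\<^sup>2" unfolding radius(5) by simp
    finally show ?thesis using eps by (simp add: field_simps power2_eq_square)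
  qed
  moreover have "max 0 ((\<mu> / cost - (real k - 1)) / real k) \<le> \<epsilon> / 2"
  proof -
    let ?c = "1 - 4 * (\<epsilon> / 8)\<^sup>2 - 4 * (\<epsilon> / 128)"
    have c: "1 - \<epsilon> / 16 \<le> ?c" using sq by (simp add: power_divide)
    have "(1 + \<epsilon> / 2) * (1 - \<epsilon> / 16) = 1 + 7/16 * \<epsilon> - \<epsilon>\<^sup>2 / 32" by (simp add: power2_eq_square field_simps)
    then have "1 + \<epsilon> / 4 \<le> (1 + \<epsilon> / 2) * (1 - \<epsilon> / 16)" using sq eps by linarith
    also have "\<dots> \<le> (1 + \<epsilon> / 2) * ?c" using c eps by (intro mult_left_mono) auto
    finally have "(real k - 1) * (\<delta> / 2) * (1 + \<epsilon> / 4) \<le> (real k - 1) * (\<delta> / 2) * ((1 + \<epsilon> / 2) * ?c)"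
      using radius by (intro mult_left_mono) auto
    with \<mu> have "\<mu> \<le> ((real k - 1) * (1 + \<epsilon> / 2)) * cost" by (simp add: cost_def mult_ac)
    moreover have "cost > 0" using c radius eps by (auto simp: cost_def)
    ultimately have "\<mu> / cost \<le> (real k - 1) + (real k - 1) * (\<epsilon> / 2)"
      by (simp add: pos_divide_le_eq distrib_left)
    then have "\<mu> / cost - (real k - 1) \<le> (real k - 1) * (\<epsilon> / 2)" by linarith
    also have "\<dots> \<le> real k * (\<epsilon> / 2)" using eps by (intro mult_right_mono) auto
    finally have "(\<mu> / cost - (real k - 1)) / real k \<le> \<epsilon> / 2"
      using radius(1) by (simp add: pos_divide_le_eq mult.commute)
    then show ?thesis by (rule max.boundedI[rotated]) (use eps in simp)
  qed
  ultimately show ?thesis using radius(6) eps by linarith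
qed

lemma noise_sensitivityI:
  assumes sets: "\<And>h. h \<in> H \<Longrightarrow> {x. h x = f x} \<in> sets borel" and zc: "zero_measure_crossings H"
    and "0 < \<delta>" "\<delta> < 1/2"
  shows "noise_sensitivity H f \<delta>"
proof
  fix h h' assume h: "h \<in> H" "h' \<in> H" "h \<noteq> h'"
  have "{x. h x = h' x} \<in> null_sets lebesgue" using zc h unfolding zero_measure_crossings_def by blast
  then have "{x. h x = f x} \<inter> {x. h' x = f x} \<in> null_sets lebesgue"
    by (rule null_sets_subset) (use sets h in auto)
  then show "{x. h x = f x} \<inter> {x. h' x = f x} \<in> null_sets lborel"
    using sets[OF h(1)] sets[OF h(2)] by (subst (asm) null_sets_completion_iff) auto
qed (use assms in auto)

lemma far_target_sensitivity:
  assumes H: "H \<noteq> {}" and eps: "0 < \<epsilon>" "\<epsilon> < 1/2" and k: "real k \<ge> 80 / \<epsilon>"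
    and ns: "noise_sensitivity H f (radius \<epsilon> k)"
    and far: "\<epsilon> \<le> dist_class uniform01 f (piecewise k H)"
  shows "(real k - 1) * (radius \<epsilon> k / 2) * (1 + \<epsilon> / 4) < (\<integral>x. excess_NS H (radius \<epsilon> k) f (\<epsilon> / 128) x \<partial>uniform01)"
proof (rule ccontr)
  interpret noise_sensitivity H f "radius \<epsilon> k" by (rule ns)
  interpret rounding H f "radius \<epsilon> k" "\<epsilon> / 8" "\<epsilon> / 128" by unfold_locales (use eps in auto)
  assume "\<not> ?thesis"
  then have "total_excess \<le> (real k - 1) * (radius \<epsilon> k / 2) * (1 + \<epsilon> / 4)"
    unfolding integral_excess_uniform01 by simp
  note error = rounding_error_less[OF eps k this, folded cost_def]
  have "k \<ge> 1" using radius_bounds(1)[OF eps k] by linarith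
  then obtain g where "g \<in> piecewise k H" "fdist uniform01 f g < \<epsilon>"
    using exists_close_piecewise[OF H] error by (meson order.strict_trans1)
  moreover have "dist_class uniform01 f (piecewise k H) \<le> fdist uniform01 f g" if "g \<in> piecewise k H" for g
    unfolding dist_class_def using that by (intro cINF_lower bdd_belowI[of _ 0]) (auto simp: fdist_def)
  ultimately show False using far by fastforce
qed

section \<open>Noise sensitivity of piecewise targets\<close>

definition tent :: "real \<Rightarrow> real \<Rightarrow> real \<Rightarrow> real \<Rightarrow> real" where
  "tent \<delta> \<eta> c x = (1/2 + \<eta> - 1 / (2 * \<delta>) * \<bar>x - c\<bar>) * indicator {c - \<delta>..c + \<delta>} x"

definition breakpoint_NS :: "real \<Rightarrow> real \<Rightarrow> nat \<Rightarrow> (nat \<Rightarrow> real) \<Rightarrow> real \<Rightarrow> real" where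
  "breakpoint_NS \<delta> \<eta> k s x = min 1 ((\<Sum>j\<in>{1..<k}. tent \<delta> \<eta> (s j) x) + indicator (- {\<delta>..1 - \<delta>}) x)"

lemma tent_eq:
  assumes "\<delta> > 0"
  shows "tent \<delta> \<eta> c x = max 0 (\<delta> - \<bar>x - c\<bar>) / (2 * \<delta>) + \<eta> * indicator {c - \<delta>..c + \<delta>} x"
proof (cases "x \<in> {c - \<delta>..c + \<delta>}")
  case True
  then have "max 0 (\<delta> - \<bar>x - c\<bar>) = \<delta> - \<bar>x - c\<bar>" by auto
  then show ?thesis using True assms by (simp add: tent_def field_simps)
next
  case False
  then have "max 0 (\<delta> - \<bar>x - c\<bar>) = 0" by auto
  moreover have "indicator {c - \<delta>..c + \<delta>} x = (0 :: real)" using False by (rule indicator_simps(2))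
  ultimately show ?thesis by (simp add: tent_def)
qed

lemma tent_nonneg: "\<delta> > 0 \<Longrightarrow> \<eta> \<ge> 0 \<Longrightarrow> 0 \<le> tent \<delta> \<eta> c x"
  unfolding tent_eq by simp

lemma tent_measurable [measurable]: "tent \<delta> \<eta> c \<in> borel_measurable borel"
  unfolding tent_def[abs_def] by measurable

lemma integral_tent_uniform01:
  assumes "\<delta> > 0" "\<eta> \<ge> 0"
  shows "integrable uniform01 (tent \<delta> \<eta> c)" "(\<integral>x. tent \<delta> \<eta> c x \<partial>uniform01) \<le> \<delta> / 2 + 2 * \<delta> * \<eta>"
proof -
  interpret prob_space uniform01 by (rule prob_space_uniform01)
  note nonneg = tent_nonneg[OF assms]
  have lborel: "integrable lborel (tent \<delta> \<eta> c)"
      "(\<integral>x. tent \<delta> \<eta> c x \<partial>lborel) = 2 * (1/2 + \<eta>) * \<delta> - 1 / (2 * \<delta>) * \<delta>\<^sup>2"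
    unfolding tent_def[abs_def] using assms(1) by (intro integral_tent less_imp_le; simp)+
  show "integrable uniform01 (tent \<delta> \<eta> c)"
  proof (rule integrable_const_bound[where B="1/2 + \<eta>"])
    have "tent \<delta> \<eta> c x \<le> 1/2 + \<eta>" for x using assms by (auto simp: tent_def indicator_def)
    then show "AE x in uniform01. norm (tent \<delta> \<eta> c x) \<le> 1/2 + \<eta>" using nonneg by simp
  qed simp
  have "(\<integral>x. tent \<delta> \<eta> c x \<partial>uniform01) = (\<integral>x. indicator {0<..<1} x * tent \<delta> \<eta> c x \<partial>lborel)"
    by (rule integral_uniform01) simp
  also have "\<dots> \<le> (\<integral>x. tent \<delta> \<eta> c x \<partial>lborel)"
  proof (rule integral_mono[OF _ lborel(1)])
    show "integrable lborel (\<lambda>x. indicator {0<..<1} x * tent \<delta> \<eta> c x)"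
      by (rule Bochner_Integration.integrable_bound[OF lborel(1)]) (auto simp: indicator_def)
    show "indicator {0<..<1} x * tent \<delta> \<eta> c x \<le> tent \<delta> \<eta> c x" for x
      using nonneg by (auto simp: indicator_def)
  qed
  also have "\<dots> = \<delta> / 2 + 2 * \<delta> * \<eta>"
    unfolding lborel(2) using assms by (simp add: field_simps power2_eq_square)
  finally show "(\<integral>x. tent \<delta> \<eta> c x \<partial>uniform01) \<le> \<delta> / 2 + 2 * \<delta> * \<eta>" .
qed

lemma breakpoint_NS_measurable: "breakpoint_NS \<delta> \<eta> k s \<in> borel_measurable borel"
  unfolding breakpoint_NS_def[abs_def] by measurable

lemma breakpoint_NS_bounds:
  assumes "\<delta> > 0" "\<eta> \<ge> 0"
  shows "0 \<le> breakpoint_NS \<delta> \<eta> k s x" "breakpoint_NS \<delta> \<eta> k s x \<le> 1"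
  using tent_nonneg[OF assms] by (auto simp: breakpoint_NS_def intro!: add_nonneg_nonneg sum_nonneg)

lemma integral_breakpoint_NS_le:
  assumes \<delta>: "0 < \<delta>" "\<delta> < 1/2" and \<eta>: "\<eta> \<ge> 0" and k: "k \<ge> 1"
  shows "(\<integral>x. breakpoint_NS \<delta> \<eta> k s x \<partial>uniform01) \<le> (real k - 1) * (\<delta> / 2 + 2 * \<delta> * \<eta>) + 2 * \<delta>"
proof -
  interpret prob_space uniform01 by (rule prob_space_uniform01)
  note tent = integral_tent_uniform01[OF \<delta>(1) \<eta>]
  have margin: "integrable uniform01 (indicator (- {\<delta>..1 - \<delta>}) :: real \<Rightarrow> real)"
    by (intro integrable_real_indicator) (auto simp: emeasure_eq_measure)
  have "(\<integral>x. breakpoint_NS \<delta> \<eta> k s x \<partial>uniform01)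
      \<le> (\<integral>x. (\<Sum>j\<in>{1..<k}. tent \<delta> \<eta> (s j) x) + indicator (- {\<delta>..1 - \<delta>}) x \<partial>uniform01)"
  proof (rule integral_mono)
    show "integrable uniform01 (breakpoint_NS \<delta> \<eta> k s)"
      using breakpoint_NS_bounds[OF \<delta>(1) \<eta>] breakpoint_NS_measurable
      by (intro integrable_const_bound[where B=1]) auto
  qed (use tent(1) margin in \<open>auto simp: breakpoint_NS_def\<close>)
  also have "\<dots> = (\<Sum>j\<in>{1..<k}. (\<integral>x. tent \<delta> \<eta> (s j) x \<partial>uniform01)) + measure uniform01 (- {\<delta>..1 - \<delta>})"
    using tent(1) by (subst Bochner_Integration.integral_add[OF Bochner_Integration.integrable_sum margin])
      (simp_all add: Bochner_Integration.integral_sum)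
  also have "\<dots> \<le> (\<Sum>j\<in>{1..<k}. \<delta> / 2 + 2 * \<delta> * \<eta>) + 2 * \<delta>"
    unfolding measure_uniform01_margin[OF \<delta>] by (intro add_right_mono sum_mono tent(2))
  also have "\<dots> = (real k - 1) * (\<delta> / 2 + 2 * \<delta> * \<eta>) + 2 * \<delta>" using k by (simp add: of_nat_diff)
  finally show ?thesis .
qed

lemma one_minus_window_frac_le:
  assumes \<delta>: "0 < \<delta>" and A: "A \<in> sets borel" and J: "finite J"
    and sep: "\<And>y. y \<notin> A \<Longrightarrow> \<exists>j\<in>J. y \<le> s j \<and> s j < x \<or> x \<le> s j \<and> s j < y"
  shows "1 - window_frac \<delta> A x \<le> (\<Sum>j\<in>J. max 0 (\<delta> - \<bar>x - s j\<bar>) / (2 * \<delta>))"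
proof -
  let ?w = "window \<delta> x"
  define B where "B j = (if s j < x then {x - \<delta>..s j} else {s j..x + \<delta>})" for j
  have B: "B j \<in> fmeasurable lborel" "measure lborel (B j) = max 0 (\<delta> - \<bar>x - s j\<bar>)" for j
    by (auto simp: B_def fmeasurable_def measure_def emeasure_lborel_Icc_eq)
  note Aw = fmeasurable_Int_window[OF A \<delta>, of x]
  have "2 * \<delta> = measure lborel ?w" using \<delta> by simp
  also have "\<dots> \<le> measure lborel ((A \<inter> ?w) \<union> (\<Union>j\<in>J. B j))"
  proof (rule measure_mono_fmeasurable)
    show "?w \<subseteq> (A \<inter> ?w) \<union> (\<Union>j\<in>J. B j)"
    proof
      fix y assume y: "y \<in> ?w"
      show "y \<in> (A \<inter> ?w) \<union> (\<Union>j\<in>J. B j)"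
      proof (cases "y \<in> A")
        case False
        then obtain j where "j \<in> J" "y \<le> s j \<and> s j < x \<or> x \<le> s j \<and> s j < y" using sep by blast
        then have "j \<in> J" "y \<in> B j" using y by (auto simp: B_def)
        then show ?thesis by blast
      qed (use y in simp)
    qed
    show "(A \<inter> ?w) \<union> (\<Union>j\<in>J. B j) \<in> fmeasurable lborel"
      using Aw B(1) J by (intro fmeasurable.Un fmeasurable.finite_UN) auto
  qed simp
  also have "\<dots> \<le> measure lborel (A \<inter> ?w) + measure lborel (\<Union>j\<in>J. B j)"
    using Aw B J by (intro measure_Un_le sets.finite_UN) (auto simp: fmeasurable_def)
  also have "measure lborel (\<Union>j\<in>J. B j) \<le> (\<Sum>j\<in>J. measure lborel (B j))"
    using B J by (intro measure_UNION_le) (auto simp: fmeasurable_def)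
  finally have "2 * \<delta> / (2 * \<delta>) \<le> (measure lborel (A \<inter> ?w) + (\<Sum>j\<in>J. max 0 (\<delta> - \<bar>x - s j\<bar>))) / (2 * \<delta>)"
    using \<delta> by (intro divide_right_mono) (auto simp: B)
  then show ?thesis using \<delta> by (simp add: window_frac_def add_divide_distrib sum_divide_distrib)
qed

lemma breakpoint_NS_ge:
  assumes bp: "has_breakpoints H k f s" and sets: "\<And>h. h \<in> H \<Longrightarrow> {x. h x = f x} \<in> sets borel"
    and \<delta>: "0 < \<delta>" and \<eta>: "0 \<le> \<eta>" and less: "breakpoint_NS \<delta> \<eta> k s x < 1"
  shows "x \<in> {\<delta>..1 - \<delta>}"
    and "\<exists>h\<in>H. h x = f x \<and> ((\<forall>y\<in>window \<delta> x. h y = f y) \<or> 1 - agree \<delta> f h x + \<eta> \<le> breakpoint_NS \<delta> \<eta> k s x)"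
proof -
  have nonneg: "0 \<le> (\<Sum>j\<in>{1..<k}. tent \<delta> \<eta> (s j) x)" by (intro sum_nonneg tent_nonneg \<delta> \<eta>)
  show core: "x \<in> {\<delta>..1 - \<delta>}"
  proof (rule ccontr)
    assume "x \<notin> {\<delta>..1 - \<delta>}"
    then have "indicator (- {\<delta>..1 - \<delta>}) x = (1 :: real)" by (intro indicator_simps(1)) simp
    then show False using less nonneg by (simp add: breakpoint_NS_def)
  qed
  obtain h where h: "h \<in> H" "h x = f x"
    and sep: "\<And>y. h y \<noteq> f y \<Longrightarrow> \<exists>j\<in>{1..<k}. y \<le> s j \<and> s j < x \<or> x \<le> s j \<and> s j < y"
    using bp unfolding has_breakpoints_def by metis
  show "\<exists>h\<in>H. h x = f x \<and> ((\<forall>y\<in>window \<delta> x. h y = f y) \<or> 1 - agree \<delta> f h x + \<eta> \<le> breakpoint_NS \<delta> \<eta> k s x)"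
  proof (cases "\<forall>y\<in>window \<delta> x. h y = f y")
    case True
    then show ?thesis using h by blast
  next
    case False
    then obtain y i where "y \<in> window \<delta> x" "i \<in> {1..<k}" "y \<le> s i \<and> s i < x \<or> x \<le> s i \<and> s i < y"
      using sep by blast
    then have i: "i \<in> {1..<k}" "x \<in> {s i - \<delta>..s i + \<delta>}" by auto
    then have "\<eta> = \<eta> * indicator {s i - \<delta>..s i + \<delta>} x" by simp
    also have "\<dots> \<le> (\<Sum>j\<in>{1..<k}. \<eta> * indicator {s j - \<delta>..s j + \<delta>} x)"
      using i(1) \<eta> by (intro member_le_sum) auto
    finally have "\<eta> \<le> (\<Sum>j\<in>{1..<k}. \<eta> * indicator {s j - \<delta>..s j + \<delta>} x)" .
    moreover have "1 - agree \<delta> f h x \<le> (\<Sum>j\<in>{1..<k}. max 0 (\<delta> - \<bar>x - s j\<bar>) / (2 * \<delta>))"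
      unfolding agree_def using sep by (intro one_minus_window_frac_le \<delta> sets h(1)) auto
    ultimately have "1 - agree \<delta> f h x + \<eta> \<le> (\<Sum>j\<in>{1..<k}. tent \<delta> \<eta> (s j) x)"
      by (simp add: tent_eq[OF \<delta>] sum.distrib)
    also have "\<dots> = breakpoint_NS \<delta> \<eta> k s x" using less core by (auto simp: breakpoint_NS_def)
    finally show ?thesis using h by blast
  qed
qed

section \<open>The procedure on a fixed sample\<close>

abbreviation hits :: "real \<Rightarrow> nat \<Rightarrow> nat \<Rightarrow> (nat \<Rightarrow> real) \<Rightarrow> nat \<Rightarrow> nat set" where
  "hits \<delta> m s x i \<equiv> {t \<in> {m + 1..s}. x t \<in> window \<delta> (x i)}"

abbreviation neighbours :: "real \<Rightarrow> nat \<Rightarrow> nat \<Rightarrow> nat \<Rightarrow> (nat \<Rightarrow> real) \<Rightarrow> nat \<Rightarrow> nat set" where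
  "neighbours \<delta> m s l x i \<equiv> first_hits l (window \<delta> (x i)) {m + 1..s} x"

lemma set_drop_strict_sorted:
  fixes xs :: "'a :: linorder list"
  assumes "sorted_wrt (<) xs" "0 < j" "j \<le> length xs"
  shows "set (drop j xs) = {a \<in> set xs. xs ! (j - 1) < a}"
proof -
  have "xs = take (j - 1) xs @ xs ! (j - 1) # drop j xs"
    using assms(2,3) id_take_nth_drop[of "j - 1" xs] by simp
  then obtain us v vs where xs: "xs = us @ v # vs" "v = xs ! (j - 1)" "vs = drop j xs" by blast
  have "\<forall>a\<in>set us. a < v" "\<forall>a\<in>set vs. v < a" using assms(1) by (simp_all add: xs(1) sorted_wrt_append)
  then have "set vs = {a \<in> set xs. v < a}" unfolding xs(1) by auto
  then show ?thesis using xs(2,3) by simp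
qed

lemma neighbour_eq_nth:
  fixes x :: "nat \<Rightarrow> real" and \<delta> :: real and m s :: nat
  defines "ts i \<equiv> sorted_list_of_set (hits \<delta> m s x i)"
  shows "neighbour m s \<delta> x i j =
    (if j = 0 then Some m else if j \<le> length (ts i) then Some (ts i ! (j - 1)) else None)"
proof (induction j)
  case (Suc j)
  have sorted: "sorted_wrt (<) (ts i)" and set: "set (ts i) = hits \<delta> m s x i" by (simp_all add: ts_def)
  show ?case
  proof (cases "j \<le> length (ts i)")
    case True
    define t where "t = (if j = 0 then m else ts i ! (j - 1))"
    have "t \<ge> m"
    proof (cases "j = 0")
      case False
      then have "ts i ! (j - 1) \<in> hits \<delta> m s x i"
        unfolding set[symmetric] using True by (intro nth_mem) simp
      then show ?thesis using False by (simp add: t_def)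
    qed (simp add: t_def)
    then have "{u \<in> {t + 1..s}. x u \<in> window \<delta> (x i)} = {u \<in> hits \<delta> m s x i. t < u}" by auto
    also have "\<dots> = set (drop j (ts i))"
    proof (cases "j = 0")
      case False
      then show ?thesis using set_drop_strict_sorted[OF sorted _ True] by (simp add: t_def set)
    qed (auto simp: t_def set)
    finally have next_hits: "{u \<in> {t + 1..s}. x u \<in> window \<delta> (x i)} = set (drop j (ts i))" .
    have "Min (set (drop j (ts i))) = ts i ! j" if "j < length (ts i)"
    proof (rule Min_eqI)
      have "sorted (drop j (ts i))" using sorted by (simp add: strict_sorted_imp_sorted)
      moreover have "drop j (ts i) = ts i ! j # drop (Suc j) (ts i)"
        using that by (rule Cons_nth_drop_Suc[symmetric])
      ultimately show "ts i ! j \<le> a" if "a \<in> set (drop j (ts i))" for a using that by auto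
      show "ts i ! j \<in> set (drop j (ts i))" using that by (auto simp: in_set_conv_nth intro!: exI[of _ 0])
    qed simp
    moreover have "neighbour m s \<delta> x i j = Some t" using Suc True by (simp add: t_def)
    ultimately show ?thesis using next_hits by (simp add: Let_def)
  next
    case False
    then show ?thesis using Suc by simp
  qed
qed simp

lemma neighbour_in_hits: "neighbour m s \<delta> x i j = Some t \<Longrightarrow> j > 0 \<Longrightarrow> t \<in> hits \<delta> m s x i"
  using nth_mem[of "j - 1" "sorted_list_of_set (hits \<delta> m s x i)"]
  by (auto simp: neighbour_eq_nth split: if_splits)

lemma bij_betw_neighbour:
  assumes "l \<le> card (hits \<delta> m s x i)"
  shows "\<forall>j\<in>{1..l}. neighbour m s \<delta> x i j \<noteq> None"
    and "bij_betw (\<lambda>j. the (neighbour m s \<delta> x i j)) {1..l} (neighbours \<delta> m s l x i)"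
proof -
  let ?ts = "sorted_list_of_set (hits \<delta> m s x i)"
  have nth: "neighbour m s \<delta> x i j = Some (take l ?ts ! (j - 1))" if "j \<in> {1..l}" for j
  proof -
    have "j - 1 < l" using that by auto
    then show ?thesis using that assms by (simp add: neighbour_eq_nth nth_take del: One_nat_def)
  qed
  then show "\<forall>j\<in>{1..l}. neighbour m s \<delta> x i j \<noteq> None" by simp
  have "bij_betw (\<lambda>j. j - 1) {1..l} {..<l}"
    by (rule bij_betwI[where g=Suc]) auto
  moreover have "bij_betw (nth (take l ?ts)) {..<l} (set (take l ?ts))"
    using assms by (intro bij_betw_nth) auto
  ultimately have "bij_betw (nth (take l ?ts) \<circ> (\<lambda>j. j - 1)) {1..l} (set (take l ?ts))"
    by (rule bij_betw_trans)
  then show "bij_betw (\<lambda>j. the (neighbour m s \<delta> x i j)) {1..l} (neighbours \<delta> m s l x i)"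
    unfolding first_hits_def
    by (subst bij_betw_cong[of _ _ "nth (take l ?ts) \<circ> (\<lambda>j. j - 1)"]) (simp_all add: nth)
qed

definition empirical_NS :: "(real \<Rightarrow> 'y) set \<Rightarrow> (real \<Rightarrow> 'y) \<Rightarrow> nat set \<Rightarrow> (nat \<Rightarrow> real) \<Rightarrow> real \<Rightarrow> real" where
  "empirical_NS H f T x y = Inf (insert 1 ((\<lambda>h. 1 - emp_freq T {z. h z = f z} x) ` consistent H y (f y)))"

lemma bdd_below_empirical_NS:
  "finite T \<Longrightarrow> bdd_below (insert 1 ((\<lambda>h. 1 - emp_freq T {z. h z = f z} x) ` consistent H y (f y)))"
  using emp_freq_bounds(2) by (intro bdd_belowI[of _ 0]) auto

lemma empirical_NS_le_1: "finite T \<Longrightarrow> empirical_NS H f T x y \<le> 1"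
  unfolding empirical_NS_def by (intro cInf_lower bdd_below_empirical_NS) auto

lemma empirical_NS_le:
  "finite T \<Longrightarrow> h \<in> H \<Longrightarrow> h y = f y \<Longrightarrow> empirical_NS H f T x y \<le> 1 - emp_freq T {z. h z = f z} x"
  unfolding empirical_NS_def by (intro cInf_lower bdd_below_empirical_NS) (auto simp: consistent_def)

lemma empirical_NS_ge:
  assumes "v \<le> 1" "\<And>h. h \<in> H \<Longrightarrow> h y = f y \<Longrightarrow> v \<le> 1 - emp_freq T {z. h z = f z} x"
  shows "v \<le> empirical_NS H f T x y"
  unfolding empirical_NS_def using assms by (intro cInf_greatest) (auto simp: consistent_def)

lemma finite_emp_freq_values:
  assumes "finite T"
  shows "finite ((\<lambda>g. emp_freq T g x) ` G)"
proof (rule finite_subset)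
  show "(\<lambda>g. emp_freq T g x) ` G \<subseteq> (\<lambda>n. real n / real (card T)) ` {..card T}"
    using assms by (auto simp: emp_freq_def intro!: imageI card_mono)
qed simp

lemma NS_hat_at_eq_empirical_NS:
  assumes l: "0 < l" and T: "bij_betw (t i) {1..l} T"
    and lab: "lab i = f (x i)" "\<And>j. j \<in> {1..l} \<Longrightarrow> lab (t i j) = f (x (t i j))"
  shows "NS_hat_at H l t x lab i = empirical_NS H f T x (x i)"
proof -
  have fin: "finite T" and card: "card T = l"
    using bij_betw_finite[OF T] bij_betw_same_card[OF T] by simp_all
  let ?A = "(\<lambda>h. 1 - emp_freq T {y. h y = f y} x) ` consistent H (x i) (f (x i))"
  have "1 / real l * (\<Sum>j=1..l. of_bool (h (x (t i j)) \<noteq> lab (t i j))) = 1 - emp_freq T {y. h y = f y} x" for h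
  proof -
    have "(\<Sum>j=1..l. of_bool (h (x (t i j)) \<noteq> lab (t i j)) :: real)
      = (\<Sum>j=1..l. of_bool (h (x (t i j)) \<noteq> f (x (t i j))))"
      using lab(2) by (intro sum.cong) auto
    also have "\<dots> = (\<Sum>u\<in>T. of_bool (h (x u) \<noteq> f (x u)))" by (rule sum.reindex_bij_betw[OF T])
    also have "\<dots> = (\<Sum>u\<in>T. 1 - indicator {y. h y = f y} (x u))"
      by (intro sum.cong) (auto simp: indicator_def)
    finally show ?thesis using l
      by (simp add: emp_freq_eq_sum[OF fin] card sum_subtractf diff_divide_distrib)
  qed
  then have NS_hat: "NS_hat_at H l t x lab i = (if ?A = {} then 1 else Min ?A)"
    by (simp add: NS_hat_at_def lab(1))
  have image: "?A = (\<lambda>v. 1 - v) ` (\<lambda>g. emp_freq T g x) ` (\<lambda>h. {y. h y = f y}) ` consistent H (x i) (f (x i))"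
    by (simp add: image_image)
  have "finite ?A" unfolding image by (intro finite_imageI finite_emp_freq_values[OF fin])
  have "Min (insert 1 ?A) = (if ?A = {} then 1 else Min ?A)"
  proof (cases "?A = {}")
    case False
    have "v \<le> 1" if "v \<in> ?A" for v using that emp_freq_bounds(1)[OF fin] by auto
    then have "Min ?A \<le> 1" using Min_in[OF \<open>finite ?A\<close> False] by blast
    then show ?thesis using Min_insert[OF \<open>finite ?A\<close> False, of 1] False
      by (simp only: min_absorb2 if_False)
  qed simp
  then show ?thesis
    unfolding NS_hat empirical_NS_def using \<open>finite ?A\<close> by (subst cInf_eq_Min) auto
qed

lemma run_query_all: "run (query_all ns lab D) labs = D (\<lambda>n. if n \<in> set ns then labs n else lab n)"
proof (induction ns arbitrary: lab)
  case (Cons n ns)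
  have "(\<lambda>a. if a \<in> set ns then labs a else (lab(n := labs n)) a)
    = (\<lambda>a. if a \<in> set (n # ns) then labs a else lab a)"
    by auto
  then show ?case using Cons by simp
qed simp

lemma query_bounded_query_all: "set ns \<subseteq> I \<Longrightarrow> length ns \<le> q \<Longrightarrow> query_bounded (query_all ns lab D) I q"
proof (induction ns arbitrary: lab q)
  case (Cons n ns)
  then show ?case by (cases q) auto
qed simp

definition queries :: "nat \<Rightarrow> nat \<Rightarrow> (nat \<Rightarrow> nat \<Rightarrow> nat) \<Rightarrow> nat list" where
  "queries m l t = concat (map (\<lambda>i. i # map (t i) [1..<l + 1]) [1..<m + 1])"

lemma set_queries: "set (queries m l t) = (\<Union>i\<in>{1..m}. insert i (t i ` {1..l}))"
  by (simp add: queries_def atLeastLessThanSuc_atLeastAtMost del: upt_Suc)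

lemma length_queries: "length (queries m l t) = m * (l + 1)"
  by (simp add: queries_def length_concat comp_def sum_list_triv)

lemma run_NS_procedure_iff:
  assumes m: "m > 0" and l: "l > 0" and many: "\<And>i. i \<in> {1..m} \<Longrightarrow> l \<le> card (hits \<delta> m s x i)"
  shows "run (NS_procedure H k \<epsilon> m l \<delta> s fallback \<omega> x) (\<lambda>n. f (x n)) \<longleftrightarrow>
    (\<Sum>i=1..m. empirical_NS H f (neighbours \<delta> m s l x i) x (x i))
    \<le> real m * ((real k - 1) * (\<delta> / 2) * (1 + \<epsilon> / 8))"
proof -
  let ?t = "\<lambda>i j. the (neighbour m s \<delta> x i j)"
  define lab where "lab n = (if n \<in> set (queries m l ?t) then f (x n) else undefined)" for n
  have exist: "\<forall>i\<in>{1..m}. \<forall>j\<in>{1..l}. neighbour m s \<delta> x i j \<noteq> None"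
    using bij_betw_neighbour(1)[OF many] by blast
  have "NS_hat_at H l ?t x lab i = empirical_NS H f (neighbours \<delta> m s l x i) x (x i)" if i: "i \<in> {1..m}" for i
  proof (rule NS_hat_at_eq_empirical_NS[where t="?t" and i=i, OF l bij_betw_neighbour(2)[OF many[OF i]]])
    show "lab i = f (x i)" using i by (auto simp: lab_def set_queries)
    show "lab (?t i j) = f (x (?t i j))" if "j \<in> {1..l}" for j
    proof -
      have "?t i j \<in> set (queries m l ?t)" using i that unfolding set_queries by blast
      then show ?thesis by (simp add: lab_def)
    qed
  qed
  then have "NS_hat H m l ?t x lab = 1 / real m * (\<Sum>i=1..m. empirical_NS H f (neighbours \<delta> m s l x i) x (x i))"
    by (simp add: NS_hat_def)
  moreover have "run (NS_procedure H k \<epsilon> m l \<delta> s fallback \<omega> x) (\<lambda>n. f (x n)) \<longleftrightarrow>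
      NS_hat H m l ?t x lab \<le> (real k - 1) * (\<delta> / 2) * (1 + \<epsilon> / 8)"
    unfolding NS_procedure_def if_P[OF exist] Let_def run_query_all lab_def queries_def ..
  ultimately show ?thesis using m by (simp add: pos_divide_le_eq mult.commute)
qed

lemma query_bounded_NS_procedure:
  assumes fallback: "query_bounded (fallback \<omega> x) {1..s} (m * (l + 1))" and ms: "m \<le> s"
  shows "query_bounded (NS_procedure H k \<epsilon> m l \<delta> s fallback \<omega> x) {1..s} (m * (l + 1))"
proof (cases "\<forall>i\<in>{1..m}. \<forall>j\<in>{1..l}. neighbour m s \<delta> x i j \<noteq> None")
  case True
  let ?t = "\<lambda>i j. the (neighbour m s \<delta> x i j)"
  have "?t i j \<in> {1..s}" if "i \<in> {1..m}" "j \<in> {1..l}" for i j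
    using True that neighbour_in_hits[of m s \<delta> x i j "?t i j"] by fastforce
  then have "set (queries m l ?t) \<subseteq> {1..s}" using ms by (auto simp: set_queries)
  then show ?thesis unfolding NS_procedure_def if_P[OF True] Let_def queries_def[symmetric]
    by (intro query_bounded_query_all) (simp_all add: length_queries)
next
  case False
  then show ?thesis using fallback by (simp only: NS_procedure_def if_False)
qed

section \<open>Uniform convergence on the first hits\<close>

lemma first_hits_restrict: "first_hits l W J (restrict x J) = first_hits l W J x"
proof -
  have "{t \<in> J. restrict x J t \<in> W} = {t \<in> J. x t \<in> W}" by auto
  then show ?thesis by (simp only: first_hits_def)
qed

definition in_order :: "nat \<Rightarrow> 'i :: linorder set \<Rightarrow> ('i \<Rightarrow> 'a) \<Rightarrow> nat \<Rightarrow> 'a" where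
  "in_order l T x = (\<lambda>j\<in>{..<l}. x (sorted_list_of_set T ! j))"

lemma bij_betw_nth_sorted_list_of_set:
  assumes "finite T" "card T = l"
  shows "bij_betw (nth (sorted_list_of_set T)) {..<l} T"
  using assms by (intro bij_betw_nth) auto

lemma in_order_restrict:
  assumes "finite T" "card T = l"
  shows "in_order l T (restrict x T) = in_order l T x"
  using bij_betwE[OF bij_betw_nth_sorted_list_of_set[OF assms]] by (auto simp: in_order_def)

lemma emp_freq_in_order:
  assumes T: "finite T" "card T = l"
  shows "emp_freq {..<l} g (in_order l T x) = emp_freq T g x"
proof -
  have "bij_betw (nth (sorted_list_of_set T)) {j \<in> {..<l}. in_order l T x j \<in> g} {t \<in> T. x t \<in> g}"
    using bij_betw_nth_sorted_list_of_set[OF T]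
    by (auto simp: in_order_def bij_betw_def inj_on_def image_iff)
  then have "card {j \<in> {..<l}. in_order l T x j \<in> g} = card {t \<in> T. x t \<in> g}" by (rule bij_betw_same_card)
  then show ?thesis using T(2) by (simp add: emp_freq_def)
qed

lemma measurable_in_order:
  assumes "T \<subseteq> K" "finite T" "card T = l"
  shows "in_order l T \<in> iid K P \<rightarrow>\<^sub>M iid {..<l} P"
  unfolding in_order_def[abs_def]
  using bij_betwE[OF bij_betw_nth_sorted_list_of_set[OF assms(2,3)]] assms(1)
  by (intro measurable_restrict measurable_component_singleton) auto

lemma distr_in_order:
  assumes P: "prob_space P" and T: "finite T" "card T = l"
  shows "distr (iid T P) (iid {..<l} P) (in_order l T) = iid {..<l} P"
  unfolding in_order_def[abs_def] using bij_betw_nth_sorted_list_of_set[OF T] P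
  by (intro distr_PiM_reindex) (auto simp: bij_betw_def)

lemma measure_first_hits_in_order_le:
  assumes P: "prob_space P" and W: "W \<in> sets P" "measure P W > 0" and J: "finite J"
    and B: "B \<in> sets (iid {..<l} P)" "measure (iid {..<l} (uniform_measure P W)) B \<le> \<beta>"
  shows "measure (iid J P) {x \<in> space (iid J P). card (first_hits l W J x) = l \<and>
      in_order l (first_hits l W J x) x \<in> B} \<le> \<beta>"
proof -
  let ?Q = "uniform_measure P W"
  have Q: "prob_space ?Q" using P W(2) by (rule prob_space_uniform_measureI)
  define C where "C T = in_order l T -` B \<inter> space (iid T P)" for T :: "'b set"
  have fin: "finite T" if "T \<subseteq> J" for T using J that by (rule finite_subset[rotated])
  have "{x \<in> space (iid J P). card (first_hits l W J x) = l \<and> in_order l (first_hits l W J x) x \<in> B}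
      = {x \<in> space (iid J P). card (first_hits l W J x) = l \<and>
        restrict x (first_hits l W J x) \<in> C (first_hits l W J x)}"
  proof (intro Collect_cong conj_cong refl)
    fix x assume x: "x \<in> space (iid J P)" and card: "card (first_hits l W J x) = l"
    have T: "first_hits l W J x \<subseteq> J" using first_hits_subset[OF J, of l W x] by blast
    have "restrict x (first_hits l W J x) \<in> space (iid (first_hits l W J x) P)"
      using measurable_space[OF measurable_restrict_subset[OF T] x] .
    then show "in_order l (first_hits l W J x) x \<in> B \<longleftrightarrow> restrict x (first_hits l W J x) \<in> C (first_hits l W J x)"
      by (simp add: C_def in_order_restrict[OF fin[OF T] card])
  qed
  also have "measure (iid J P) \<dots> \<le> \<beta>"
  proof (rule measure_first_hits_le[OF P W J])
    fix T assume T: "T \<subseteq> J" "card T = l"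
    show "C T \<in> sets (iid T P)"
      unfolding C_def by (rule measurable_sets[OF measurable_in_order[OF order.refl fin[OF T(1)] T(2)] B(1)])
    have CT: "C T = in_order l T -` B \<inter> space (iid T ?Q)" by (simp add: C_def space_PiM)
    have B_Q: "B \<in> sets (iid {..<l} ?Q)" using B(1) by (simp cong: sets_PiM_cong)
    show "measure (iid T ?Q) (C T) \<le> \<beta>"
      using B(2) measure_distr[OF measurable_in_order[OF order.refl fin[OF T(1)] T(2)] B_Q]
      by (simp only: CT distr_in_order[OF Q fin[OF T(1)] T(2)])
  next
    show "0 \<le> \<beta>" using B(2) measure_nonneg order.trans by blast
  qed
  finally show ?thesis .
qed

lemma pred_component_in:
  assumes W_meas: "Measurable.pred (N \<Otimes>\<^sub>M P) (\<lambda>p. snd p \<in> W (fst p))" and t: "t \<in> J"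
  shows "Measurable.pred (N \<Otimes>\<^sub>M iid J P) (\<lambda>p. snd p t \<in> W (fst p))"
  using t by (intro measurable_compose[OF _ W_meas, of "\<lambda>p. (fst p, snd p t)", simplified]) measurable

lemma pred_first_hits_eq:
  assumes W_meas: "Measurable.pred (N \<Otimes>\<^sub>M P) (\<lambda>p. snd p \<in> W (fst p))"
    and J: "finite J" and T: "T \<subseteq> J" "card T = l"
  shows "Measurable.pred (N \<Otimes>\<^sub>M iid J P) (\<lambda>p. first_hits l (W (fst p)) J (snd p) = T)"
  unfolding first_hits_eq_iff[OF J T] using J T
  by (intro pred_intros_logic pred_intros_finite) (auto intro: finite_subset pred_component_in[OF W_meas])

lemma sets_in_order_first_hits:
  assumes W_meas: "Measurable.pred (N \<Otimes>\<^sub>M P) (\<lambda>p. snd p \<in> W (fst p))"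
    and J: "finite J" and C: "C \<in> sets (N \<Otimes>\<^sub>M iid {..<l} P)"
  shows "{p \<in> space (N \<Otimes>\<^sub>M iid J P). card (first_hits l (W (fst p)) J (snd p)) = l \<and>
    (fst p, in_order l (first_hits l (W (fst p)) J (snd p)) (snd p)) \<in> C} \<in> sets (N \<Otimes>\<^sub>M iid J P)"
    (is "?S \<in> _")
proof -
  let ?first = "\<lambda>p. first_hits l (W (fst p)) J (snd p)"
  have "?S = (\<Union>T\<in>{T. T \<subseteq> J \<and> card T = l}.
      {p \<in> space (N \<Otimes>\<^sub>M iid J P). ?first p = T \<and> (fst p, in_order l T (snd p)) \<in> C})"
    using first_hits_subset[OF J] by fastforce
  also have "\<dots> \<in> sets (N \<Otimes>\<^sub>M iid J P)"
  proof (rule sets.finite_UN)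
    fix T assume "T \<in> {T. T \<subseteq> J \<and> card T = l}"
    then have T: "T \<subseteq> J" "card T = l" by auto
    note [measurable] = C measurable_in_order[OF T(1) finite_subset[OF T(1) J] T(2)]
      pred_first_hits_eq[OF W_meas J T]
    show "{p \<in> space (N \<Otimes>\<^sub>M iid J P). ?first p = T \<and> (fst p, in_order l T (snd p)) \<in> C} \<in> sets (N \<Otimes>\<^sub>M iid J P)"
      by measurable
  qed (use J in simp)
  finally show ?thesis .
qed

lemma uniform_convergence_first_hits:
  fixes P :: "'a measure" and N :: "'b measure" and W :: "'b \<Rightarrow> 'a set" and J :: "nat set"
  assumes P: "prob_space P" and W: "\<And>y. W y \<in> sets P"
    and W_meas: "Measurable.pred (N \<Otimes>\<^sub>M P) (\<lambda>p. snd p \<in> W (fst p))"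
    and G: "measurable_vc_class P d G"
    and l: "l > 0" and \<eta>: "0 < \<eta>" "\<eta> \<le> 1" "8 \<le> real l * \<eta>\<^sup>2" and J: "finite J"
  obtains \<Phi> where "\<Phi> \<in> sets (N \<Otimes>\<^sub>M iid J P)"
    and "\<And>y x g. y \<in> space N \<Longrightarrow> measure P (W y) > 0 \<Longrightarrow> x \<in> space (iid J P) \<Longrightarrow> g \<in> G \<Longrightarrow>
        l \<le> card {t \<in> J. x t \<in> W y} \<Longrightarrow>
        \<bar>emp_freq (first_hits l (W y) J x) g x - measure (uniform_measure P (W y)) g\<bar> \<ge> \<eta> \<Longrightarrow> (y, x) \<in> \<Phi>"
    and "\<And>y. measure P (W y) > 0 \<Longrightarrow> measure (iid J P) (Pair y -` \<Phi>) \<le> 2 * vc_bound d l \<eta>"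
proof -
  let ?first = "\<lambda>p. first_hits l (W (fst p)) J (snd p)"
  obtain C where C: "C \<in> sets (N \<Otimes>\<^sub>M iid {..<l} P)"
    and C_dev: "\<And>y z g. y \<in> space N \<Longrightarrow> measure P (W y) > 0 \<Longrightarrow> z \<in> space (iid {..<l} P) \<Longrightarrow> g \<in> G \<Longrightarrow>
        \<bar>emp_freq {..<l} g z - measure (uniform_measure P (W y)) g\<bar> \<ge> \<eta> \<Longrightarrow> (y, z) \<in> C"
    and C_le: "\<And>y. measure P (W y) > 0 \<Longrightarrow>
        measure (iid {..<l} (uniform_measure P (W y))) (Pair y -` C) \<le> 2 * vc_bound d l \<eta>"
    using uniform_convergence_cover[OF P W W_meas G l \<eta>] by blast
  define \<Phi> where "\<Phi> = {p \<in> space (N \<Otimes>\<^sub>M iid J P).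
    card (?first p) = l \<and> (fst p, in_order l (?first p) (snd p)) \<in> C}"
  have first_subset: "first_hits l A J x \<subseteq> J" for A x using first_hits_subset[OF J, of l A x] by blast
  show ?thesis
  proof (rule that)
    show "\<Phi> \<in> sets (N \<Otimes>\<^sub>M iid J P)" unfolding \<Phi>_def by (rule sets_in_order_first_hits[OF W_meas J C])
    show "(y, x) \<in> \<Phi>" if y: "y \<in> space N" "measure P (W y) > 0" and x: "x \<in> space (iid J P)" and g: "g \<in> G"
      and many: "l \<le> card {t \<in> J. x t \<in> W y}"
      and dev: "\<bar>emp_freq (first_hits l (W y) J x) g x - measure (uniform_measure P (W y)) g\<bar> \<ge> \<eta>" for y x g
    proof -
      let ?T = "first_hits l (W y) J x"
      note T = finite_subset[OF first_subset[of "W y" x] J] card_first_hits[OF J many]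
      have "in_order l ?T x \<in> space (iid {..<l} P)"
        by (rule measurable_space[OF measurable_in_order[OF first_subset T] x])
      then have "(y, in_order l ?T x) \<in> C" using C_dev[OF y _ g] dev by (simp add: emp_freq_in_order[OF T])
      then show ?thesis using T(2) x y(1) by (simp add: \<Phi>_def space_pair_measure)
    qed
    show "measure (iid J P) (Pair y -` \<Phi>) \<le> 2 * vc_bound d l \<eta>" if w: "measure P (W y) > 0" for y
    proof -
      have "Pair y -` \<Phi> = (if y \<in> space N then {x \<in> space (iid J P). card (first_hits l (W y) J x) = l \<and>
          in_order l (first_hits l (W y) J x) x \<in> Pair y -` C} else {})"
        by (auto simp: \<Phi>_def space_pair_measure)
      then show ?thesis
        using measure_first_hits_in_order_le[OF P W w J sets_Pair1[OF C] C_le[OF w]]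
        by (simp add: vc_bound_def)
    qed
  qed
qed

section \<open>Good samples\<close>

lemma measure_some_centre_le:
  assumes P: "prob_space P" and K: "finite K" "J \<subseteq> K" "I \<subseteq> K" "I \<inter> J = {}"
    and \<Phi>: "\<Phi> \<in> sets (P \<Otimes>\<^sub>M iid J P)" and \<beta>: "0 \<le> \<beta>" "AE y in P. measure (iid J P) (Pair y -` \<Phi>) \<le> \<beta>"
  shows "{x \<in> space (iid K P). \<exists>i\<in>I. (x i, restrict x J) \<in> \<Phi>} \<in> sets (iid K P)"
    and "measure (iid K P) {x \<in> space (iid K P). \<exists>i\<in>I. (x i, restrict x J) \<in> \<Phi>} \<le> real (card I) * \<beta>"
proof -
  interpret P: prob_space P by (rule P)
  interpret J: prob_space "iid J P" by (intro prob_space_PiM P)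
  interpret M: prob_space "iid K P" by (intro prob_space_PiM P)
  interpret PJ: pair_prob_space P "iid J P" by unfold_locales
  let ?B = "\<lambda>i. {x \<in> space (iid K P). (x i, restrict x J) \<in> \<Phi>}" and ?f = "\<lambda>i x. (x i, restrict x J)"
  have f: "?f i \<in> iid K P \<rightarrow>\<^sub>M P \<Otimes>\<^sub>M iid J P" if "i \<in> I" for i
    using that K by (intro measurable_Pair measurable_restrict_subset) auto
  have B: "?B i \<in> sets (iid K P)" if "i \<in> I" for i
    using measurable_sets[OF f[OF that] \<Phi>] by (simp add: vimage_def Int_def conj_commute)
  have B_le: "measure (iid K P) (?B i) \<le> \<beta>" if i: "i \<in> I" for i
  proof -
    have "?B i = ?f i -` \<Phi> \<inter> space (iid K P)" by auto
    then have "measure (iid K P) (?B i) = measure (distr (iid K P) (P \<Otimes>\<^sub>M iid J P) (?f i)) \<Phi>"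
      by (simp only: measure_distr[OF f[OF i] \<Phi>])
    also have "distr (iid K P) (P \<Otimes>\<^sub>M iid J P) (?f i) = P \<Otimes>\<^sub>M iid J P"
      using K i by (intro distr_PiM_component_restrict P) auto
    finally show ?thesis using PJ.measure_le_of_sections[OF \<Phi> \<beta>] by (rule ord_eq_le_trans)
  qed
  have fin: "finite I" using K(1,3) by (rule finite_subset[rotated])
  have UN: "{x \<in> space (iid K P). \<exists>i\<in>I. (x i, restrict x J) \<in> \<Phi>} = (\<Union>i\<in>I. ?B i)" by auto
  show "{x \<in> space (iid K P). \<exists>i\<in>I. (x i, restrict x J) \<in> \<Phi>} \<in> sets (iid K P)"
    unfolding UN using fin B by (intro sets.finite_UN)
  have "measure (iid K P) (\<Union>i\<in>I. ?B i) \<le> (\<Sum>i\<in>I. measure (iid K P) (?B i))"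
    using fin B by (intro M.finite_measure_subadditive_finite) auto
  also have "\<dots> \<le> (\<Sum>i\<in>I. \<beta>)" by (intro sum_mono B_le)
  finally show "measure (iid K P) {x \<in> space (iid K P). \<exists>i\<in>I. (x i, restrict x J) \<in> \<Phi>} \<le> real (card I) * \<beta>"
    unfolding UN by simp
qed

definition good_sample ::
  "(real \<Rightarrow> 'y) set \<Rightarrow> (real \<Rightarrow> 'y) \<Rightarrow> real \<Rightarrow> real \<Rightarrow> nat \<Rightarrow> nat \<Rightarrow> nat \<Rightarrow> (nat \<Rightarrow> real) \<Rightarrow> bool" where
  "good_sample H f \<delta> \<eta> m s l x \<longleftrightarrow> (\<forall>i\<in>{1..m}. l \<le> card (hits \<delta> m s x i) \<and> (x i \<in> {\<delta>..1 - \<delta>} \<longrightarrow>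
     (\<forall>h\<in>H. \<bar>emp_freq (neighbours \<delta> m s l x i) {y. h y = f y} x - agree \<delta> f h (x i)\<bar> \<le> \<eta>)))"

lemma pred_window: "Measurable.pred (uniform01 \<Otimes>\<^sub>M uniform01) (\<lambda>p. snd p \<in> window \<delta> (fst p))"
  unfolding greaterThanLessThan_iff by measurable

lemma few_hits_cover:
  assumes \<delta>: "0 < \<delta>" "\<delta> < 1/2" and J: "finite J" and enough: "real l \<le> real (card J) * \<delta> / 2"
  obtains \<Psi> where "\<Psi> \<in> sets (uniform01 \<Otimes>\<^sub>M iid J uniform01)"
    and "\<And>y x. x \<in> space (iid J uniform01) \<Longrightarrow> card {t \<in> J. x t \<in> window \<delta> y} < l \<Longrightarrow> (y, x) \<in> \<Psi>"
    and "AE y in uniform01. measure (iid J uniform01) (Pair y -` \<Psi>) \<le> exp (- (real (card J) * \<delta> / 8))"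
proof (rule that)
  let ?M = "iid J uniform01"
  let ?\<Psi> = "{p \<in> space (uniform01 \<Otimes>\<^sub>M ?M). card {t \<in> J. snd p t \<in> window \<delta> (fst p)} < l}"
  note [measurable] = pred_component_in[OF pred_window]
  have "card {t \<in> J. snd p t \<in> window \<delta> (fst p)} = (\<Sum>t\<in>J. if snd p t \<in> window \<delta> (fst p) then 1 else 0)"
    for p :: "real \<times> ('a \<Rightarrow> real)"
    using J by (simp add: sum.If_cases Int_def)
  then show "?\<Psi> \<in> sets (uniform01 \<Otimes>\<^sub>M ?M)" by (simp only:) measurable
  show "(y, x) \<in> ?\<Psi>" if "x \<in> space ?M" "card {t \<in> J. x t \<in> window \<delta> y} < l" for y x
    using that by (simp add: space_pair_measure)
  show "AE y in uniform01. measure ?M (Pair y -` ?\<Psi>) \<le> exp (- (real (card J) * \<delta> / 8))"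
  proof (rule AE_uniform_measureI, simp, intro AE_I2 impI)
    fix y :: real assume "y \<in> {0<..<1}"
    then have "\<delta> \<le> measure uniform01 (window \<delta> y)" by (rule measure_uniform01_window_ge[OF \<delta>])
    then have le: "real (card J) * \<delta> \<le> real (card J) * measure uniform01 (window \<delta> y)"
      by (intro mult_left_mono) auto
    then have "real l \<le> real (card J) * measure uniform01 (window \<delta> y) / 2" using enough by linarith
    moreover have "Pair y -` ?\<Psi> = {x \<in> space ?M. card {t \<in> J. x t \<in> window \<delta> y} < l}"
      by (auto simp: space_pair_measure)
    ultimately have "measure ?M (Pair y -` ?\<Psi>) \<le> exp (- (real (card J) * measure uniform01 (window \<delta> y) / 8))"
      using measure_few_hits_le[OF prob_space_uniform01 _ J, of "window \<delta> y" l] by simp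
    also have "\<dots> \<le> exp (- (real (card J) * \<delta> / 8))" using le by simp
    finally show "measure ?M (Pair y -` ?\<Psi>) \<le> exp (- (real (card J) * \<delta> / 8))" .
  qed
qed

lemma uniform_convergence_neighbours:
  fixes H :: "(real \<Rightarrow> 'y) set" and f :: "real \<Rightarrow> 'y" and J :: "nat set"
  assumes vc: "measurable_vc_class uniform01 d (agreement_sets f H)"
    and \<delta>: "0 < \<delta>" "\<delta> < 1/2" and l: "0 < l" and \<eta>: "0 < \<eta>" "\<eta> \<le> 1" "8 \<le> real l * \<eta>\<^sup>2" and J: "finite J"
  obtains \<Phi> where "\<Phi> \<in> sets (uniform01 \<Otimes>\<^sub>M iid J uniform01)"
    and "\<And>y x h. y \<in> {\<delta>..1 - \<delta>} \<Longrightarrow> x \<in> space (iid J uniform01) \<Longrightarrow> h \<in> H \<Longrightarrow>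
        l \<le> card {t \<in> J. x t \<in> window \<delta> y} \<Longrightarrow>
        \<bar>emp_freq (first_hits l (window \<delta> y) J x) {z. h z = f z} x - agree \<delta> f h y\<bar> > \<eta> \<Longrightarrow> (y, x) \<in> \<Phi>"
    and "AE y in uniform01. measure (iid J uniform01) (Pair y -` \<Phi>) \<le> 2 * vc_bound d l \<eta>"
proof -
  have sets: "{z. h z = f z} \<in> sets borel" if "h \<in> H" for h
    using measurable_vc_classD(1)[OF vc] that by (auto simp: agreement_sets_def)
  have window_sets: "window \<delta> y \<in> sets uniform01" for y by simp
  obtain \<Phi> where \<Phi>: "\<Phi> \<in> sets (uniform01 \<Otimes>\<^sub>M iid J uniform01)"
    and dev: "\<And>y x g. y \<in> space uniform01 \<Longrightarrow> measure uniform01 (window \<delta> y) > 0 \<Longrightarrow> x \<in> space (iid J uniform01) \<Longrightarrow>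
        g \<in> agreement_sets f H \<Longrightarrow> l \<le> card {t \<in> J. x t \<in> window \<delta> y} \<Longrightarrow>
        \<bar>emp_freq (first_hits l (window \<delta> y) J x) g x - measure (uniform_measure uniform01 (window \<delta> y)) g\<bar> \<ge> \<eta> \<Longrightarrow>
        (y, x) \<in> \<Phi>"
    and le: "\<And>y. measure uniform01 (window \<delta> y) > 0 \<Longrightarrow>
        measure (iid J uniform01) (Pair y -` \<Phi>) \<le> 2 * vc_bound d l \<eta>"
    using uniform_convergence_first_hits[OF prob_space_uniform01 window_sets pred_window vc l \<eta> J]
    by blast
  show ?thesis
  proof (rule that[OF \<Phi>])
    fix y x h
    assume y: "y \<in> {\<delta>..1 - \<delta>}" and x: "x \<in> space (iid J uniform01)" and h: "h \<in> H"
      and many: "l \<le> card {t \<in> J. x t \<in> window \<delta> y}"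
      and large: "\<bar>emp_freq (first_hits l (window \<delta> y) J x) {z. h z = f z} x - agree \<delta> f h y\<bar> > \<eta>"
    have "agree \<delta> f h y = measure (uniform_measure uniform01 (window \<delta> y)) {z. h z = f z}"
      using measure_uniform_window[OF \<delta>(1) y sets[OF h]] by (simp add: agree_def)
    moreover have "measure uniform01 (window \<delta> y) > 0" using measure_uniform01_window[OF \<delta>(1) y] \<delta> by simp
    ultimately show "(y, x) \<in> \<Phi>" using x h many large
      by (intro dev[where g="{z. h z = f z}"]) (auto simp: agreement_sets_def)
  next
    have "measure uniform01 (window \<delta> y) > 0" if "y \<in> {0<..<1}" for y
      using measure_uniform01_window_ge[OF \<delta> that] \<delta> by linarith
    then show "AE y in uniform01. measure (iid J uniform01) (Pair y -` \<Phi>) \<le> 2 * vc_bound d l \<eta>"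
      using le by (intro AE_uniform_measureI AE_I2) auto
  qed
qed

lemma neighbours_subset_hits: "neighbours \<delta> m s l x i \<subseteq> hits \<delta> m s x i"
  by (intro first_hits_subset) simp

lemma finite_neighbours: "finite (neighbours \<delta> m s l x i)"
  using neighbours_subset_hits by (rule finite_subset) simp

lemma good_sample_restrictI:
  assumes many: "\<And>i. i \<in> {1..m} \<Longrightarrow> l \<le> card {t \<in> {m + 1..s}. restrict x {m + 1..s} t \<in> window \<delta> (x i)}"
    and close: "\<And>i h. i \<in> {1..m} \<Longrightarrow> x i \<in> {\<delta>..1 - \<delta>} \<Longrightarrow> h \<in> H \<Longrightarrow>
      \<bar>emp_freq (first_hits l (window \<delta> (x i)) {m + 1..s} (restrict x {m + 1..s}))
        {y. h y = f y} (restrict x {m + 1..s})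
        - agree \<delta> f h (x i)\<bar> \<le> \<eta>"
  shows "good_sample H f \<delta> \<eta> m s l x"
  unfolding good_sample_def
proof (intro ballI conjI impI)
  fix i assume i: "i \<in> {1..m}"
  have "{t \<in> {m + 1..s}. restrict x {m + 1..s} t \<in> window \<delta> (x i)} = hits \<delta> m s x i" by auto
  then show "l \<le> card (hits \<delta> m s x i)" using many[OF i] by (simp only:)
  fix h assume xi: "x i \<in> {\<delta>..1 - \<delta>}" and h: "h \<in> H"
  let ?g = "{y. h y = f y}" and ?T = "neighbours \<delta> m s l x i"
  have "{t \<in> ?T. restrict x {m + 1..s} t \<in> ?g} = {t \<in> ?T. x t \<in> ?g}"
    using neighbours_subset_hits by fastforce
  then have "emp_freq ?T ?g (restrict x {m + 1..s}) = emp_freq ?T ?g x" by (simp only: emp_freq_def)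
  then show "\<bar>emp_freq ?T ?g x - agree \<delta> f h (x i)\<bar> \<le> \<eta>"
    using close[OF i xi h] by (simp only: first_hits_restrict)
qed

lemma good_sample_likely:
  assumes vc: "measurable_vc_class uniform01 d (agreement_sets f H)"
    and \<delta>: "0 < \<delta>" "\<delta> < 1/2" and l: "0 < l" and ms: "m \<le> s" and \<eta>: "0 < \<eta>" "\<eta> \<le> 1" "8 \<le> real l * \<eta>\<^sup>2"
    and enough: "real l \<le> real (s - m) * \<delta> / 2"
  shows "\<exists>E\<in>sets (iid {1..s} uniform01). (\<forall>x\<in>E. good_sample H f \<delta> \<eta> m s l x) \<and>
    measure (iid {1..s} uniform01) E \<ge> 1 - real m * exp (- (real (s - m) * \<delta> / 8))
      - real m * (2 * vc_bound d l \<eta>)"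
proof -
  let ?P = uniform01 and ?M = "iid {1..s} uniform01" and ?J = "{m + 1..s}"
  note P = prob_space_uniform01
  interpret M: prob_space ?M by (intro prob_space_PiM P)
  obtain \<Phi> where \<Phi>: "\<Phi> \<in> sets (?P \<Otimes>\<^sub>M iid ?J ?P)"
    and \<Phi>_dev: "\<And>y x h. y \<in> {\<delta>..1 - \<delta>} \<Longrightarrow> x \<in> space (iid ?J ?P) \<Longrightarrow> h \<in> H \<Longrightarrow> l \<le> card {t \<in> ?J. x t \<in> window \<delta> y} \<Longrightarrow>
        \<bar>emp_freq (first_hits l (window \<delta> y) ?J x) {z. h z = f z} x - agree \<delta> f h y\<bar> > \<eta> \<Longrightarrow> (y, x) \<in> \<Phi>"
    and \<Phi>_le: "AE y in ?P. measure (iid ?J ?P) (Pair y -` \<Phi>) \<le> 2 * vc_bound d l \<eta>"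
    using uniform_convergence_neighbours[OF vc \<delta> l \<eta> finite_atLeastAtMost[of "m + 1" s]] by blast
  obtain \<Psi> where \<Psi>: "\<Psi> \<in> sets (?P \<Otimes>\<^sub>M iid ?J ?P)"
    and \<Psi>_few: "\<And>y x. x \<in> space (iid ?J ?P) \<Longrightarrow> card {t \<in> ?J. x t \<in> window \<delta> y} < l \<Longrightarrow> (y, x) \<in> \<Psi>"
    and \<Psi>_le: "AE y in ?P. measure (iid ?J ?P) (Pair y -` \<Psi>) \<le> exp (- (real (s - m) * \<delta> / 8))"
    using few_hits_cover[OF \<delta> finite_atLeastAtMost[of "m + 1" s], of l] enough
    unfolding card_atLeastAtMost by auto
  let ?bad = "\<lambda>\<Phi>. {x \<in> space ?M. \<exists>i\<in>{1..m}. (x i, restrict x ?J) \<in> \<Phi>}"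
  have JK: "?J \<subseteq> {1..s}" "{1..m} \<subseteq> {1..s}" "{1..m} \<inter> ?J = {}" using ms by auto
  have "0 \<le> 2 * vc_bound d l \<eta>" by (simp add: vc_bound_def)
  note bad_\<Phi> = measure_some_centre_le[OF P finite_atLeastAtMost JK \<Phi> this \<Phi>_le]
  note bad_\<Psi> = measure_some_centre_le[OF P finite_atLeastAtMost JK \<Psi> exp_ge_zero \<Psi>_le]
  show ?thesis
  proof (intro bexI[of _ "space ?M - (?bad \<Psi> \<union> ?bad \<Phi>)"] conjI ballI)
    show "space ?M - (?bad \<Psi> \<union> ?bad \<Phi>) \<in> M.events"
      using bad_\<Psi>(1) bad_\<Phi>(1) by (intro sets.compl_sets sets.Un)
    have "M.prob (?bad \<Psi> \<union> ?bad \<Phi>) \<le> M.prob (?bad \<Psi>) + M.prob (?bad \<Phi>)"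
      using bad_\<Psi>(1) bad_\<Phi>(1) by (rule measure_Un_le)
    moreover have "M.prob (space ?M - (?bad \<Psi> \<union> ?bad \<Phi>)) = 1 - M.prob (?bad \<Psi> \<union> ?bad \<Phi>)"
      using bad_\<Psi>(1) bad_\<Phi>(1) by (intro M.prob_compl sets.Un)
    ultimately show "1 - real m * exp (- (real (s - m) * \<delta> / 8)) - real m * (2 * vc_bound d l \<eta>)
        \<le> M.prob (space ?M - (?bad \<Psi> \<union> ?bad \<Phi>))"
      using bad_\<Psi>(2) bad_\<Phi>(2) unfolding card_atLeastAtMost diff_Suc_1 by linarith
    fix x assume "x \<in> space ?M - (?bad \<Psi> \<union> ?bad \<Phi>)"
    then have x: "x \<in> space ?M"
      and not_bad: "\<And>i. i \<in> {1..m} \<Longrightarrow> (x i, restrict x ?J) \<notin> \<Psi> \<and> (x i, restrict x ?J) \<notin> \<Phi>" by blast+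
    have xJ: "restrict x ?J \<in> space (iid ?J ?P)"
      by (rule measurable_space[OF measurable_restrict_subset[OF JK(1)] x])
    have "l \<le> card {t \<in> ?J. restrict x ?J t \<in> window \<delta> (x i)}" if "i \<in> {1..m}" for i
      using \<Psi>_few[OF xJ] not_bad[OF that] by (meson not_less)
    then show "good_sample H f \<delta> \<eta> m s l x"
      using \<Phi>_dev[OF _ xJ] not_bad by (intro good_sample_restrictI) (meson not_less)+
  qed
qed

lemma good_sample_empirical_NS_le_breakpoint_NS:
  assumes good: "good_sample H f \<delta> \<eta> m s l x" and i: "i \<in> {1..m}" and l: "l > 0" and \<delta>: "0 < \<delta>" and \<eta>: "0 \<le> \<eta>"
    and bp: "has_breakpoints H k f b" and sets: "\<And>h. h \<in> H \<Longrightarrow> {x. h x = f x} \<in> sets borel"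
  shows "empirical_NS H f (neighbours \<delta> m s l x i) x (x i) \<le> breakpoint_NS \<delta> \<eta> k b (x i)"
proof (cases "breakpoint_NS \<delta> \<eta> k b (x i) < 1")
  case False
  then show ?thesis using empirical_NS_le_1[OF finite_neighbours] by (meson not_less order.trans)
next
  case True
  let ?T = "neighbours \<delta> m s l x i"
  have T: "card ?T = l" using good i by (intro card_first_hits) (auto simp: good_sample_def)
  note core = breakpoint_NS_ge(1)[OF bp sets \<delta> \<eta> True]
  obtain h where h: "h \<in> H" "h (x i) = f (x i)"
    and cases: "(\<forall>y\<in>window \<delta> (x i). h y = f y) \<or> 1 - agree \<delta> f h (x i) + \<eta> \<le> breakpoint_NS \<delta> \<eta> k b (x i)"
    using breakpoint_NS_ge(2)[OF bp sets \<delta> \<eta> True] by blast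
  have le: "empirical_NS H f ?T x (x i) \<le> 1 - emp_freq ?T {y. h y = f y} x"
    by (rule empirical_NS_le[where f=f, OF finite_neighbours h])
  from cases show ?thesis
  proof
    assume "\<forall>y\<in>window \<delta> (x i). h y = f y"
    then have "{t \<in> ?T. x t \<in> {y. h y = f y}} = ?T" using neighbours_subset_hits by fast
    then have "emp_freq ?T {y. h y = f y} x = 1" using T l by (simp only: emp_freq_def) simp
    then show ?thesis using le breakpoint_NS_bounds(1)[OF \<delta> \<eta>] by (metis diff_self order.trans)
  next
    assume "1 - agree \<delta> f h (x i) + \<eta> \<le> breakpoint_NS \<delta> \<eta> k b (x i)"
    moreover have "\<bar>emp_freq ?T {y. h y = f y} x - agree \<delta> f h (x i)\<bar> \<le> \<eta>"
      using good i core h(1) unfolding good_sample_def by blast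
    ultimately show ?thesis using le by linarith
  qed
qed

lemma good_sample_excess_NS_le_empirical_NS:
  assumes good: "good_sample H f \<delta> \<eta> m s l x" and i: "i \<in> {1..m}"
    and ns: "noise_sensitivity H f \<delta>" and \<eta>: "0 \<le> \<eta>"
  shows "excess_NS H \<delta> f \<eta> (x i) \<le> empirical_NS H f (neighbours \<delta> m s l x i) x (x i)"
proof (rule empirical_NS_ge)
  let ?T = "neighbours \<delta> m s l x i"
  show "excess_NS H \<delta> f \<eta> (x i) \<le> 1" by (rule noise_sensitivity.excess_NS_bounds(2)[OF ns \<eta>])
  fix h assume h: "h \<in> H" "h (x i) = f (x i)"
  have nonneg: "0 \<le> 1 - emp_freq ?T {z. h z = f z} x" using emp_freq_bounds(2)[OF finite_neighbours] by simp
  show "excess_NS H \<delta> f \<eta> (x i) \<le> 1 - emp_freq ?T {z. h z = f z} x"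
  proof (cases "x i \<in> {\<delta>..1 - \<delta>}")
    case True
    then have "\<bar>emp_freq ?T {y. h y = f y} x - agree \<delta> f h (x i)\<bar> \<le> \<eta>"
      using good i h(1) unfolding good_sample_def by blast
    moreover have "truncated_NS H \<delta> f (x i) \<le> 1 - agree \<delta> f h (x i)"
      by (rule noise_sensitivity.NS_le[OF ns h])
    ultimately have "truncated_NS H \<delta> f (x i) - \<eta> \<le> 1 - emp_freq ?T {z. h z = f z} x" by linarith
    then show ?thesis unfolding excess_NS_def if_P[OF True] using nonneg by (rule max.boundedI[rotated])
  next
    case False
    then show ?thesis using nonneg by (simp only: excess_NS_def if_False)
  qed
qed

section \<open>Parameters\<close>

lemma num_centres_ge: "c / \<epsilon> ^ 4 \<le> real (num_centres c \<epsilon>)"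
  unfolding num_centres_def by linarith

lemma num_centres_le:
  assumes "0 < \<epsilon>" "\<epsilon> \<le> 1" "1 \<le> c"
  shows "real (num_centres c \<epsilon>) \<le> 2 * c / \<epsilon> ^ 4"
proof -
  have "\<epsilon> ^ 4 \<le> c" using power_le_one[of \<epsilon> 4] assms by linarith
  then have "1 \<le> c / \<epsilon> ^ 4" using assms(1) by simp
  moreover have "real (num_centres c \<epsilon>) \<le> c / \<epsilon> ^ 4 + 1"
    unfolding num_centres_def using assms by (simp add: of_nat_nat)
  ultimately show ?thesis by simp
qed

lemma num_neighbours_ge: "c' * real d / \<epsilon> ^ 4 * ln (c'' / \<epsilon>) \<le> real (num_neighbours c' c'' d \<epsilon>)"
  unfolding num_neighbours_def by linarith

lemma le_sample_size: "m \<le> sample_size m l \<delta>"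
  by (simp add: sample_size_def)

lemma sample_size_bounds:
  assumes \<delta>: "0 < \<delta>" and m: "0 < m"
  shows "real l \<le> real (sample_size m l \<delta> - m) * \<delta> / 2"
    and "real m * exp (- (real (sample_size m l \<delta> - m) * \<delta> / 8)) \<le> 1/12"
proof -
  let ?n = "sample_size m l \<delta> - m"
  have "max (2 * real l / \<delta>) (8 / \<delta> * ln (12 * real m)) \<le> real ?n"
    unfolding sample_size_def diff_add_inverse by linarith
  then have "2 * real l / \<delta> \<le> real ?n" "8 / \<delta> * ln (12 * real m) \<le> real ?n" by auto
  then have l: "real l \<le> real ?n * \<delta> / 2" and ln: "ln (12 * real m) \<le> real ?n * \<delta> / 8"
    using \<delta> by (auto simp: field_simps)
  show "real l \<le> real ?n * \<delta> / 2" by (rule l)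
  have "exp (- (real ?n * \<delta> / 8)) \<le> exp (- ln (12 * real m))" using ln by simp
  also have "\<dots> = 1 / (12 * real m)" using m by (simp add: exp_minus inverse_eq_divide)
  finally have "real m * exp (- (real ?n * \<delta> / 8)) \<le> real m * (1 / (12 * real m))"
    by (intro mult_left_mono) auto
  then show "real m * exp (- (real ?n * \<delta> / 8)) \<le> 1/12" using m by simp
qed

locale calibration =
  fixes \<epsilon> :: real and d k :: nat
  assumes eps: "0 < \<epsilon>" "\<epsilon> < 1/2" and k_ge: "80 / \<epsilon> \<le> real k" and d_pos: "0 < d"
begin

text \<open>\<open>524288 = 2 * 16 * 128\<^sup>2\<close> makes \<open>l * \<eta>\<^sup>2 / 16\<close> at least \<open>2 * d * L / \<epsilon>\<^sup>2\<close>, and \<open>1024\<close> gives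
  \<open>32 / \<eta>\<^sup>2 \<le> (1024 / \<epsilon>)\<^sup>2\<close>; these are the two terms in the exponent of \<open>vc_bound\<close>.  Chebyshev's
  inequality needs \<open>m\<close> of order \<open>1 / (budget * \<epsilon>\<^sup>2)\<close>, where \<open>budget\<close> is about \<open>\<epsilon>\<^sup>2 / 64\<close>.\<close>

abbreviation "m \<equiv> num_centres 4194304 \<epsilon>"
abbreviation "l \<equiv> num_neighbours 524288 1024 d \<epsilon>"
abbreviation "\<delta> \<equiv> radius \<epsilon> k"
abbreviation "s \<equiv> sample_size m l \<delta>"
abbreviation "\<eta> \<equiv> \<epsilon> / 128"
abbreviation "L \<equiv> ln (1024 / \<epsilon>)"

definition budget :: real where "budget = (real k - 1) * (\<delta> / 2)"

lemmas radius = radius_bounds[OF eps k_ge]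

lemma \<eta>: "0 < \<eta>" "\<eta> \<le> 1"
  using eps by simp_all

lemma num_centres_pos: "0 < m"
proof -
  have "0 < 4194304 / \<epsilon> ^ 4" using eps by simp
  then have "0 < real m" using num_centres_ge by (rule less_le_trans)
  then show ?thesis by simp
qed

lemma d_L_ge_1: "1 \<le> real d * L" and L_le: "L \<le> real d * L"
proof -
  have "exp 1 \<le> (3 :: real)" by (rule exp_le)
  also have "3 \<le> 1024 / \<epsilon>" using eps by (simp add: field_simps)
  finally have L: "1 \<le> L" using eps by (subst ln_ge_iff) auto
  then show "L \<le> real d * L" using d_pos mult_right_mono[of 1 "real d" L] by simp
  then show "1 \<le> real d * L" using L by linarith
qed

lemma num_neighbours_eta_ge: "8 * (real d * L) \<le> real l * \<eta>\<^sup>2 / 16"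
proof -
  have "\<epsilon>\<^sup>2 \<le> (1/2)\<^sup>2" using eps by (intro power_mono) auto
  then have "4 \<le> 1 / \<epsilon>\<^sup>2" using eps by (simp add: field_simps power2_eq_square)
  then have "2 * (real d * L) * 4 \<le> 2 * (real d * L) * (1 / \<epsilon>\<^sup>2)"
    using d_L_ge_1 by (intro mult_left_mono) auto
  also have "\<dots> = (524288 * real d / \<epsilon> ^ 4 * L) * \<eta>\<^sup>2 / 16"
    using eps by (simp add: field_simps power2_eq_square power4_eq_xxxx)
  also have "\<dots> \<le> real l * \<eta>\<^sup>2 / 16" by (intro divide_right_mono mult_right_mono num_neighbours_ge) auto
  finally show ?thesis by simp
qed

lemma num_neighbours_large: "8 \<le> real l * \<eta>\<^sup>2"
  using num_neighbours_eta_ge d_L_ge_1 by linarith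

lemma num_neighbours_pos: "0 < l"
  using num_neighbours_large by (cases "l = 0") auto

lemma vc_bound_le: "vc_bound d l \<eta> \<le> 2 * (\<epsilon> / 1024) ^ 6"
proof -
  have "ln (32 / \<eta>\<^sup>2) \<le> ln ((1024 / \<epsilon>)\<^sup>2)"
    using eps by (subst ln_le_cancel_iff) (auto simp: field_simps power2_eq_square)
  also have "\<dots> = 2 * L" using eps by (simp add: ln_realpow)
  finally have "real d * ln (32 / \<eta>\<^sup>2) \<le> real d * (2 * L)" by (intro mult_left_mono) auto
  then have "real d * ln (32 / \<eta>\<^sup>2) - real l * \<eta>\<^sup>2 / 16 \<le> - (6 * L)"
    using num_neighbours_eta_ge L_le by linarith
  then have "vc_bound d l \<eta> \<le> 2 * exp (- (6 * L))" by (simp add: vc_bound_def)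
  also have "exp (- (6 * L)) = exp (- L) ^ 6" by (simp add: exp_of_nat_mult[of 6 "- L", simplified])
  also have "exp (- L) = \<epsilon> / 1024" using eps by (simp add: exp_minus)
  finally show ?thesis .
qed

lemma num_centres_vc_bound: "real m * (2 * vc_bound d l \<eta>) \<le> 1/12"
proof -
  have "real m * (2 * vc_bound d l \<eta>) \<le> 2 * 4194304 / \<epsilon> ^ 4 * (2 * (2 * (\<epsilon> / 1024) ^ 6))"
    using eps vc_bound_le by (intro mult_mono num_centres_le) (auto simp: vc_bound_def)
  also have "\<dots> = 33554432 / 1024 ^ 6 * \<epsilon>\<^sup>2" using eps by (simp add: field_simps eval_nat_numeral)
  also have "\<dots> \<le> 33554432 / 1024 ^ 6 * 1" using eps by (intro mult_left_mono power_le_one) auto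
  finally show ?thesis by simp
qed

lemma budget_pos: "0 < budget"
  using radius by (simp add: budget_def)

lemma num_centres_budget_ge: "64527 \<le> real m * budget * \<epsilon>\<^sup>2"
proof -
  have "budget = real k * \<delta> / 2 - \<delta> / 2" by (simp add: budget_def left_diff_distrib)
  moreover have "160 * \<delta> \<le> real k * \<delta>" using radius by (intro mult_right_mono) auto
  ultimately have "\<epsilon>\<^sup>2 / 65 \<le> budget" using radius(5) zero_le_power2[of \<epsilon>] by linarith
  moreover have "64527 \<le> 4194304 / \<epsilon> ^ 4 * (\<epsilon>\<^sup>2 / 65) * \<epsilon>\<^sup>2"
    using eps by (simp add: power2_eq_square power4_eq_xxxx)
  ultimately show ?thesis
    using num_centres_ge budget_pos by (elim order.trans) (intro mult_mono, auto)
qed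

lemma margin_le: "2 * \<delta> \<le> budget * \<epsilon> / 16"
proof -
  have "79 * \<delta> \<le> ((real k - 1) * \<epsilon>) * \<delta>"
    using radius eps by (intro mult_right_mono) (auto simp: algebra_simps)
  then show ?thesis using radius(3) by (simp add: budget_def algebra_simps)
qed

end

section \<open>The tester\<close>

lemma measure_sum_centres_deviation:
  fixes g :: "real \<Rightarrow> real"
  assumes g: "g \<in> borel_measurable borel" "\<And>x. g x \<in> {0..1}" and a: "0 < a" and ms: "m \<le> s"
  defines "D \<equiv> {x \<in> space (iid {1..s} uniform01). \<bar>(\<Sum>i=1..m. g (x i)) - real m * (\<integral>x. g x \<partial>uniform01)\<bar> \<ge> a}"
  shows "D \<in> sets (iid {1..s} uniform01)"
    and "measure (iid {1..s} uniform01) D \<le> real m * (\<integral>x. g x \<partial>uniform01) / a\<^sup>2"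
proof -
  interpret prob_space uniform01 by (rule prob_space_uniform01)
  have [measurable]: "g \<in> borel_measurable uniform01" using g(1) by simp
  have [measurable]: "(\<lambda>x. x i) \<in> iid {1..s} uniform01 \<rightarrow>\<^sub>M uniform01" if "i \<in> {1..m}" for i
    using that ms by (intro measurable_component_singleton) auto
  show "D \<in> sets (iid {1..s} uniform01)" unfolding D_def by measurable
  have "integrable uniform01 (\<lambda>x. (g x)\<^sup>2)"
    using g(2) by (intro integrable_const_bound[where B=1]) (auto simp: power_le_one)
  then have "measure (iid {1..s} uniform01) D \<le> real m * variance g / a\<^sup>2"
    using Chebyshev_inequality_iid[OF prob_space_axioms, of "{1..m}" "{1..s}" g a] ms a by (simp add: D_def)
  also have "\<dots> \<le> real m * expectation g / a\<^sup>2"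
    using g(2) by (intro divide_right_mono mult_left_mono variance_le_expectation) auto
  finally show "measure (iid {1..s} uniform01) D \<le> real m * expectation g / a\<^sup>2" .
qed

lemma prob_at_least_pair_measure:
  assumes "prob_space R" "prob_space M" and E: "E \<in> sets M" "p \<le> measure M E"
    and Q: "\<And>\<omega> x. \<omega> \<in> space R \<Longrightarrow> x \<in> E \<Longrightarrow> Q (\<omega>, x)"
  shows "prob_at_least (R \<Otimes>\<^sub>M M) p {z \<in> space (R \<Otimes>\<^sub>M M). Q z}"
proof -
  interpret R: prob_space R by fact
  interpret M: prob_space M by fact
  have "measure (R \<Otimes>\<^sub>M M) (space R \<times> E) = measure M E"
    using M.emeasure_pair_measure_Times[OF sets.top E(1), of R]
    by (simp add: measure_def R.emeasure_space_1)
  moreover have "space R \<times> E \<subseteq> {z \<in> space (R \<Otimes>\<^sub>M M). Q z}"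
    using Q sets.sets_into_space[OF E(1)] by (auto simp: space_pair_measure)
  ultimately show ?thesis
    unfolding prob_at_least_def using E by (intro bexI[of _ "space R \<times> E"]) auto
qed

locale NS_tester = calibration +
  fixes Y :: "'y measure" and H :: "(real \<Rightarrow> 'y) set"
  assumes H_nonempty: "H \<noteq> {}" and well_behaved: "measurably_well_behaved Y H"
    and zero_crossings: "zero_measure_crossings H" and graph_dim: "graph_dim H = enat d"
begin

abbreviation "sample \<equiv> iid {1..s} uniform01"

abbreviation "accepts fallback f \<equiv> (\<lambda>(\<omega>, x). run (NS_procedure H k \<epsilon> m l \<delta> s fallback \<omega> x) (\<lambda>i. f (x i)))"

lemma agree_sets: "f \<in> borel \<rightarrow>\<^sub>M Y \<Longrightarrow> h \<in> H \<Longrightarrow> {x. h x = f x} \<in> sets borel"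
  using well_behaved unfolding measurably_well_behaved_def by blast

lemma good_sample_prob:
  assumes f: "f \<in> borel \<rightarrow>\<^sub>M Y"
  shows "\<exists>E\<in>sets sample. (\<forall>x\<in>E. good_sample H f \<delta> \<eta> m s l x) \<and> 5/6 \<le> measure sample E"
proof -
  note vc = measurable_vc_class_agreement_sets[OF well_behaved graph_dim f]
  note size = sample_size_bounds[OF radius(3) num_centres_pos]
  have "1 - real m * exp (- (real (s - m) * \<delta> / 8)) - real m * (2 * vc_bound d l \<eta>) \<ge> 5/6"
    using size(2)[of l] num_centres_vc_bound by linarith
  then show ?thesis
    using good_sample_likely[OF vc radius(3,4) num_neighbours_pos le_sample_size \<eta>
        num_neighbours_large size(1)] by (meson order.trans)
qed

lemma good_sample_average_prob:
  assumes f: "f \<in> borel \<rightarrow>\<^sub>M Y" and g: "g \<in> borel_measurable borel" "\<And>x. g x \<in> {0..1}"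
    and a: "0 < a" "real m * (\<integral>x. g x \<partial>uniform01) / a\<^sup>2 \<le> 1/12"
  shows "\<exists>E\<in>sets sample. 2/3 \<le> measure sample E \<and> (\<forall>x\<in>E. good_sample H f \<delta> \<eta> m s l x \<and>
    \<bar>(\<Sum>i=1..m. g (x i)) - real m * (\<integral>x. g x \<partial>uniform01)\<bar> < a)"
proof -
  interpret M: prob_space sample by (intro prob_space_PiM prob_space_uniform01)
  obtain E where E: "E \<in> sets sample" "\<And>x. x \<in> E \<Longrightarrow> good_sample H f \<delta> \<eta> m s l x" "5/6 \<le> M.prob E"
    using good_sample_prob[OF f] by blast
  define D where "D = {x \<in> space sample. \<bar>(\<Sum>i=1..m. g (x i)) - real m * (\<integral>x. g x \<partial>uniform01)\<bar> \<ge> a}"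
  have D: "D \<in> sets sample" "M.prob D \<le> 1/12"
    using measure_sum_centres_deviation[where m=m and s=s, OF g a(1) le_sample_size] a(2)
    unfolding D_def by (blast intro: order.trans)+
  show ?thesis
  proof (intro bexI[of _ "E - D"] conjI ballI)
    have "M.prob E \<le> M.prob (E - D \<union> D)" using E(1) D(1) by (intro M.finite_measure_mono) auto
    also have "\<dots> \<le> M.prob (E - D) + M.prob D" using E(1) D(1) by (intro measure_Un_le) auto
    finally show "2/3 \<le> M.prob (E - D)" using E(3) D(2) by linarith
    show "E - D \<in> sets sample" using E(1) D(1) by (rule sets.Diff)
    fix x assume x: "x \<in> E - D"
    then show "good_sample H f \<delta> \<eta> m s l x" using E(2) by blast
    have "x \<in> space sample" using x sets.sets_into_space[OF E(1)] by blast
    then show "\<bar>(\<Sum>i=1..m. g (x i)) - real m * (\<integral>x. g x \<partial>uniform01)\<bar> < a" using x by (simp add: D_def)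
  qed
qed

lemma run_good_sample_iff:
  assumes "good_sample H f \<delta> \<eta> m s l x"
  shows "run (NS_procedure H k \<epsilon> m l \<delta> s fallback \<omega> x) (\<lambda>n. f (x n)) \<longleftrightarrow>
    (\<Sum>i=1..m. empirical_NS H f (neighbours \<delta> m s l x i) x (x i)) \<le> real m * (budget * (1 + \<epsilon> / 8))"
  using assms unfolding budget_def
  by (intro run_NS_procedure_iff num_centres_pos num_neighbours_pos) (auto simp: good_sample_def)

lemma integral_breakpoint_NS_budget:
  "(\<integral>x. breakpoint_NS \<delta> \<eta> k b x \<partial>uniform01) + budget * \<epsilon> / 32 \<le> budget * (1 + \<epsilon> / 8)"
proof -
  have "(\<integral>x. breakpoint_NS \<delta> \<eta> k b x \<partial>uniform01) \<le> (real k - 1) * (\<delta> / 2 + 2 * \<delta> * \<eta>) + 2 * \<delta>"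
    using radius \<eta> by (intro integral_breakpoint_NS_le) auto
  also have "(real k - 1) * (\<delta> / 2 + 2 * \<delta> * \<eta>) = budget * (1 + \<epsilon> / 32)"
    by (simp add: budget_def field_simps)
  finally show ?thesis using margin_le by (simp add: algebra_simps)
qed

lemma accepts_piecewise:
  assumes R: "prob_space R" and f: "f \<in> borel \<rightarrow>\<^sub>M Y" "f \<in> piecewise k H"
  shows "prob_at_least (R \<Otimes>\<^sub>M sample) (2/3)
    {z \<in> space (R \<Otimes>\<^sub>M sample). accepts fallback f z}"
proof -
  obtain b where b: "has_breakpoints H k f b" using piecewise_has_breakpoints[OF f(2)] by blast
  let ?g = "breakpoint_NS \<delta> \<eta> k b"
  define \<mu> where "\<mu> = (\<integral>x. ?g x \<partial>uniform01)"
  define a where "a = real m * (budget * \<epsilon> / 32)"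
  have \<mu>: "\<mu> + budget * \<epsilon> / 32 \<le> budget * (1 + \<epsilon> / 8)"
    unfolding \<mu>_def by (rule integral_breakpoint_NS_budget)
  have "budget * (1 + \<epsilon> / 8) \<le> budget * 2" using budget_pos eps by (intro mult_left_mono) auto
  moreover have "0 < budget * \<epsilon> / 32" using budget_pos eps by simp
  ultimately have \<mu>_le: "\<mu> \<le> 2 * budget" using \<mu> by linarith
  have a_pos: "0 < a" using num_centres_pos budget_pos eps by (simp add: a_def)
  have "real m * \<mu> / a\<^sup>2 \<le> real m * (2 * budget) / a\<^sup>2"
    using \<mu>_le by (intro divide_right_mono mult_left_mono) auto
  also have "\<dots> = 2048 / (real m * budget * \<epsilon>\<^sup>2)"
    using num_centres_pos budget_pos eps by (simp add: a_def field_simps power2_eq_square)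
  also have "\<dots> \<le> 2048 / 64527" using num_centres_budget_ge by (intro divide_left_mono) auto
  finally have "real m * \<mu> / a\<^sup>2 \<le> 1/12" by simp
  then obtain E where E: "E \<in> sets sample" "2/3 \<le> measure sample E"
    and good: "\<And>x. x \<in> E \<Longrightarrow> good_sample H f \<delta> \<eta> m s l x"
    and average: "\<And>x. x \<in> E \<Longrightarrow> \<bar>(\<Sum>i=1..m. ?g (x i)) - real m * \<mu>\<bar> < a"
    using good_sample_average_prob[OF f(1) breakpoint_NS_measurable _ a_pos, of \<delta> \<eta> k b]
      breakpoint_NS_bounds[OF radius(3)] \<eta>
    unfolding \<mu>_def by fastforce
  show ?thesis
  proof (rule prob_at_least_pair_measure[OF R _ E])
    fix \<omega> x assume x: "x \<in> E"
    have "(\<Sum>i=1..m. empirical_NS H f (neighbours \<delta> m s l x i) x (x i)) \<le> (\<Sum>i=1..m. ?g (x i))"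
      using \<eta> agree_sets[OF f(1)]
      by (intro sum_mono good_sample_empirical_NS_le_breakpoint_NS[OF good[OF x] _ num_neighbours_pos radius(3) _ b]) auto
    also have "\<dots> \<le> real m * \<mu> + a" using average[OF x] by linarith
    also have "\<dots> = real m * (\<mu> + budget * \<epsilon> / 32)" by (simp add: a_def distrib_left)
    also have "\<dots> \<le> real m * (budget * (1 + \<epsilon> / 8))" using \<mu> by (intro mult_left_mono) auto
    finally show "accepts fallback f (\<omega>, x)"
      unfolding prod.case run_good_sample_iff[OF good[OF x]] .
  qed (intro prob_space_PiM prob_space_uniform01)
qed

lemma excess_gap:
  assumes \<mu>: "budget * (1 + \<epsilon> / 4) < \<mu>"
  shows "\<mu> * \<epsilon> / 16 \<le> \<mu> - budget * (1 + \<epsilon> / 8)"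
proof -
  have "\<epsilon>\<^sup>2 \<le> \<epsilon> * (1/2)" using eps by (simp add: power2_eq_square)
  moreover have "(1 + \<epsilon> / 4) * (1 - \<epsilon> / 16) = 1 + 3/16 * \<epsilon> - \<epsilon>\<^sup>2 / 64"
    by (simp add: power2_eq_square field_simps)
  ultimately have "1 + \<epsilon> / 8 \<le> (1 + \<epsilon> / 4) * (1 - \<epsilon> / 16)" using eps by linarith
  then have "budget * (1 + \<epsilon> / 8) \<le> budget * ((1 + \<epsilon> / 4) * (1 - \<epsilon> / 16))"
    using budget_pos by (intro mult_left_mono) auto
  also have "\<dots> = budget * (1 + \<epsilon> / 4) * (1 - \<epsilon> / 16)" by simp
  also have "\<dots> \<le> \<mu> * (1 - \<epsilon> / 16)" using \<mu> eps by (intro mult_right_mono) auto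
  finally show ?thesis by (simp add: algebra_simps)
qed

lemma excess_Chebyshev_bound:
  assumes \<mu>: "budget * (1 + \<epsilon> / 4) < \<mu>" and a: "real m * (\<mu> * \<epsilon> / 16) \<le> a"
  shows "0 < a" "real m * \<mu> / a\<^sup>2 \<le> 1/12"
proof -
  have "budget * 1 \<le> budget * (1 + \<epsilon> / 4)" using budget_pos eps by (intro mult_left_mono) auto
  then have \<mu>_ge: "budget \<le> \<mu>" "0 < \<mu>" using \<mu> budget_pos by linarith+
  then have pos: "0 < real m * (\<mu> * \<epsilon> / 16)" using num_centres_pos eps by simp
  then show a_pos: "0 < a" using a by linarith
  have "real m * \<mu> / a\<^sup>2 \<le> real m * \<mu> / (real m * (\<mu> * \<epsilon> / 16))\<^sup>2"
    using a pos a_pos \<mu>_ge num_centres_pos by (intro divide_left_mono power_mono mult_pos_pos) auto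
  also have "\<dots> = 256 / (real m * \<mu> * \<epsilon>\<^sup>2)"
    using num_centres_pos \<mu>_ge eps by (simp add: field_simps power2_eq_square)
  also have "\<dots> \<le> 256 / 64527"
  proof (rule divide_left_mono)
    have "real m * budget * \<epsilon>\<^sup>2 \<le> real m * \<mu> * \<epsilon>\<^sup>2"
      using \<mu>_ge by (intro mult_right_mono mult_left_mono) auto
    then show "64527 \<le> real m * \<mu> * \<epsilon>\<^sup>2" using num_centres_budget_ge by linarith
    then show "0 < real m * \<mu> * \<epsilon>\<^sup>2 * 64527" by simp
  qed simp
  finally show "real m * \<mu> / a\<^sup>2 \<le> 1/12" by simp
qed

lemma rejects_far:
  assumes R: "prob_space R" and f: "f \<in> borel \<rightarrow>\<^sub>M Y" and far: "\<epsilon> \<le> dist_class uniform01 f (piecewise k H)"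
  shows "prob_at_least (R \<Otimes>\<^sub>M sample) (2/3)
    {z \<in> space (R \<Otimes>\<^sub>M sample). \<not> accepts fallback f z}"
proof -
  have ns: "noise_sensitivity H f \<delta>"
    using agree_sets[OF f] zero_crossings radius(3,4) by (rule noise_sensitivityI)
  interpret noise: noise_sensitivity H f \<delta> by (rule ns)
  let ?g = "excess_NS H \<delta> f \<eta>"
  define \<mu> where "\<mu> = (\<integral>x. ?g x \<partial>uniform01)"
  define a where "a = real m * (\<mu> - budget * (1 + \<epsilon> / 8))"
  have \<mu>: "budget * (1 + \<epsilon> / 4) < \<mu>"
    unfolding \<mu>_def budget_def by (rule far_target_sensitivity[OF H_nonempty eps k_ge ns far])
  have "real m * (\<mu> * \<epsilon> / 16) \<le> a" unfolding a_def using excess_gap[OF \<mu>] by (intro mult_left_mono) auto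
  note a = excess_Chebyshev_bound[OF \<mu> this]
  obtain E where E: "E \<in> sets sample" "2/3 \<le> measure sample E"
    and good: "\<And>x. x \<in> E \<Longrightarrow> good_sample H f \<delta> \<eta> m s l x"
    and average: "\<And>x. x \<in> E \<Longrightarrow> \<bar>(\<Sum>i=1..m. ?g (x i)) - real m * \<mu>\<bar> < a"
    using good_sample_average_prob[OF f noise.excess_NS_measurable _ a(1)[unfolded \<mu>_def], of \<eta>]
      a(2) noise.excess_NS_bounds \<eta>
    unfolding \<mu>_def by fastforce
  show ?thesis
  proof (rule prob_at_least_pair_measure[OF R _ E])
    fix \<omega> x assume x: "x \<in> E"
    have "real m * (budget * (1 + \<epsilon> / 8)) = real m * \<mu> - a" by (simp add: a_def algebra_simps)
    also have "\<dots> < (\<Sum>i=1..m. ?g (x i))" using average[OF x] by linarith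
    also have "\<dots> \<le> (\<Sum>i=1..m. empirical_NS H f (neighbours \<delta> m s l x i) x (x i))"
      using \<eta> by (intro sum_mono good_sample_excess_NS_le_empirical_NS[OF good[OF x] _ ns]) auto
    finally show "\<not> accepts fallback f (\<omega>, x)"
      unfolding prod.case run_good_sample_iff[OF good[OF x]] not_le .
  qed (intro prob_space_PiM prob_space_uniform01)
qed

lemma NS_procedure_is_tester:
  assumes R: "prob_space R"
    and fallback: "\<And>\<omega> x. \<omega> \<in> space R \<Longrightarrow> x \<in> space sample \<Longrightarrow> query_bounded (fallback \<omega> x) {1..s} (m * (l + 1))"
  shows "is_tester uniform01 Y (piecewise k H) s (m * (l + 1)) \<epsilon> R (NS_procedure H k \<epsilon> m l \<delta> s fallback)"
proof -
  have "f \<in> borel \<rightarrow>\<^sub>M Y" if "f \<in> uniform01 \<rightarrow>\<^sub>M Y" for f using that by (simp cong: measurable_cong_sets)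
  moreover have "query_bounded (NS_procedure H k \<epsilon> m l \<delta> s fallback \<omega> x) {1..s} (m * (l + 1))"
    if "\<omega> \<in> space R" "x \<in> space sample" for \<omega> x
    using fallback[OF that] le_sample_size by (rule query_bounded_NS_procedure)
  ultimately show ?thesis
    unfolding is_tester_def Let_def using R accepts_piecewise[OF R] rejects_far[OF R] by blast
qed

end

theorem theorem3:
  shows "\<exists>c c' c'' :: real. c \<ge> 1 \<and> c' \<ge> 1 \<and> c'' \<ge> 1 \<and>
    (\<forall>(Y :: 'y measure) (H :: (real \<Rightarrow> 'y) set) (d :: nat) (\<epsilon> :: real) (k :: nat).
       space Y \<noteq> {} \<and> H \<noteq> {} \<and> H \<subseteq> borel \<rightarrow>\<^sub>M Y \<and> measurably_well_behaved Y H \<and>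
       zero_measure_crossings H \<and> graph_dim H = enat d \<and> d > 0 \<and>
       0 < \<epsilon> \<and> \<epsilon> < 1 / 2 \<and> real k \<ge> 80 / \<epsilon> \<longrightarrow>
       (let m = num_centres c \<epsilon>;
            l = num_neighbours c' c'' d \<epsilon>;
            \<delta> = radius \<epsilon> k;
            s = sample_size m l \<delta>;
            q = m * (l + 1)
        in \<forall>(R :: 'w measure) fallback.
             prob_space R \<and>
             (\<forall>\<omega>\<in>space R. \<forall>x\<in>space (PiM {1..s} (\<lambda>_. uniform01)).
                query_bounded (fallback \<omega> x) {1..s} q) \<longrightarrow>
             is_tester uniform01 Y (piecewise k H) s q \<epsilon> R
               (NS_procedure H k \<epsilon> m l \<delta> s fallback)))"
  unfolding Let_def
proof (rule exI[of _ 4194304], rule exI[of _ 524288], rule exI[of _ 1024], intro conjI allI impI)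
  fix Y :: "'y measure" and H d \<epsilon> k and R :: "'w measure"
    and fallback :: "'w \<Rightarrow> (nat \<Rightarrow> real) \<Rightarrow> 'y strategy"
  let ?m = "num_centres 4194304 \<epsilon>" and ?l = "num_neighbours 524288 1024 d \<epsilon>" and ?\<delta> = "radius \<epsilon> k"
  let ?s = "sample_size ?m ?l ?\<delta>"
  assume "space Y \<noteq> {} \<and> H \<noteq> {} \<and> H \<subseteq> borel \<rightarrow>\<^sub>M Y \<and> measurably_well_behaved Y H \<and>
    zero_measure_crossings H \<and> graph_dim H = enat d \<and> d > 0 \<and> 0 < \<epsilon> \<and> \<epsilon> < 1 / 2 \<and> real k \<ge> 80 / \<epsilon>"
  then interpret NS_tester \<epsilon> d k Y H by unfold_locales auto
  assume "prob_space R \<and> (\<forall>\<omega>\<in>space R. \<forall>x\<in>space (iid {1..?s} uniform01).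
    query_bounded (fallback \<omega> x) {1..?s} (?m * (?l + 1)))"
  then show "is_tester uniform01 Y (piecewise k H) ?s (?m * (?l + 1)) \<epsilon> R
    (NS_procedure H k \<epsilon> ?m ?l ?\<delta> ?s fallback)"
    by (intro NS_procedure_is_tester) blast+
qed simp_all

end
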